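(* Let $H=\bigoplus_{n\ge0}H_n$ and $B=\bigoplus_{n\ge0}B_n$ be graded Hopf algebras such that $H$ is generated as an algebra by $H_0$ and $H_1$, and $B$ is generated by $B_0$ and $B_1$. Assume there exists a two-sided non-degenerate graded Hopf pairing $\psi:H\times B\to K$. Then the maps $j_H:H\to S_{H_0}(H_1)$ and $j_B:B\to S_{B_0}(B_1)$ are isomorphisms of graded Hopf algebras, where for such a graded Hopf algebra $X$ generated in degrees $0$ and $1$, $j_X:X\to S_{X_0}(X_1)$ denotes the unique graded Hopf algebra epimorphism whose restriction to $X_0\oplus X_1$ is the identity.
   Context: All objects are over a field $K$; "graded" means $\mathbb{Z}_{\ge0}$-graded. For a Hopf algebra $H$ write $\Delta_H(h)=\sum h_1\otimes h_2$, counit $\varepsilon_H$, antipode $S_H$, multiplication $m_H$. An $H$-Hopf bimodule is an $H$-bimodule $M$ (actions $h.m.h'$) which is also an $H$-bicomodule with left coaction $\rho_l(m)=\sum m_{-1}\otimes m_0\in H\otimes M$ and right coaction $\rho_r(m)=\sum m_0\otimes m_1\in M\otimes H$ such that $\rho_l(h.m.h')=\sum h_1m_{-1}h'_1\otimes h_2.m_0.h'_2$ and $\rho_r(h.m.h')=\sum h_1.m_0.h'_1\otimes h_2m_1h'_2$. A couple $(H,M)$ is a Hopf algebra $H$ with an $H$-Hopf bimodule $M$. A graded Hopf algebra is a Hopf algebra $H=\bigoplus_{n\ge0}H_n$ with $H_nH_m\subseteq H_{n+m}$, $1\in H_0$, $S_H(H_n)\subseteq H_n$, $\Delta_H(H_n)\subseteq\sum_{i+j=n}H_i\otimes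 H_j$, $\varepsilon_H(H_n)=0$ for $n>0$. Its associated couple is $(H_0,H_1)$: $H_1$ is an $H_0$-bimodule by multiplication and, writing $\Delta_H(m)=\rho_l(m)+\rho_r(m)$ with $\rho_l(m)\in H_0\otimes H_1$, $\rho_r(m)\in H_1\otimes H_0$ for $m\in H_1$, an $H_0$-Hopf bimodule. Cotensor Hopf algebra $\mathrm{Cot}_H(M)=H\oplus M\oplus M^{\square_H2}\oplus\cdots$: the cotensor coalgebra of the $H$-bicomodule $M$, with counit $\varepsilon_H$ on $H$ and $0$ in positive degrees, comultiplication $\Delta|_H=\Delta_H$ and, for $x=\sum m^1\square\cdots\square m^k\in M^{\square_H k}$, $\Delta(x)=\sum (m^1)_{-1}\otimes((m^1)_0\square\cdots\square m^k)+\sum_{i=1}^{k-1}(m^1\square\cdots\square m^i)\otimes(m^{i+1}\square\cdots\square m^k)+\sum(m^1\square\cdots\square(m^k)_0)\otimes(m^k)_1$; multiplication the unique graded coalgebra morphism $\mathrm{Cot}_H(M)\otimes\mathrm{Cot}_H(M)\to\mathrm{Cot}_H(M)$ equal to $m_H$ on $H\otimes H$ and sending $h\otimes n+n'\otimes h'$ to $h.n+n'.h'$ on $H\otimes M\oplus M\otimes H$; unit $1_H$. The quantum symmetric algebra $S_H(M)$ is the subalgebra of $\mathrm{Cot}_H(M)$ generated by $H\oplus M$, a graded sub-Hopf algebra. A Hopf pairing between Hopf algebras $H$ and $B$ is a bilinear $\phi:H\times B\to K$ with $\phi(1_H,b)=\varepsilon_B(b)$, $\phi(h,1_B)=\varepsilon_H(h)$,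 $\phi(h,bc)=\sum\phi(h_1,b)\phi(h_2,c)$, $\phi(hg,b)=\sum\phi(h,b_1)\phi(g,b_2)$, $\phi(S_H(h),b)=\phi(h,S_B(b))$; it is graded if $\phi(H_i,B_j)=0$ for $i\neq j$; it is two-sided non-degenerate if for every nonzero $b\in B$ some $h$ has $\phi(h,b)\ne0$ and for every nonzero $h\in H$ some $b$ has $\phi(h,b)\neq0$. *)

theory Defs
  imports Complex_Main "HOL-Library.Function_Algebras"
begin

text \<open>A vector space over the field 'k is a type 'x::ab_group_add together with a scalar
multiplication sc (assumed to satisfy the vector space axioms where relevant).
An element of the n-fold tensor power of 'x is represented by the form it induces on
n-tuples of linear functionals:  x1 (x) ... (x) xn  corresponds to
fs |-> fs 0 x1 * ... * fs (n-1) xn  (and 0 on non-linear arguments).  Over a field this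
representation is injective, hence canonical.\<close>

type_synonym ('x, 'k) tensor = "(nat \<Rightarrow> 'x \<Rightarrow> 'k) \<Rightarrow> 'k"

definition lin :: "('k \<Rightarrow> 'x \<Rightarrow> 'x) \<Rightarrow> ('x::plus \<Rightarrow> 'k::{plus,times}) \<Rightarrow> bool" where
  "lin sc f \<longleftrightarrow> (\<forall>x y. f (x + y) = f x + f y) \<and> (\<forall>c x. f (sc c x) = c * f x)"

definition ptensl :: "('k::field \<Rightarrow> 'x::plus \<Rightarrow> 'x) \<Rightarrow> 'x list \<Rightarrow> ('x, 'k) tensor" where
  "ptensl sc xs = (\<lambda>fs. if (\<forall>i<length xs. lin sc (fs i))
                         then (\<Prod>i<length xs. fs i (xs ! i)) else 0)"

definition tensors :: "('k::field \<Rightarrow> 'x::plus \<Rightarrow> 'x) \<Rightarrow> nat \<Rightarrow> 'x set \<Rightarrow> ('x, 'k) tensor set" where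
  "tensors sc n D = {sum_list (map (ptensl sc) vs) | vs.
                       \<forall>v\<in>set vs. length v = n \<and> set v \<subseteq> D}"

text \<open>Application of an n-multilinear map beta (defined on D^n) to an element t of D^{(x)n}:
 choose any representation t = sum of pure tensors with entries in D and sum up beta.
 (Well defined for multilinear beta.)\<close>
definition tapp :: "('k::field \<Rightarrow> 'x::plus \<Rightarrow> 'x) \<Rightarrow> nat \<Rightarrow> 'x set \<Rightarrow> ('x list \<Rightarrow> 'y::monoid_add)
                     \<Rightarrow> ('x, 'k) tensor \<Rightarrow> 'y" where
  "tapp sc n D \<beta> t = sum_list (map \<beta> (SOME vs. (\<forall>v\<in>set vs. length v = n \<and> set v \<subseteq> D)
                                               \<and> t = sum_list (map (ptensl sc) vs)))"

definition tscale :: "'k::times \<Rightarrow> ('x, 'k) tensor \<Rightarrow> ('x, 'k) tensor" where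
  "tscale c t = (\<lambda>fs. c * t fs)"

record ('h, 'k) ghopf =
  hscale :: "'k \<Rightarrow> 'h \<Rightarrow> 'h"
  hmult :: "'h \<Rightarrow> 'h \<Rightarrow> 'h"
  hone :: 'h
  hcomult :: "'h \<Rightarrow> ('h, 'k) tensor"
  hcounit :: "'h \<Rightarrow> 'k"
  hanti :: "'h \<Rightarrow> 'h"
  hgrad :: "nat \<Rightarrow> 'h set"

definition hopf_alg :: "('h::ab_group_add, 'k::field) ghopf \<Rightarrow> bool" where
  "hopf_alg X \<longleftrightarrow>
    (let sc = hscale X; m = hmult X; u = hone X; \<Delta> = hcomult X; \<epsilon> = hcounit X; S = hanti X in
     vector_space sc \<and>
     (\<forall>x y z. m (x + y) z = m x z + m y z \<and> m z (x + y) = m z x + m z y) \<and>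
     (\<forall>c x y. m (sc c x) y = sc c (m x y) \<and> m x (sc c y) = sc c (m x y)) \<and>
     (\<forall>x y z. m (m x y) z = m x (m y z)) \<and>
     (\<forall>x. m u x = x \<and> m x u = x) \<and>
     (\<forall>x. \<Delta> x \<in> tensors sc 2 UNIV) \<and>
     (\<forall>x y. \<Delta> (x + y) = \<Delta> x + \<Delta> y) \<and>
     (\<forall>c x. \<Delta> (sc c x) = tscale c (\<Delta> x)) \<and>
     lin sc \<epsilon> \<and>
     (\<forall>x. tapp sc 2 UNIV (\<lambda>v. tapp sc 2 UNIV (\<lambda>w. ptensl sc [w!0, w!1, v!1]) (\<Delta> (v!0))) (\<Delta> x)
        = tapp sc 2 UNIV (\<lambda>v. tapp sc 2 UNIV (\<lambda>w. ptensl sc [v!0, w!0, w!1]) (\<Delta> (v!1))) (\<Delta> x)) \<and>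
     (\<forall>x. tapp sc 2 UNIV (\<lambda>v. sc (\<epsilon> (v!0)) (v!1)) (\<Delta> x) = x \<and>
          tapp sc 2 UNIV (\<lambda>v. sc (\<epsilon> (v!1)) (v!0)) (\<Delta> x) = x) \<and>
     (\<forall>x y. \<Delta> (m x y) = tapp sc 2 UNIV (\<lambda>v. tapp sc 2 UNIV
                 (\<lambda>w. ptensl sc [m (v!0) (w!0), m (v!1) (w!1)]) (\<Delta> y)) (\<Delta> x)) \<and>
     \<Delta> u = ptensl sc [u, u] \<and>
     (\<forall>x y. \<epsilon> (m x y) = \<epsilon> x * \<epsilon> y) \<and> \<epsilon> u = 1 \<and>
     (\<forall>x y. S (x + y) = S x + S y) \<and> (\<forall>c x. S (sc c x) = sc c (S x)) \<and>
     (\<forall>x. tapp sc 2 UNIV (\<lambda>v. m (S (v!0)) (v!1)) (\<Delta> x) = sc (\<epsilon> x) u \<and>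
          tapp sc 2 UNIV (\<lambda>v. m (v!0) (S (v!1))) (\<Delta> x) = sc (\<epsilon> x) u))"

definition subspace_of :: "('k \<Rightarrow> 'h \<Rightarrow> 'h) \<Rightarrow> 'h::ab_group_add set \<Rightarrow> bool" where
  "subspace_of sc V \<longleftrightarrow> 0 \<in> V \<and> (\<forall>x\<in>V. \<forall>y\<in>V. x + y \<in> V) \<and> (\<forall>c. \<forall>x\<in>V. sc c x \<in> V)"

definition dsum_decomp :: "(nat \<Rightarrow> 'h::ab_group_add set) \<Rightarrow> 'h \<Rightarrow> (nat \<Rightarrow> 'h) \<Rightarrow> bool" where
  "dsum_decomp G x c \<longleftrightarrow> (\<forall>n. c n \<in> G n) \<and> finite {n. c n \<noteq> 0} \<and> x = (\<Sum>n\<in>{n. c n \<noteq> 0}. c n)"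

definition gtensors2 :: "('k::field \<Rightarrow> 'h::ab_group_add \<Rightarrow> 'h) \<Rightarrow> (nat \<Rightarrow> 'h set) \<Rightarrow> nat \<Rightarrow> ('h, 'k) tensor set" where
  "gtensors2 sc G n = {sum_list (map (ptensl sc) vs) | vs.
       \<forall>v\<in>set vs. \<exists>i\<le>n. \<exists>a b. v = [a, b] \<and> a \<in> G i \<and> b \<in> G (n - i)}"

definition graded_hopf :: "('h::ab_group_add, 'k::field) ghopf \<Rightarrow> bool" where
  "graded_hopf X \<longleftrightarrow> hopf_alg X \<and>
     (\<forall>n. subspace_of (hscale X) (hgrad X n)) \<and>
     (\<forall>x. \<exists>!c. dsum_decomp (hgrad X) x c) \<and>
     (\<forall>i j x y. x \<in> hgrad X i \<longrightarrow> y \<in> hgrad X j \<longrightarrow> hmult X x y \<in> hgrad X (i + j)) \<and>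
     hone X \<in> hgrad X 0 \<and>
     (\<forall>n x. x \<in> hgrad X n \<longrightarrow> hanti X x \<in> hgrad X n) \<and>
     (\<forall>n x. x \<in> hgrad X n \<longrightarrow> hcomult X x \<in> gtensors2 (hscale X) (hgrad X) n) \<and>
     (\<forall>n x. 0 < n \<longrightarrow> x \<in> hgrad X n \<longrightarrow> hcounit X x = 0)"

definition proj :: "('h::ab_group_add, 'k) ghopf \<Rightarrow> nat \<Rightarrow> 'h \<Rightarrow> 'h" where
  "proj X n x = (THE c. dsum_decomp (hgrad X) x c) n"

inductive_set alg_gen :: "('h::ab_group_add, 'k) ghopf \<Rightarrow> 'h set \<Rightarrow> 'h set"
  for X :: "('h, 'k) ghopf" and G :: "'h set" where
  gen: "x \<in> G \<Longrightarrow> x \<in> alg_gen X G"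
| one: "hone X \<in> alg_gen X G"
| add: "x \<in> alg_gen X G \<Longrightarrow> y \<in> alg_gen X G \<Longrightarrow> x + y \<in> alg_gen X G"
| scale: "x \<in> alg_gen X G \<Longrightarrow> hscale X c x \<in> alg_gen X G"
| mult: "x \<in> alg_gen X G \<Longrightarrow> y \<in> alg_gen X G \<Longrightarrow> hmult X x y \<in> alg_gen X G"

definition generated_deg01 :: "('h::ab_group_add, 'k) ghopf \<Rightarrow> bool" where
  "generated_deg01 X \<longleftrightarrow> alg_gen X (hgrad X 0 \<union> hgrad X 1) = UNIV"

definition hopf_pairing :: "('h::ab_group_add, 'k::field) ghopf \<Rightarrow> ('b::ab_group_add, 'k) ghopf
                             \<Rightarrow> ('h \<Rightarrow> 'b \<Rightarrow> 'k) \<Rightarrow> bool" where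
  "hopf_pairing H B \<psi> \<longleftrightarrow>
     (\<forall>h h' b. \<psi> (h + h') b = \<psi> h b + \<psi> h' b) \<and>
     (\<forall>h b b'. \<psi> h (b + b') = \<psi> h b + \<psi> h b') \<and>
     (\<forall>c h b. \<psi> (hscale H c h) b = c * \<psi> h b) \<and>
     (\<forall>c h b. \<psi> h (hscale B c b) = c * \<psi> h b) \<and>
     (\<forall>b. \<psi> (hone H) b = hcounit B b) \<and>
     (\<forall>h. \<psi> h (hone B) = hcounit H h) \<and>
     (\<forall>h b b'. \<psi> h (hmult B b b') =
         tapp (hscale H) 2 UNIV (\<lambda>v. \<psi> (v!0) b * \<psi> (v!1) b') (hcomult H h)) \<and>
     (\<forall>h h' b. \<psi> (hmult H h h') b =
         tapp (hscale B) 2 UNIV (\<lambda>v. \<psi> h (v!0) * \<psi> h' (v!1)) (hcomult B b)) \<and>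
     (\<forall>h b. \<psi> (hanti H h) b = \<psi> h (hanti B b))"

definition graded_pairing :: "('h, 'k) ghopf \<Rightarrow> ('b, 'k) ghopf \<Rightarrow> ('h \<Rightarrow> 'b \<Rightarrow> 'k::zero) \<Rightarrow> bool" where
  "graded_pairing H B \<psi> \<longleftrightarrow>
     (\<forall>i j h b. i \<noteq> j \<longrightarrow> h \<in> hgrad H i \<longrightarrow> b \<in> hgrad B j \<longrightarrow> \<psi> h b = 0)"

definition two_sided_nondeg :: "('h::zero \<Rightarrow> 'b::zero \<Rightarrow> 'k::zero) \<Rightarrow> bool" where
  "two_sided_nondeg \<psi> \<longleftrightarrow> (\<forall>b. b \<noteq> 0 \<longrightarrow> (\<exists>h. \<psi> h b \<noteq> 0)) \<and> (\<forall>h. h \<noteq> 0 \<longrightarrow> (\<exists>b. \<psi> h b \<noteq> 0))"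

text \<open>A couple (A, M): A and M are subspaces of an ambient space 'v; A carries the Hopf algebra
 operations, M the bimodule actions and the coactions (with values in 2-tensors).\<close>
record ('v, 'k) couple =
  csc :: "'k \<Rightarrow> 'v \<Rightarrow> 'v"
  cA :: "'v set"
  cM :: "'v set"
  cmult :: "'v \<Rightarrow> 'v \<Rightarrow> 'v"
  cone :: 'v
  ccomult :: "'v \<Rightarrow> ('v, 'k) tensor"
  ccounit :: "'v \<Rightarrow> 'k"
  clact :: "'v \<Rightarrow> 'v \<Rightarrow> 'v"
  cract :: "'v \<Rightarrow> 'v \<Rightarrow> 'v"
  crhol :: "'v \<Rightarrow> ('v, 'k) tensor"
  crhor :: "'v \<Rightarrow> ('v, 'k) tensor"

definition assoc_couple :: "('h::ab_group_add, 'k::field) ghopf \<Rightarrow> ('h, 'k) couple" where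
  "assoc_couple X =
    \<lparr> csc = hscale X, cA = hgrad X 0, cM = hgrad X 1, cmult = hmult X, cone = hone X,
      ccomult = hcomult X, ccounit = hcounit X, clact = hmult X, cract = hmult X,
      crhol = (\<lambda>m. tapp (hscale X) 2 UNIV
                  (\<lambda>v. ptensl (hscale X) [proj X 0 (v!0), proj X 1 (v!1)]) (hcomult X m)),
      crhor = (\<lambda>m. tapp (hscale X) 2 UNIV
                  (\<lambda>v. ptensl (hscale X) [proj X 1 (v!0), proj X 0 (v!1)]) (hcomult X m)) \<rparr>"

text \<open>Elements of Cot_A(M): families x with x 0 = a (as a 1-tensor), a in A, and x n in M^{box n}
 (as n-tensors) for n >= 1, finitely many nonzero.\<close>
type_synonym ('v, 'k) cot = "nat \<Rightarrow> ('v, 'k) tensor"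

definition cscale :: "'k::times \<Rightarrow> ('v, 'k) cot \<Rightarrow> ('v, 'k) cot" where
  "cscale c x = (\<lambda>n. tscale c (x n))"

definition emb0 :: "('v::plus, 'k::field) couple \<Rightarrow> 'v \<Rightarrow> ('v, 'k) cot" where
  "emb0 C a = (\<lambda>n. if n = 0 then ptensl (csc C) [a] else 0)"

definition embn :: "nat \<Rightarrow> ('v, 'k::zero) tensor \<Rightarrow> ('v, 'k) cot" where
  "embn n t = (\<lambda>k. if k = n then t else 0)"

definition emb1 :: "('v::plus, 'k::field) couple \<Rightarrow> 'v \<Rightarrow> ('v, 'k) cot" where
  "emb1 C m = embn 1 (ptensl (csc C) [m])"

definition cot_one :: "('v::plus, 'k::field) couple \<Rightarrow> ('v, 'k) cot" where
  "cot_one C = emb0 C (cone C)"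

text \<open>apply a coaction rho at position i of an n-tensor, giving an (n+1)-tensor\<close>
definition coinsert :: "('k::field \<Rightarrow> 'v::plus \<Rightarrow> 'v) \<Rightarrow> ('v \<Rightarrow> ('v, 'k) tensor) \<Rightarrow> nat \<Rightarrow> nat
                        \<Rightarrow> ('v, 'k) tensor \<Rightarrow> ('v, 'k) tensor" where
  "coinsert sc \<rho> n i t = (\<lambda>fs. if (\<forall>j<Suc n. lin sc (fs j))
      then t (\<lambda>j. if j < i then fs j else if j = i then (\<lambda>m. \<rho> m (\<lambda>l. fs (i + l))) else fs (Suc j))
      else 0)"

definition cotens :: "('v::plus, 'k::field) couple \<Rightarrow> nat \<Rightarrow> ('v, 'k) tensor set" where
  "cotens C n = (if n = 0 then {} else
     {t \<in> tensors (csc C) n (cM C). \<forall>i. Suc i < n \<longrightarrow>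
         coinsert (csc C) (crhor C) n i t = coinsert (csc C) (crhol C) n (Suc i) t})"

definition cot_carrier :: "('v::plus, 'k::field) couple \<Rightarrow> ('v, 'k) cot set" where
  "cot_carrier C = {x. x 0 \<in> {ptensl (csc C) [a] | a. a \<in> cA C} \<and>
                       (\<forall>n>0. x n \<in> cotens C n) \<and> finite {n. x n \<noteq> 0}}"

definition cot_deg :: "('v::plus, 'k::field) couple \<Rightarrow> nat \<Rightarrow> ('v, 'k) cot set" where
  "cot_deg C n = {x \<in> cot_carrier C. \<forall>k. k \<noteq> n \<longrightarrow> x k = 0}"

definition comult_hom :: "('v::plus, 'k::field) couple \<Rightarrow> nat \<Rightarrow> ('v, 'k) tensor
                          \<Rightarrow> (('v, 'k) cot, 'k) tensor" where
  "comult_hom C k t = (let sc = csc C in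
    if k = 0 then
      tapp sc 1 UNIV (\<lambda>v. tapp sc 2 UNIV
           (\<lambda>w. ptensl cscale [emb0 C (w!0), emb0 C (w!1)]) (ccomult C (v!0))) t
    else
      tapp sc k UNIV (\<lambda>v. tapp sc 2 UNIV
           (\<lambda>w. ptensl cscale [emb0 C (w!0), embn k (ptensl sc ((w!1) # tl v))]) (crhol C (v!0))) t
    + (\<Sum>i\<in>{1..<k}. tapp sc k UNIV
           (\<lambda>v. ptensl cscale [embn i (ptensl sc (take i v)), embn (k - i) (ptensl sc (drop i v))]) t)
    + tapp sc k UNIV (\<lambda>v. tapp sc 2 UNIV
           (\<lambda>w. ptensl cscale [embn k (ptensl sc (butlast v @ [w!0])), emb0 C (w!1)]) (crhor C (last v))) t)"

definition cot_comult :: "('v::plus, 'k::field) couple \<Rightarrow> ('v, 'k) cot \<Rightarrow> (('v, 'k) cot, 'k) tensor" where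
  "cot_comult C x = (\<Sum>k\<in>{k. x k \<noteq> 0}. comult_hom C k (x k))"

definition cot_counit :: "('v::plus, 'k::field) couple \<Rightarrow> ('v, 'k) cot \<Rightarrow> 'k" where
  "cot_counit C x = tapp (csc C) 1 UNIV (\<lambda>v. ccounit C (v!0)) (x 0)"

definition CC :: "('v::plus, 'k::field) couple \<Rightarrow> (('v, 'k) cot, 'k) tensor set" where
  "CC C = tensors cscale 2 (cot_carrier C)"

definition cc_deg :: "('v::plus, 'k::field) couple \<Rightarrow> nat \<Rightarrow> (('v, 'k) cot, 'k) tensor set" where
  "cc_deg C n = {sum_list (map (ptensl cscale) vs) | vs. \<forall>v\<in>set vs.
      \<exists>i j x y. v = [x, y] \<and> x \<in> cot_deg C i \<and> y \<in> cot_deg C j \<and> i + j = n}"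

definition cc_comult :: "('v::plus, 'k::field) couple \<Rightarrow> (('v, 'k) cot, 'k) tensor
                         \<Rightarrow> ((('v, 'k) cot, 'k) tensor, 'k) tensor" where
  "cc_comult C u = tapp cscale 2 (cot_carrier C) (\<lambda>v.
      tapp cscale 2 UNIV (\<lambda>p. tapp cscale 2 UNIV (\<lambda>q.
          ptensl tscale [ptensl cscale [p!0, q!0], ptensl cscale [p!1, q!1]])
        (cot_comult C (v!1))) (cot_comult C (v!0))) u"

definition cc_counit :: "('v::plus, 'k::field) couple \<Rightarrow> (('v, 'k) cot, 'k) tensor \<Rightarrow> 'k" where
  "cc_counit C u = tapp cscale 2 (cot_carrier C) (\<lambda>v. cot_counit C (v!0) * cot_counit C (v!1)) u"

text \<open>the multiplication of Cot: the unique graded coalgebra morphism Cot (x) Cot -> Cot which is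
 m_A on A (x) A and h (x) n + n' (x) h' |-> h.n + n'.h' in degree 1 (set to 0 off Cot (x) Cot)\<close>
definition is_cot_mult :: "('v::plus, 'k::field) couple \<Rightarrow> ((('v, 'k) cot, 'k) tensor \<Rightarrow> ('v, 'k) cot) \<Rightarrow> bool" where
  "is_cot_mult C \<mu> \<longleftrightarrow>
     (\<forall>u. u \<notin> CC C \<longrightarrow> \<mu> u = 0) \<and>
     (\<forall>u\<in>CC C. \<mu> u \<in> cot_carrier C) \<and>
     (\<forall>u\<in>CC C. \<forall>u'\<in>CC C. \<mu> (u + u') = \<mu> u + \<mu> u') \<and>
     (\<forall>c. \<forall>u\<in>CC C. \<mu> (tscale c u) = cscale c (\<mu> u)) \<and>
     (\<forall>n. \<forall>u\<in>cc_deg C n. \<mu> u \<in> cot_deg C n) \<and>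
     (\<forall>u\<in>CC C. cot_comult C (\<mu> u) =
          tapp tscale 2 (CC C) (\<lambda>v. ptensl cscale [\<mu> (v!0), \<mu> (v!1)]) (cc_comult C u)) \<and>
     (\<forall>u\<in>CC C. cot_counit C (\<mu> u) = cc_counit C u) \<and>
     (\<forall>a\<in>cA C. \<forall>b\<in>cA C. \<mu> (ptensl cscale [emb0 C a, emb0 C b]) = emb0 C (cmult C a b)) \<and>
     (\<forall>h\<in>cA C. \<forall>m\<in>cM C. \<mu> (ptensl cscale [emb0 C h, emb1 C m]) = emb1 C (clact C h m) \<and>
                          \<mu> (ptensl cscale [emb1 C m, emb0 C h]) = emb1 C (cract C m h))"

definition cot_mult :: "('v::plus, 'k::field) couple \<Rightarrow> (('v, 'k) cot, 'k) tensor \<Rightarrow> ('v, 'k) cot" where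
  "cot_mult C = (THE \<mu>. is_cot_mult C \<mu>)"

definition cot_times :: "('v::plus, 'k::field) couple \<Rightarrow> ('v, 'k) cot \<Rightarrow> ('v, 'k) cot \<Rightarrow> ('v, 'k) cot" where
  "cot_times C x y = cot_mult C (ptensl cscale [x, y])"

inductive_set qsym :: "('v::plus, 'k::field) couple \<Rightarrow> ('v, 'k) cot set"
  for C :: "('v, 'k) couple" where
  deg0: "a \<in> cA C \<Longrightarrow> emb0 C a \<in> qsym C"
| deg1: "m \<in> cM C \<Longrightarrow> emb1 C m \<in> qsym C"
| add: "x \<in> qsym C \<Longrightarrow> y \<in> qsym C \<Longrightarrow> x + y \<in> qsym C"
| scale: "x \<in> qsym C \<Longrightarrow> cscale c x \<in> qsym C"
| mult: "x \<in> qsym C \<Longrightarrow> y \<in> qsym C \<Longrightarrow> cot_times C x y \<in> qsym C"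

text \<open>graded Hopf algebra morphism X -> S_{X_0}(X_1) (a bialgebra morphism between Hopf algebras;
 compatibility with antipodes is then automatic)\<close>
definition qsym_hom :: "('h::ab_group_add, 'k::field) ghopf \<Rightarrow> ('h \<Rightarrow> ('h, 'k) cot) \<Rightarrow> bool" where
  "qsym_hom X j \<longleftrightarrow> (let C = assoc_couple X in
     range j \<subseteq> qsym C \<and>
     (\<forall>x y. j (x + y) = j x + j y) \<and> (\<forall>c x. j (hscale X c x) = cscale c (j x)) \<and>
     (\<forall>n. \<forall>x\<in>hgrad X n. j x \<in> cot_deg C n) \<and>
     (\<forall>x y. j (hmult X x y) = cot_times C (j x) (j y)) \<and> j (hone X) = cot_one C \<and>
     (\<forall>x. cot_comult C (j x) =
          tapp (hscale X) 2 UNIV (\<lambda>v. ptensl cscale [j (v!0), j (v!1)]) (hcomult X x)) \<and>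
     (\<forall>x. cot_counit C (j x) = hcounit X x))"

definition id_on_deg01 :: "('h::ab_group_add, 'k::field) ghopf \<Rightarrow> ('h \<Rightarrow> ('h, 'k) cot) \<Rightarrow> bool" where
  "id_on_deg01 X j \<longleftrightarrow> (let C = assoc_couple X in
     (\<forall>x\<in>hgrad X 0. j x = emb0 C x) \<and> (\<forall>x\<in>hgrad X 1. j x = emb1 C x))"

definition j_is_iso :: "('h::ab_group_add, 'k::field) ghopf \<Rightarrow> bool" where
  "j_is_iso X \<longleftrightarrow>
     (\<exists>j. qsym_hom X j \<and> id_on_deg01 X j \<and> bij_betw j UNIV (qsym (assoc_couple X))) \<and>
     (\<forall>j. qsym_hom X j \<and> id_on_deg01 X j \<and> range j = qsym (assoc_couple X)
          \<longrightarrow> bij_betw j UNIV (qsym (assoc_couple X)))"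

end

theory Submission
  imports Defs
begin

text \<open>
Since a tensor is represented by its values on functionals, \<open>\<Delta> x\<close> applied to \<open>(f, g)\<close> is the
convolution product of \<open>f\<close> and \<open>g\<close> at \<open>x\<close>. The elements of \<open>Cot\<close> are separated by the
functionals that evaluate the component of degree \<open>n\<close> on \<open>g\<^sub>1, \<dots>, g\<^sub>n\<close> (or the component of
degree 0 on \<open>a\<close>). These pure functionals are closed under convolution, and a family of tensors
lies in \<open>Cot\<close> exactly when their product is associative on it. Testing on pure functionals shows
that \<open>Cot\<close> and \<open>Cot \<otimes> Cot\<close> are coalgebras, and that a graded coalgebra \<open>D\<close> with compatible maps
\<open>f\<^sub>0\<close> to \<open>X\<^sub>0\<close> and \<open>f\<^sub>1\<close> to \<open>X\<^sub>1\<close> has exactly one graded coalgebra morphism to \<open>Cot\<close> extending them: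
its component of degree \<open>n\<close>, evaluated on \<open>g\<^sub>1, \<dots>, g\<^sub>n\<close>, is the convolution product of the
\<open>g\<^sub>i \<circ> f\<^sub>1\<close>. For \<open>D = Cot \<otimes> Cot\<close> this is the multiplication of \<open>Cot\<close>, for \<open>D = X\<close> it is \<open>j\<close>.

Let \<open>x\<close> of degree \<open>n \<ge> 2\<close> be in the kernel of \<open>j\<close>. Then \<open>j \<otimes> j\<close> kills \<open>\<Delta> x\<close>. By induction \<open>j\<close> is
injective in degrees 1 and \<open>n - 1\<close>, so \<open>\<psi>(x, b b') = 0\<close> for \<open>b\<close> of degree 1 and \<open>b'\<close> of degree
\<open>n - 1\<close>. Such products span the degree \<open>n\<close> part of the other algebra, so \<open>x\<close> is orthogonal to it
and vanishes.
\<close>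

section \<open>Functionals and multilinear maps\<close>

text \<open>The encoding fixes what has to be proved. \<open>tapp\<close> evaluates a representation
  picked by \<open>SOME\<close>, so each use of it computes only after a multilinearity proof.
  Carriers are subspaces of a type, while functionals live on the whole type, so convolution is
  precomposed with a projection. The multiplication of Cot is a definite description, so its
  uniqueness is needed before any product can be computed. The obstacle in Cot is that pure
  functionals are formal words: when a functional of degree 0 stands between two of positive degree,
  the two bracketings are different lists and agree only after evaluation on Cot. Every
  associativity argument therefore separates this pattern from the others. Generation in degrees 0
  and 1 enters from both sides: for the algebra at hand it makes \<open>j\<close> surjective onto
  the quantum symmetric algebra, and for its partner it makes products of degrees 1 and
  \<open>n - 1\<close> span degree \<open>n\<close>.\<close>

lemma sum_list_fun_apply: "sum_list fs x = sum_list (map (\<lambda>f. f x) fs)"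
  by (induction fs) auto

lemma sum_list_swap:
  "(\<Sum>x\<leftarrow>xs. \<Sum>y\<leftarrow>ys. f x y) = (\<Sum>y\<leftarrow>ys. \<Sum>x\<leftarrow>xs. (f x y :: 'a::comm_monoid_add))"
  by (induction xs) (auto simp: sum_list_addf)

lemma lin_add: "lin sc f \<Longrightarrow> f (x + y) = f x + f y"
  and lin_scale: "lin sc f \<Longrightarrow> f (sc c x) = c * f x"
  by (auto simp: lin_def)

lemma lin_0: "lin sc f \<Longrightarrow> f (0::'x::ab_group_add) = (0::'k::field)"
  using lin_add[of sc f 0 0] by (metis add_cancel_right_right)

lemma lin_diff: "lin sc f \<Longrightarrow> f (x - y) = f (x::'x::ab_group_add) - (f y::'k::field)"
  using lin_add[of sc f "x - y" y] by (simp add: algebra_simps)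

lemma lin_sum_list: "lin sc f \<Longrightarrow> f (sum_list xs) = (\<Sum>x\<leftarrow>xs. f (x::'x::ab_group_add) :: 'k::field)"
  by (induction xs) (auto simp: lin_0 lin_add)

lemma lin_sum: "lin sc f \<Longrightarrow> f (sum g S) = (\<Sum>x\<in>S. f (g x::'x::ab_group_add) :: 'k::field)"
  by (induction S rule: infinite_finite_induct) (auto simp: lin_0 lin_add)

lemma vs_zero_right: "vector_space sc \<Longrightarrow> sc c 0 = 0"
  and vs_zero_left: "vector_space sc \<Longrightarrow> sc 0 x = 0"
  and vs_one: "vector_space sc \<Longrightarrow> sc 1 x = x"
  by (simp_all add: module.scale_zero_right module.scale_zero_left module.scale_one flip: module_iff_vector_space)

lemma subspace_of_iff: "vector_space sc \<Longrightarrow> subspace_of sc V \<longleftrightarrow> module.subspace sc V"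
  using module.subspace_def[of sc V] by (auto simp: subspace_of_def module_iff_vector_space)

lemma subspace_of_UNIV [simp]: "subspace_of sc UNIV"
  by (auto simp: subspace_of_def)

lemma subspace_of_0: "subspace_of sc V \<Longrightarrow> 0 \<in> V"
  and subspace_of_add: "subspace_of sc V \<Longrightarrow> x \<in> V \<Longrightarrow> y \<in> V \<Longrightarrow> x + y \<in> V"
  and subspace_of_scale: "subspace_of sc V \<Longrightarrow> x \<in> V \<Longrightarrow> sc c x \<in> V"
  by (auto simp: subspace_of_def)

lemma subspace_of_sum_list: "subspace_of sc V \<Longrightarrow> set xs \<subseteq> V \<Longrightarrow> sum_list xs \<in> V"
  by (induction xs) (auto simp: subspace_of_def)

lemma subspace_of_sum: "subspace_of sc V \<Longrightarrow> (\<And>x. x \<in> S \<Longrightarrow> f x \<in> V) \<Longrightarrow> sum f S \<in> V"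
  by (induction S rule: infinite_finite_induct) (auto simp: subspace_of_def)

lemma subspace_of_diff:
  "vector_space sc \<Longrightarrow> subspace_of sc V \<Longrightarrow> x \<in> V \<Longrightarrow> y \<in> V \<Longrightarrow> x - y \<in> V"
  by (metis subspace_of_iff module.subspace_diff module_iff_vector_space)

lemma vector_space_field: "vector_space ((*) :: 'k::field \<Rightarrow> 'k \<Rightarrow> 'k)"
  by (unfold_locales) (auto simp: algebra_simps)

lemma lin_iff: 
  fixes sc :: "'k::field \<Rightarrow> 'x::ab_group_add \<Rightarrow> 'x"
  assumes "vector_space sc" shows "lin sc f \<longleftrightarrow> Vector_Spaces.linear sc (*) f"
  using assms vector_space_field
  by (auto simp: lin_def Vector_Spaces.linear_iff)

text \<open>A basis of \<open>V\<close> stays independent when \<open>x\<close> is added, so a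
  linear functional can be 1 on \<open>x\<close> and 0 on that basis.\<close>

lemma separating_functional:
  fixes sc :: "'k::field \<Rightarrow> 'x::ab_group_add \<Rightarrow> 'x"
  assumes vs: "vector_space sc" and V: "subspace_of sc V" and x: "x \<notin> V"
  shows "\<exists>f. lin sc f \<and> (\<forall>v\<in>V. f v = 0) \<and> f x \<noteq> 0"
proof -
  interpret vector_space sc by fact
  interpret vp: vector_space_pair sc "(*) :: 'k \<Rightarrow> 'k \<Rightarrow> 'k"
    by (simp add: vector_space_pair_def vs vector_space_field)
  have sV: "subspace V" using V vs subspace_of_iff by blast
  obtain b where b: "b \<subseteq> V" "independent b" "V \<subseteq> span b"
    by (rule maximal_independent_subset)
  have "span b \<subseteq> V" using b(1) sV by (rule span_minimal)
  hence "x \<notin> span b" using x by blast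
  hence "independent (insert x b)" using b by (intro independent_insertI)
  then obtain g where g: "Vector_Spaces.linear sc (*) g" "\<forall>y\<in>insert x b. g y = (if y = x then 1 else 0)"
    using vp.linear_independent_extend[of "insert x b" "\<lambda>y. if y = x then 1 else 0"] by blast
  have "g v = 0" if "v \<in> span b" for v
    by (rule vp.linear_eq_0_on_span[OF g(1) _ that]) (use g(2) x b in auto)
  thus ?thesis using g vs b(3) by (intro exI[of _ g]) (auto simp: lin_iff)
qed

lemma functional_separates:
  fixes sc :: "'k::field \<Rightarrow> 'x::ab_group_add \<Rightarrow> 'x"
  assumes "vector_space sc" "x \<noteq> 0"
  shows "\<exists>f. lin sc f \<and> f x \<noteq> 0"
  using separating_functional[of sc "{0}" x] assms
  by (auto simp: subspace_of_def vs_zero_right)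

lemma functional_eqI:
  fixes sc :: "'k::field \<Rightarrow> 'x::ab_group_add \<Rightarrow> 'x"
  assumes "vector_space sc" "\<And>f. lin sc f \<Longrightarrow> f x = f y"
  shows "x = y"
  using functional_separates[of sc "x - y"] assms lin_diff[of sc] by (metis eq_iff_diff_eq_0)

definition is_prj :: "('k::field \<Rightarrow> 'x::ab_group_add \<Rightarrow> 'x) \<Rightarrow> 'x set \<Rightarrow> ('x \<Rightarrow> 'x) \<Rightarrow> bool" where
  "is_prj sc V P \<longleftrightarrow> range P \<subseteq> V \<and> (\<forall>x\<in>V. P x = x) \<and> (\<forall>x y. P (x + y) = P x + P y) \<and>
     (\<forall>c x. P (sc c x) = sc c (P x))"

text \<open>Serves two purposes: with the identity as \<open>L\<close> it gives a projection onto
  \<open>V\<close>, and with \<open>L = j\<close> on a homogeneous part it rewrites functionals on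
  that part as functionals on Cot.\<close>

lemma left_inverse_on:
  fixes sc :: "'k::field \<Rightarrow> 'x::ab_group_add \<Rightarrow> 'x" and sc' :: "'k \<Rightarrow> 'y::ab_group_add \<Rightarrow> 'y"
  assumes "vector_space sc" "vector_space sc'" "subspace_of sc V"
    and "\<And>x y. L (x + y) = L x + L y" "\<And>c x. L (sc c x) = sc' c (L x)"
    and "\<And>x. x \<in> V \<Longrightarrow> L x = 0 \<Longrightarrow> x = 0"
  shows "\<exists>G. range G \<subseteq> V \<and> (\<forall>x y. G (x + y) = G x + G y) \<and> (\<forall>c x. G (sc' c x) = sc c (G x)) \<and>
    (\<forall>x\<in>V. G (L x) = x)"
proof -
  interpret vector_space_pair sc sc' by (simp add: vector_space_pair_def assms)
  have L: "Vector_Spaces.linear sc sc' L"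
    by (unfold_locales) (auto simp: assms)
  have V: "vs1.subspace V" using assms subspace_of_iff by blast
  have "inj_on L V"
    using linear_inj_on_iff_eq_0[OF L V] assms(6) by blast
  from linear_exists_left_inverse_on[OF L V this] obtain g where
   g: "range g \<subseteq> V" "Vector_Spaces.linear sc' sc g" "\<forall>v\<in>V. g (L v) = v" by blast
  interpret g: Vector_Spaces.linear sc' sc g by fact
  show ?thesis using g g.add g.scale by blast
qed

lemma is_prj_ex:
  fixes sc :: "'k::field \<Rightarrow> 'x::ab_group_add \<Rightarrow> 'x"
  assumes "vector_space sc" "subspace_of sc V"
  shows "\<exists>P. is_prj sc V P"
  using left_inverse_on[OF assms(1,1,2), of "\<lambda>x. x"] unfolding is_prj_def by auto

text \<open>Functionals on a subspace are represented by functionals on the whole type that factor through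
this fixed projection onto it.\<close>

definition prj :: "('k::field \<Rightarrow> 'x::ab_group_add \<Rightarrow> 'x) \<Rightarrow> 'x set \<Rightarrow> 'x \<Rightarrow> 'x" where
  "prj sc V = (SOME P. is_prj sc V P)"

lemma is_prj_prj:
  fixes sc :: "'k::field \<Rightarrow> 'x::ab_group_add \<Rightarrow> 'x"
  assumes "vector_space sc" "subspace_of sc V"
  shows "is_prj sc V (prj sc V)"
  unfolding prj_def using is_prj_ex[OF assms] by (rule someI_ex)

section \<open>Multilinear maps and independence of the chosen representation\<close>

definition mlin :: "('k::field \<Rightarrow> 'x::ab_group_add \<Rightarrow> 'x) \<Rightarrow> 'x set \<Rightarrow> nat \<Rightarrow>
    ('k \<Rightarrow> 'y::ab_group_add \<Rightarrow> 'y) \<Rightarrow> ('x list \<Rightarrow> 'y) \<Rightarrow> bool" where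
  "mlin sc D n s \<beta> \<longleftrightarrow> (\<forall>v i x y c. length v = n \<longrightarrow> i < n \<longrightarrow> set v \<subseteq> D \<longrightarrow> x \<in> D \<longrightarrow> y \<in> D \<longrightarrow>
     \<beta> (v[i := x + y]) = \<beta> (v[i := x]) + \<beta> (v[i := y]) \<and> \<beta> (v[i := sc c x]) = s c (\<beta> (v[i := x])))"

lemma mlin_Cons:
  assumes "mlin sc D (Suc n) s \<beta>" "x \<in> D"
  shows "mlin sc D n s (\<lambda>v. \<beta> (x # v))"
  unfolding mlin_def
proof (intro allI impI, goal_cases)
  case (1 v i a b c)
  show ?case using assms(1)[unfolded mlin_def, rule_format, of "x # v" "Suc i" a b c] 1 assms(2) by auto
qed

lemma mlin_head:
  assumes "mlin sc D (Suc n) s \<beta>" "set v \<subseteq> D" "length v = n" "x \<in> D" "y \<in> D"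
  shows "\<beta> ((x + y) # v) = \<beta> (x # v) + \<beta> (y # v)" "\<beta> (sc c x # v) = s c (\<beta> (x # v))"
  using assms(1)[unfolded mlin_def, rule_format, of "x # v" 0 x y c] assms by auto

lemma mlin_head_sum:
  assumes "mlin sc D (Suc n) s \<beta>" "set v \<subseteq> D" "length v = n" and vs: "vector_space sc" "vector_space s"
    and D: "subspace_of sc D"
    and "finite S" "\<And>b. b \<in> S \<Longrightarrow> w b \<in> D"
  shows "\<beta> ((\<Sum>b\<in>S. sc (r b) (w b)) # v) = (\<Sum>b\<in>S. s (r b) (\<beta> (w b # v)))"
  using assms(7,8)
proof (induction S rule: finite_induct)
  case empty
  have "\<beta> (sc 0 0 # v) = s 0 (\<beta> (0 # v))"
    using mlin_head(2)[OF assms(1-3), of 0 0 0] D by (auto simp: subspace_of_def)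
  thus ?case by (simp add: vs_zero_right[OF vs(1)] vs_zero_left[OF vs(2)])
next
  case (insert b S)
  have 1: "(\<Sum>b\<in>S. sc (r b) (w b)) \<in> D"
    by (rule subspace_of_sum[OF D]) (use insert D in \<open>auto simp: subspace_of_def\<close>)
  have 2: "sc (r b) (w b) \<in> D" using insert D by (auto simp: subspace_of_def)
  show ?case using insert mlin_head[OF assms(1-3)] 1 2 by simp
qed

text \<open>The head is expanded by linearity in the first slot, the other slots by induction. The
  coefficients \<open>r\<close> are left abstract; \<open>mlin_well_defined\<close> takes coordinate
  functionals for them.\<close>

lemma mlin_expand:
  fixes sc :: "'k::field \<Rightarrow> 'x::ab_group_add \<Rightarrow> 'x"
  assumes vs: "vector_space sc" "vector_space s" and D: "subspace_of sc D" and S: "finite S" "S \<subseteq> D"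
    and "mlin sc D n s \<beta>" "length v = n" "\<And>x. x \<in> set v \<Longrightarrow> x = (\<Sum>b\<in>S. sc (r b x) b)"
  shows "\<beta> v = (\<Sum>bs\<in>{bs. set bs \<subseteq> S \<and> length bs = n}. s (\<Prod>i<n. r (bs ! i) (v ! i)) (\<beta> bs))"
  using assms(6-)
proof (induction n arbitrary: \<beta> v)
  case 0
  have "{bs. set bs \<subseteq> S \<and> length bs = 0} = {[]}" by auto
  thus ?case using 0 by (simp add: vs_one[OF vs(2)])
next
  case (Suc n)
  interpret s: vector_space s by fact
  obtain x xs where v: "v = x # xs" "length xs = n" using Suc.prems(2) by (cases v) auto
  have inD: "y \<in> D" if "y \<in> set v" for y
    using Suc.prems(3)[OF that] subspace_of_sum[OF D, of S "\<lambda>b. sc (r b y) b"] S D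
    by (metis subsetD subspace_of_scale)
  let ?L = "{bs. set bs \<subseteq> S \<and> length bs = n}"
  have fin: "finite ?L" using finite_lists_length_eq[OF S(1)] by simp
  have xe: "x = (\<Sum>b\<in>S. sc (r b x) b)" using Suc.prems(3) v by auto
  have "\<beta> v = (\<Sum>b\<in>S. s (r b x) (\<beta> (b # xs)))"
    unfolding v(1) by (subst xe, subst mlin_head_sum[OF Suc.prems(1) _ v(2) vs D S(1)])
       (use inD v S in auto)
  also have "\<dots> = (\<Sum>b\<in>S. \<Sum>bs\<in>?L. s (r b x) (s (\<Prod>i<n. r (bs ! i) (xs ! i)) (\<beta> (b # bs))))"
  proof (rule sum.cong[OF refl])
    fix b assume b: "b \<in> S"
    have "\<beta> (b # xs) = (\<Sum>bs\<in>?L. s (\<Prod>i<n. r (bs ! i) (xs ! i)) (\<beta> (b # bs)))"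
      by (rule Suc.IH[OF mlin_Cons[OF Suc.prems(1)] v(2)]) (use b S Suc.prems(3) v in auto)
    thus "s (r b x) (\<beta> (b # xs)) = (\<Sum>bs\<in>?L. s (r b x) (s (\<Prod>i<n. r (bs ! i) (xs ! i)) (\<beta> (b # bs))))"
      by (simp only: s.scale_sum_right)
  qed
  also have "\<dots> = (\<Sum>(bs, b)\<in>?L \<times> S. s (r b x) (s (\<Prod>i<n. r (bs ! i) (xs ! i)) (\<beta> (b # bs))))"
    by (subst sum.swap) (simp add: sum.cartesian_product)
  also have "\<dots> = (\<Sum>bs\<in>{bs. set bs \<subseteq> S \<and> length bs = Suc n}. s (\<Prod>i<Suc n. r (bs ! i) (v ! i)) (\<beta> bs))"
    unfolding lists_length_Suc_eq
    by (subst sum.reindex) (auto simp: inj_on_def v prod.lessThan_Suc_shift case_prod_unfold o_def simp del: prod.lessThan_Suc intro!: sum.cong)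
  finally show ?case .
qed

lemma sum_ptensl_eval:
  assumes "\<forall>v\<in>set vs. length v = n" "\<forall>i<n. lin sc (fs i)"
  shows "sum_list (map (ptensl sc) vs) fs = (\<Sum>v\<leftarrow>vs. \<Prod>i<n. fs i (v ! i))"
  using assms by (induction vs) (auto simp: ptensl_def)

text \<open>Expanding in a basis of \<open>D\<close>, the coefficients of the expansion of \<open>\<Sum> \<beta> v\<close> are the values of
the tensor on coordinate functionals.\<close>

theorem mlin_well_defined:
  fixes sc :: "'k::field \<Rightarrow> 'x::ab_group_add \<Rightarrow> 'x"
  assumes vs: "vector_space sc" "vector_space s" and D: "subspace_of sc D"
    and m: "mlin sc D n s \<beta>"
    and us: "\<forall>v\<in>set us. length v = n \<and> set v \<subseteq> D"
    and ws: "\<forall>v\<in>set ws. length v = n \<and> set v \<subseteq> D"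
    and eq: "sum_list (map (ptensl sc) us) = sum_list (map (ptensl sc) ws)"
  shows "sum_list (map \<beta> us) = sum_list (map \<beta> ws)"
proof -
  interpret vector_space sc by fact
  interpret s: vector_space s by fact
  obtain B where B: "B \<subseteq> D" "independent B" "D \<subseteq> span B"
    by (rule maximal_independent_subset)
  \<comment> \<open>The functionals in a tensor are linear on the whole type, so the coordinates are
    taken in a basis \<open>B'\<close> of the whole space. On vectors of \<open>D\<close> they agree
    with the coordinates in \<open>B\<close>; hence only basis vectors from \<open>D\<close> occur,
    where \<open>\<beta>\<close> is multilinear.\<close>
  obtain B' where B': "B \<subseteq> B'" "independent B'" "span B' = UNIV"
    using extend_basis_superset[OF B(2)] independent_extend_basis[OF B(2)] span_extend_basis[OF B(2)] by blast
  define r where "r b x = representation B' x b" for b x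
  have lr: "lin sc (r b)" for b
    unfolding lin_def r_def using B' by (auto simp: representation_add representation_scale)
  \<comment> \<open>All basis vectors that occur in some entry of \<open>us\<close> or
    \<open>ws\<close>: a finite set over which both sums can be expanded simultaneously.\<close>
  define S where "S = (\<Union>x\<in>(\<Union>v\<in>set us \<union> set ws. set v). {b. r b x \<noteq> 0})"
  have fS: "finite S" unfolding S_def r_def by (auto simp: finite_representation)
  have SB: "S \<subseteq> B"
  proof
    fix b assume "b \<in> S"
    then obtain x where x: "x \<in> D" "r b x \<noteq> 0" using us ws unfolding S_def by blast
    have "representation B' x = representation B x"
      using representation_extend[of B' x B] B B' x by blast
    with x show "b \<in> B" unfolding r_def by (metis representation_ne_zero)
  qed
  have xe: "x = (\<Sum>b\<in>S. sc (r b x) b)" if x: "x \<in> (\<Union>v\<in>set us \<union> set ws. set v)" for x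
  proof -
    have "x = (\<Sum>b | r b x \<noteq> 0. sc (r b x) b)"
      unfolding r_def using sum_nonzero_representation_eq[of B' x] B' by auto
    also have "\<dots> = (\<Sum>b\<in>S. sc (r b x) b)"
      by (rule sum.mono_neutral_left[OF fS]) (use x in \<open>auto simp: S_def\<close>)
    finally show ?thesis .
  qed
  let ?L = "{bs. set bs \<subseteq> S \<and> length bs = n}"
  have *: "sum_list (map \<beta> vs) = (\<Sum>bs\<in>?L. s (sum_list (map (ptensl sc) vs) (\<lambda>i. r (bs ! i))) (\<beta> bs))"
    if "set vs \<subseteq> set us \<union> set ws" for vs
  proof -
    have l: "\<forall>v\<in>set vs. length v = n" using that us ws by blast
    have b: "\<beta> v = (\<Sum>bs\<in>?L. s (\<Prod>i<n. r (bs ! i) (v ! i)) (\<beta> bs))" if "v \<in> set vs" for v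
      by (rule mlin_expand[OF vs D fS _ m]) (use SB B l that \<open>set vs \<subseteq> _\<close> in \<open>auto intro!: xe\<close>)
    have "sum_list (map \<beta> vs) = (\<Sum>v\<leftarrow>vs. \<Sum>bs\<in>?L. s (\<Prod>i<n. r (bs ! i) (v ! i)) (\<beta> bs))"
      using b by (metis (no_types, lifting) map_eq_conv)
    also have "\<dots> = (\<Sum>bs\<in>?L. s (\<Sum>v\<leftarrow>vs. \<Prod>i<n. r (bs ! i) (v ! i)) (\<beta> bs))"
      by (induction vs) (auto simp: s.scale_left_distrib sum.distrib)
    also have "\<dots> = (\<Sum>bs\<in>?L. s (sum_list (map (ptensl sc) vs) (\<lambda>i. r (bs ! i))) (\<beta> bs))"
      by (subst sum_ptensl_eval[OF l]) (auto simp: lr)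
    finally show ?thesis .
  qed
  show ?thesis using *[of us] *[of ws] eq by simp
qed

text \<open>Removes the choice operator from \<open>tapp\<close>: the representation picked by
  \<open>SOME\<close> and the given one have the same tensor, so multilinearity gives them the same
  sum.\<close>

lemma tapp_sum_ptensl:
  fixes sc :: "'k::field \<Rightarrow> 'x::ab_group_add \<Rightarrow> 'x"
  assumes vs: "vector_space sc" "vector_space s" and D: "subspace_of sc D"
    and m: "mlin sc D n s \<beta>"
    and us: "\<forall>v\<in>set us. length v = n \<and> set v \<subseteq> D"
  shows "tapp sc n D \<beta> (sum_list (map (ptensl sc) us)) = sum_list (map \<beta> us)"
proof -
  let ?P = "\<lambda>ws. (\<forall>v\<in>set ws. length v = n \<and> set v \<subseteq> D) \<and>
     sum_list (map (ptensl sc) us) = sum_list (map (ptensl sc) ws)"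
  define ws where "ws = (SOME ws. ?P ws)"
  have "?P ws" unfolding ws_def by (rule someI[of ?P us]) (use us in auto)
  thus ?thesis unfolding tapp_def ws_def[symmetric] using mlin_well_defined[OF vs D m us, of ws] by metis
qed

lemma vector_space_tscale: "vector_space (tscale :: 'k::field \<Rightarrow> ('x, 'k) tensor \<Rightarrow> ('x, 'k) tensor)"
  by unfold_locales (auto simp: tscale_def fun_eq_iff algebra_simps)

lemma vector_space_cscale: "vector_space (cscale :: 'k::field \<Rightarrow> ('x, 'k) cot \<Rightarrow> ('x, 'k) cot)"
  by unfold_locales (auto simp: cscale_def tscale_def fun_eq_iff algebra_simps)

lemma mlin_ptensl:
  fixes sc :: "'k::field \<Rightarrow> 'x::ab_group_add \<Rightarrow> 'x"
  shows "mlin sc D n tscale (ptensl sc)"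
  unfolding mlin_def
proof (intro allI impI, goal_cases)
  case (1 v i x y c)
  have *: "(\<Prod>j<length v. fs j (v[i := z] ! j)) = fs i z * (\<Prod>j\<in>{..<length v} - {i}. fs j (v ! j))"
    for fs :: "nat \<Rightarrow> 'x \<Rightarrow> 'k" and z
    using 1 by (subst prod.remove[of _ i]) (auto intro!: prod.cong)
  show ?case using 1(1,2)
    by (auto simp: fun_eq_iff ptensl_def tscale_def * algebra_simps lin_add lin_scale simp del: nth_list_update)
qed

lemma tensors_0: "0 \<in> tensors sc n D"
  unfolding tensors_def by (auto intro!: exI[of _ "[]"])

lemma tensors_add: "t \<in> tensors sc n D \<Longrightarrow> t' \<in> tensors sc n D \<Longrightarrow> t + t' \<in> tensors sc n D"
proof -
  assume "t \<in> tensors sc n D" "t' \<in> tensors sc n D"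
  then obtain us ws where "t = sum_list (map (ptensl sc) us)" "\<forall>v\<in>set us. length v = n \<and> set v \<subseteq> D"
    "t' = sum_list (map (ptensl sc) ws)" "\<forall>v\<in>set ws. length v = n \<and> set v \<subseteq> D"
    unfolding tensors_def by blast
  thus ?thesis unfolding tensors_def by (intro CollectI exI[of _ "us @ ws"]) auto
qed

lemma ptensl_in_tensors: "length v = n \<Longrightarrow> set v \<subseteq> D \<Longrightarrow> ptensl sc v \<in> tensors sc n D"
  unfolding tensors_def by (intro CollectI exI[of _ "[v]"]) auto

lemma tensors_mono: "D \<subseteq> D' \<Longrightarrow> t \<in> tensors sc n D \<Longrightarrow> t \<in> tensors sc n D'"
  unfolding tensors_def by blast

lemma ptensl_scale_head:
  fixes sc :: "'k::field \<Rightarrow> 'x::ab_group_add \<Rightarrow> 'x"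
  shows "ptensl sc (sc c x # v) = tscale c (ptensl sc (x # v))"
  using mlin_ptensl[of sc UNIV "Suc (length v)", unfolded mlin_def, rule_format, of "x # v" 0] by auto

lemma tscale_sum_list: "tscale c (sum_list ts) = (\<Sum>t\<leftarrow>ts. tscale c t :: ('x, 'k::field) tensor)"
  by (induction ts) (auto simp: tscale_def fun_eq_iff algebra_simps)

text \<open>The scalar is absorbed into the first entry of each pure tensor. For
  \<open>n = 0\<close> there is no entry, and \<open>tensors\<close> contains only sums of copies of
  the empty tensor.\<close>

lemma tensors_scale:
  fixes sc :: "'k::field \<Rightarrow> 'x::ab_group_add \<Rightarrow> 'x"
  assumes "t \<in> tensors sc n D" "subspace_of sc D" "n > 0"
  shows "tscale c t \<in> tensors sc n D"
proof -
  from assms(1) obtain us where us: "t = sum_list (map (ptensl sc) us)" "\<forall>v\<in>set us. length v = n \<and> set v \<subseteq> D"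
    unfolding tensors_def by blast
  have *: "tscale c (ptensl sc v) = ptensl sc (sc c (hd v) # tl v)" if "v \<in> set us" for v
    using us(2) that assms(3) by (cases v) (auto simp: ptensl_scale_head)
  have "tscale c t = sum_list (map (ptensl sc) (map (\<lambda>v. sc c (hd v) # tl v) us))"
    unfolding us(1) tscale_sum_list using * by (simp add: o_def cong: map_cong)
  moreover have "\<forall>v\<in>set (map (\<lambda>v. sc c (hd v) # tl v) us). length v = n \<and> set v \<subseteq> D"
    using us(2) assms(2,3) by (force simp: subspace_of_def neq_Nil_conv dest: list.set_sel(2))
  ultimately show ?thesis unfolding tensors_def by blast
qed

lemma subspace_tensors:
  fixes sc :: "'k::field \<Rightarrow> 'x::ab_group_add \<Rightarrow> 'x"
  shows "subspace_of sc D \<Longrightarrow> n > 0 \<Longrightarrow> subspace_of tscale (tensors sc n D)"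
  unfolding subspace_of_def[of tscale] using tensors_0 tensors_add tensors_scale by blast

lemma tensors_not_lin:
  assumes "t \<in> tensors sc n D" "\<not> (\<forall>i<n. lin sc (fs i))"
  shows "t fs = 0"
proof -
  obtain us where us: "t = sum_list (map (ptensl sc) us)" "\<forall>v\<in>set us. length v = n \<and> set v \<subseteq> D"
    using assms(1) unfolding tensors_def by blast
  show ?thesis unfolding us(1) using us(2) assms(2) by (induction us) (auto simp: ptensl_def)
qed

lemma tensors_cong: "t \<in> tensors sc n D \<Longrightarrow> (\<And>i. i < n \<Longrightarrow> fs i = gs i) \<Longrightarrow> t fs = t gs"
  by (auto simp: tensors_def sum_list_fun_apply ptensl_def o_def intro!: arg_cong[where f=sum_list] map_cong prod.cong)

section \<open>Tensors and coalgebras\<close>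

lemma tapp_add:
  fixes sc :: "'k::field \<Rightarrow> 'x::ab_group_add \<Rightarrow> 'x"
  assumes "vector_space sc" "vector_space s" "subspace_of sc D" "mlin sc D n s \<beta>"
    "t \<in> tensors sc n D" "t' \<in> tensors sc n D"
  shows "tapp sc n D \<beta> (t + t') = tapp sc n D \<beta> t + tapp sc n D \<beta> t'"
proof -
  obtain us ws where us: "t = sum_list (map (ptensl sc) us)" "\<forall>v\<in>set us. length v = n \<and> set v \<subseteq> D"
    and ws: "t' = sum_list (map (ptensl sc) ws)" "\<forall>v\<in>set ws. length v = n \<and> set v \<subseteq> D"
    using assms(5,6) unfolding tensors_def by blast
  have "t + t' = sum_list (map (ptensl sc) (us @ ws))" using us ws by simp
  moreover have "\<forall>v\<in>set (us @ ws). length v = n \<and> set v \<subseteq> D" using us ws by auto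
  ultimately show ?thesis using tapp_sum_ptensl[OF assms(1-4)] us ws by (metis map_append sum_list_append)
qed

lemma mlin_scale_head:
  assumes "mlin sc D n s \<beta>" "length v = n" "n > 0" "set v \<subseteq> D"
  shows "\<beta> (sc c (hd v) # tl v) = s c (\<beta> v)"
  using assms(1)[unfolded mlin_def, rule_format, of v 0 "hd v" "hd v" c] assms(2-4)
  by (cases v) auto

lemma s_sum_list: "vector_space s \<Longrightarrow> s c (sum_list xs) = (\<Sum>x\<leftarrow>xs. s c x)"
  by (induction xs) (auto simp: vs_zero_right module.scale_right_distrib simp flip: module_iff_vector_space)

lemma tapp_scale:
  fixes sc :: "'k::field \<Rightarrow> 'x::ab_group_add \<Rightarrow> 'x"
  assumes "vector_space sc" "vector_space s" "subspace_of sc D" "mlin sc D n s \<beta>"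
    "t \<in> tensors sc n D" "n > 0"
  shows "tapp sc n D \<beta> (tscale c t) = s c (tapp sc n D \<beta> t)"
proof -
  obtain us where us: "t = sum_list (map (ptensl sc) us)" "\<forall>v\<in>set us. length v = n \<and> set v \<subseteq> D"
    using assms(5) unfolding tensors_def by blast
  define ws where "ws = map (\<lambda>v. sc c (hd v) # tl v) us"
  have ws: "\<forall>v\<in>set ws. length v = n \<and> set v \<subseteq> D"
    unfolding ws_def using us(2) assms(3,6) by (force simp: subspace_of_def neq_Nil_conv dest: list.set_sel(2))
  have *: "tscale c (ptensl sc v) = ptensl sc (sc c (hd v) # tl v)" if "v \<in> set us" for v
    using mlin_scale_head[OF mlin_ptensl[of sc D n], of v] us(2) that assms(6) by auto
  have "tscale c t = sum_list (map (ptensl sc) ws)"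
    unfolding us(1) tscale_sum_list ws_def using * by (simp add: o_def cong: map_cong)
  hence "tapp sc n D \<beta> (tscale c t) = sum_list (map \<beta> ws)" using tapp_sum_ptensl[OF assms(1-4) ws] by simp
  also have "\<dots> = (\<Sum>v\<leftarrow>us. s c (\<beta> v))"
    unfolding ws_def using mlin_scale_head[OF assms(4)] us(2) assms(6) by (simp add: o_def cong: map_cong)
  also have "\<dots> = s c (sum_list (map \<beta> us))" by (simp add: s_sum_list[OF assms(2)] o_def)
  finally show ?thesis using tapp_sum_ptensl[OF assms(1-4) us(2)] us(1) by simp
qed

section \<open>Tensors of rank two as lists of pairs\<close>

definition pr :: "'a \<Rightarrow> 'a \<Rightarrow> nat \<Rightarrow> 'a" where
  "pr f g = (\<lambda>i. if i = 0 then f else g)"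

lemma pr_simps [simp]: "pr f g 0 = f" "pr f g (Suc i) = g"
  by (auto simp: pr_def)

definition ten2 :: "('k::field \<Rightarrow> 'x::plus \<Rightarrow> 'x) \<Rightarrow> ('x \<times> 'x) list \<Rightarrow> ('x, 'k) tensor" where
  "ten2 sc ps = (\<Sum>(a, b)\<leftarrow>ps. ptensl sc [a, b])"

lemma ten2_alt: "ten2 sc ps = sum_list (map (ptensl sc) (map (\<lambda>(a, b). [a, b]) ps))"
  by (simp add: ten2_def o_def case_prod_unfold)

lemma ten2_simps: "ten2 sc [] = 0" "ten2 sc ((a, b) # ps) = ptensl sc [a, b] + ten2 sc ps"
  "ten2 sc (ps @ qs) = ten2 sc ps + ten2 sc qs"
  by (auto simp: ten2_def)

lemma tensors2E:
  assumes "t \<in> tensors sc 2 D"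
  obtains ps where "set ps \<subseteq> D \<times> D" "t = ten2 sc ps"
proof -
  obtain us where us: "t = sum_list (map (ptensl sc) us)" "\<forall>v\<in>set us. length v = 2 \<and> set v \<subseteq> D"
    using assms unfolding tensors_def by blast
  have *: "v = [v ! 0, v ! 1] \<and> v ! 0 \<in> D \<and> v ! 1 \<in> D" if "v \<in> set us" for v
    using us(2) that by (auto simp: length_Suc_conv numeral_2_eq_2)
  let ?ps = "map (\<lambda>v. (v ! 0, v ! 1)) us"
  have "map (\<lambda>(a, b). [a, b]) ?ps = us" using * by (auto intro!: map_idI)
  hence "t = ten2 sc ?ps" unfolding ten2_alt us(1) by simp
  moreover have "set ?ps \<subseteq> D \<times> D" using * by auto
  ultimately show ?thesis using that by blast
qed

lemma ten2_in: "set ps \<subseteq> D \<times> D \<Longrightarrow> ten2 sc ps \<in> tensors sc 2 D"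
  unfolding ten2_alt tensors_def by (intro CollectI exI[of _ "map (\<lambda>(a, b). [a, b]) ps"] conjI[OF refl]) auto

lemma ptensl2_eval: "lin sc f \<Longrightarrow> lin sc g \<Longrightarrow> ptensl sc [a, b] (pr f g) = f a * g b"
  by (simp add: ptensl_def less_Suc_eq numeral_2_eq_2)

lemma ten2_eval: "lin sc f \<Longrightarrow> lin sc g \<Longrightarrow> ten2 sc ps (pr f g) = (\<Sum>(a, b)\<leftarrow>ps. f a * g b)"
  by (induction ps) (auto simp: ten2_simps ptensl2_eval)

lemma tensors2_pr:
  assumes "t \<in> tensors sc 2 D" shows "t fs = t (pr (fs 0) (fs 1))"
proof (rule tensors_cong[OF assms])
  fix i :: nat assume "i < 2"
  thus "fs i = pr (fs 0) (fs 1) i" by (cases i) auto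
qed

definition bilin :: "('k::field \<Rightarrow> 'x::ab_group_add \<Rightarrow> 'x) \<Rightarrow> 'x set \<Rightarrow>
    ('k \<Rightarrow> 'y::ab_group_add \<Rightarrow> 'y) \<Rightarrow> ('x \<Rightarrow> 'x \<Rightarrow> 'y) \<Rightarrow> bool" where
  "bilin sc D s b \<longleftrightarrow> (\<forall>x\<in>D. \<forall>y\<in>D. \<forall>z\<in>D. \<forall>c. b (x + y) z = b x z + b y z \<and> b z (x + y) = b z x + b z y \<and>
     b (sc c x) z = s c (b x z) \<and> b z (sc c x) = s c (b z x))"

lemma bilinI:
  assumes "\<And>x y z. x \<in> D \<Longrightarrow> y \<in> D \<Longrightarrow> z \<in> D \<Longrightarrow> b (x + y) z = b x z + b y z"
    "\<And>x y z. x \<in> D \<Longrightarrow> y \<in> D \<Longrightarrow> z \<in> D \<Longrightarrow> b z (x + y) = b z x + b z y"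
    "\<And>c x z. x \<in> D \<Longrightarrow> z \<in> D \<Longrightarrow> b (sc c x) z = s c (b x z)"
    "\<And>c x z. x \<in> D \<Longrightarrow> z \<in> D \<Longrightarrow> b z (sc c x) = s c (b z x)"
  shows "bilin sc D s b"
  using assms unfolding bilin_def by blast

lemma bilin_mlin: "bilin sc D s (\<lambda>x y. \<beta> [x, y]) \<Longrightarrow> mlin sc D 2 s \<beta>"
  unfolding mlin_def bilin_def
  by (auto simp: numeral_2_eq_2 length_Suc_conv less_Suc_eq)

lemma tapp2:
  assumes "vector_space sc" "vector_space s" "subspace_of sc D" "bilin sc D s (\<lambda>x y. \<beta> [x, y])"
    "set ps \<subseteq> D \<times> D"
  shows "tapp sc 2 D \<beta> (ten2 sc ps) = (\<Sum>(a, b)\<leftarrow>ps. \<beta> [a, b])"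
  unfolding ten2_alt
  by (subst tapp_sum_ptensl[OF assms(1-3) bilin_mlin[OF assms(4)]])
     (use assms(5) in \<open>auto simp: o_def case_prod_unfold\<close>)

lemmas tapp2_add = tapp_add[OF _ _ _ bilin_mlin]
lemmas tapp2_scale = tapp_scale[OF _ _ _ bilin_mlin _ zero_less_numeral]

lemma bilin_ptensl: "bilin sc D tscale (\<lambda>x y. ptensl sc [x, y])"
  using mlin_ptensl[of sc UNIV 2, unfolded mlin_def, rule_format, of "[x, y]" 0 for x y]
   mlin_ptensl[of sc UNIV 2, unfolded mlin_def, rule_format, of "[x, y]" "Suc 0" for x y]
  by (intro bilinI) simp_all

text \<open>In each pure tensor the slots other than \<open>m\<close> evaluate to a scalar in front
  of the \<open>m\<close>-th entry. That the resulting vector lies in \<open>D\<close> is what lets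
  facts about vectors of \<open>D\<close> be applied to tensors slot by slot.\<close>

lemma tensor_slice:
  fixes sc :: "'k::field \<Rightarrow> 'x::ab_group_add \<Rightarrow> 'x"
  assumes D: "subspace_of sc D" and t: "t \<in> tensors sc n D" and m: "m < n"
    and fs: "\<And>i. i < n \<Longrightarrow> lin sc (fs i)"
  shows "\<exists>z\<in>D. \<forall>f. lin sc f \<longrightarrow> t (fs(m := f)) = f z"
proof -
  obtain us where us: "t = sum_list (map (ptensl sc) us)" "\<forall>v\<in>set us. length v = n \<and> set v \<subseteq> D"
    using t unfolding tensors_def by blast
  define w where "w v = sc (\<Prod>i\<in>{..<n} - {m}. fs i (v ! i)) (v ! m)" for v
  have wD: "w v \<in> D" if "v \<in> set us" for v
  proof -
    have "v ! m \<in> set v" using us(2) that m by auto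
    hence "v ! m \<in> D" using us(2) that by blast
    thus ?thesis unfolding w_def by (rule subspace_of_scale[OF D])
  qed
  have "t (fs(m := f)) = f (\<Sum>v\<leftarrow>us. w v)" if f: "lin sc f" for f
  proof -
    have *: "ptensl sc v (fs(m := f)) = f (w v)" if "v \<in> set us" for v
    proof -
      have "(\<Prod>i<n. (fs(m := f)) i (v ! i)) = f (v ! m) * (\<Prod>i\<in>{..<n} - {m}. fs i (v ! i))"
        using m by (subst prod.remove[of _ m]) auto
      thus ?thesis using us(2) that fs f by (auto simp: ptensl_def w_def lin_scale[OF f])
    qed
    show ?thesis
      unfolding us(1) by (subst lin_sum_list[OF f]) (use * in \<open>simp add: sum_list_fun_apply o_def cong: map_cong\<close>)
  qed
  moreover have "(\<Sum>v\<leftarrow>us. w v) \<in> D" by (rule subspace_of_sum_list[OF D]) (use wD in auto)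
  ultimately show ?thesis by blast
qed

lemma tensors_eqI:
  assumes "t \<in> tensors sc n D" "t' \<in> tensors sc n D'"
    "\<And>fs. (\<And>i. i < n \<Longrightarrow> lin sc (fs i)) \<Longrightarrow> t fs = t' fs"
  shows "t = t'"
  using assms tensors_not_lin[of t] tensors_not_lin[of t'] by (metis ext)

lemma tensors2_eqI:
  assumes "t \<in> tensors sc 2 D" "t' \<in> tensors sc 2 D'"
    "\<And>f g. lin sc f \<Longrightarrow> lin sc g \<Longrightarrow> t (pr f g) = t' (pr f g)"
  shows "t = t'"
  by (rule tensors_eqI[OF assms(1,2)], subst tensors2_pr[OF assms(1)], subst tensors2_pr[OF assms(2)])
     (auto intro: assms(3))

text \<open>The slots are freed one at a time. If equality is known with arbitrary functionals in
  the first \<open>m\<close> slots and members of \<open>E\<close> in the rest, the slices of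
  \<open>t\<close> and \<open>t'\<close> in slot \<open>m\<close> are vectors of \<open>D\<close> on
  which all of \<open>E\<close> agrees, so they are equal and slot \<open>m\<close> is free
  too.\<close>

theorem tensors_sep:
  fixes sc :: "'k::field \<Rightarrow> 'x::ab_group_add \<Rightarrow> 'x"
  assumes vs: "vector_space sc" and D: "subspace_of sc D"
    and E: "\<And>e. e \<in> E \<Longrightarrow> lin sc e" "\<And>x. x \<in> D \<Longrightarrow> (\<And>e. e \<in> E \<Longrightarrow> e x = 0) \<Longrightarrow> x = 0"
    and t: "t \<in> tensors sc n D" "t' \<in> tensors sc n D"
    and eq: "\<And>fs. (\<And>i. i < n \<Longrightarrow> fs i \<in> E) \<Longrightarrow> t fs = t' fs"
  shows "t = t'"
proof -
  have *: "t fs = t' fs" if "m \<le> n" "\<And>i. i < m \<Longrightarrow> lin sc (fs i)" "\<And>i. m \<le> i \<Longrightarrow> i < n \<Longrightarrow> fs i \<in> E" for m fs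
    using that
  proof (induction m arbitrary: fs)
    case 0
    thus ?case using eq by blast
  next
    case (Suc m)
    have l: "lin sc (fs i)" if "i < n" for i
      using Suc.prems E(1) that by (metis not_less)
    obtain z z' where z: "z \<in> D" "\<And>f. lin sc f \<Longrightarrow> t (fs(m := f)) = f z"
      and z': "z' \<in> D" "\<And>f. lin sc f \<Longrightarrow> t' (fs(m := f)) = f z'"
      using tensor_slice[OF D t(1), of m fs] tensor_slice[OF D t(2), of m fs] Suc.prems(1) l by auto
    have "e (z - z') = 0" if e: "e \<in> E" for e
    proof -
      have "t (fs(m := e)) = t' (fs(m := e))"
        by (rule Suc.IH) (use Suc.prems e in auto)
      thus ?thesis using z z' E(1)[OF e] by (simp add: lin_diff)
    qed
    hence "z = z'" using E(2)[of "z - z'"] subspace_of_diff[OF vs D z(1) z'(1)] by simp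
    thus ?case using z(2)[of "fs m"] z'(2)[of "fs m"] Suc.prems by simp
  qed
  show ?thesis by (rule tensors_eqI[OF t]) (use *[of n] in auto)
qed

lemma tensors2_sep:
  fixes sc :: "'k::field \<Rightarrow> 'x::ab_group_add \<Rightarrow> 'x"
  assumes vs: "vector_space sc" and D: "subspace_of sc D"
    and E: "\<And>e. e \<in> E \<Longrightarrow> lin sc e" "\<And>x. x \<in> D \<Longrightarrow> (\<And>e. e \<in> E \<Longrightarrow> e x = 0) \<Longrightarrow> x = 0"
    and t: "t \<in> tensors sc 2 D" "t' \<in> tensors sc 2 D"
    and eq: "\<And>f g. f \<in> E \<Longrightarrow> g \<in> E \<Longrightarrow> t (pr f g) = t' (pr f g)"
  shows "t = t'"
  by (rule tensors_sep[OF vs D E t], assumption+, subst tensors2_pr[OF t(1)], subst tensors2_pr[OF t(2)])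
     (auto intro: eq)

text \<open>For a projection \<open>P\<close> onto \<open>V\<close>, slices in \<open>V\<close> give \<open>t(f, g) = t(f \<circ> P, g \<circ> P)\<close>, which exhibits \<open>t\<close>
as a sum of pure tensors over \<open>V\<close>. The slices need to be known only for a separating family.\<close>

theorem tensors2_mem:
  fixes sc :: "'k::field \<Rightarrow> 'x::ab_group_add \<Rightarrow> 'x"
  assumes vs: "vector_space sc" and U: "subspace_of sc U" and V: "subspace_of sc V"
    and E: "\<And>e. e \<in> E \<Longrightarrow> lin sc e" "\<And>x. x \<in> U \<Longrightarrow> (\<And>e. e \<in> E \<Longrightarrow> e x = 0) \<Longrightarrow> x = 0"
    and t: "t \<in> tensors sc 2 U"
    and R: "\<And>e z. e \<in> E \<Longrightarrow> z \<in> U \<Longrightarrow> (\<And>f. lin sc f \<Longrightarrow> t (pr f e) = f z) \<Longrightarrow> z \<in> V"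
    and L: "\<And>e z. e \<in> E \<Longrightarrow> z \<in> U \<Longrightarrow> (\<And>f. lin sc f \<Longrightarrow> t (pr e f) = f z) \<Longrightarrow> z \<in> V"
  shows "t \<in> tensors sc 2 V"
proof -
  have slR: "\<exists>z\<in>U. \<forall>f. lin sc f \<longrightarrow> t (pr f g) = f z" if "lin sc g" for g
  proof -
    have "(pr g g)(0 := f) = pr f g" for f by (auto simp: pr_def)
    thus ?thesis using tensor_slice[OF U t, of 0 "pr g g"] that by (simp add: pr_def)
  qed
  have slL: "\<exists>z\<in>U. \<forall>f. lin sc f \<longrightarrow> t (pr g f) = f z" if "lin sc g" for g
  proof -
    have "t ((pr g g)(1 := f)) = t (pr g f)" for f
      by (rule tensors_cong[OF t]) (auto simp: less_Suc_eq numeral_2_eq_2)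
    thus ?thesis using tensor_slice[OF U t, of 1 "pr g g"] that by (simp add: pr_def)
  qed
  have RV: "z \<in> V" if g: "lin sc g" and z: "z \<in> U" "\<And>f. lin sc f \<Longrightarrow> t (pr f g) = f z" for g z
  proof (rule ccontr)
    assume "z \<notin> V"
    then obtain l where l: "lin sc l" "\<And>v. v \<in> V \<Longrightarrow> l v = 0" "l z \<noteq> 0"
      using separating_functional[OF vs V] by blast
    \<comment> \<open>The opposite slice is taken against \<open>l\<close>. For
      \<open>e \<in> E\<close> the value \<open>e w\<close> equals \<open>l y\<close> with
      \<open>y\<close> a slice against \<open>e\<close>; such a slice lies in \<open>V\<close>,
      where \<open>l\<close> vanishes. So \<open>w = 0\<close>, although \<open>g w = l z\<close> is
      nonzero.\<close>
    obtain w where w: "w \<in> U" "\<And>f. lin sc f \<Longrightarrow> t (pr l f) = f w" using slL[OF l(1)] by blast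
    have "e w = 0" if e: "e \<in> E" for e
    proof -
      obtain y where y: "y \<in> U" "\<And>f. lin sc f \<Longrightarrow> t (pr f e) = f y" using slR[OF E(1)[OF e]] by blast
      have "y \<in> V" using R[OF e] y by blast
      thus ?thesis using l w E(1)[OF e] y by metis
    qed
    hence "w = 0" using E(2) w(1) by blast
    thus False using w(2)[OF g] l z lin_0[OF g] by metis
  qed
  have LV: "z \<in> V" if g: "lin sc g" and z: "z \<in> U" "\<And>f. lin sc f \<Longrightarrow> t (pr g f) = f z" for g z
  proof (rule ccontr)
    assume "z \<notin> V"
    then obtain l where l: "lin sc l" "\<And>v. v \<in> V \<Longrightarrow> l v = 0" "l z \<noteq> 0"
      using separating_functional[OF vs V] by blast
    obtain w where w: "w \<in> U" "\<And>f. lin sc f \<Longrightarrow> t (pr f l) = f w" using slR[OF l(1)] by blast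
    have "e w = 0" if e: "e \<in> E" for e
    proof -
      obtain y where y: "y \<in> U" "\<And>f. lin sc f \<Longrightarrow> t (pr e f) = f y" using slL[OF E(1)[OF e]] by blast
      have "y \<in> V" using L[OF e] y by blast
      thus ?thesis using l w E(1)[OF e] y by metis
    qed
    hence "w = 0" using E(2) w(1) by blast
    thus False using w(2)[OF g] l z lin_0[OF g] by metis
  qed
  define P where "P = prj sc V"
  have P: "is_prj sc V P" unfolding P_def by (rule is_prj_prj[OF vs V])
  have linP: "lin sc (\<lambda>x. f (P x))" if "lin sc f" for f
    using that P unfolding lin_def is_prj_def by auto
  have P1: "t (pr f g) = t (pr (\<lambda>x. f (P x)) g)" if fg: "lin sc f" "lin sc g" for f g
  proof -
    obtain z where z: "z \<in> U" "\<And>f. lin sc f \<Longrightarrow> t (pr f g) = f z" using slR[OF fg(2)] by blast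
    have "z \<in> V" using RV[OF fg(2)] z by blast
    thus ?thesis using z(2)[OF fg(1)] z(2)[OF linP[OF fg(1)]] P by (simp add: is_prj_def)
  qed
  have P2: "t (pr f g) = t (pr f (\<lambda>x. g (P x)))" if fg: "lin sc f" "lin sc g" for f g
  proof -
    obtain z where z: "z \<in> U" "\<And>g. lin sc g \<Longrightarrow> t (pr f g) = g z" using slL[OF fg(1)] by blast
    have "z \<in> V" using LV[OF fg(1)] z by blast
    thus ?thesis using z(2)[OF fg(2)] z(2)[OF linP[OF fg(2)]] P by (simp add: is_prj_def)
  qed
  obtain ps where ps: "set ps \<subseteq> U \<times> U" "t = ten2 sc ps" using tensors2E[OF t] by blast
  let ?qs = "map (\<lambda>(a, b). (P a, P b)) ps"
  have q: "ten2 sc ?qs \<in> tensors sc 2 V" by (rule ten2_in) (use P in \<open>auto simp: is_prj_def\<close>)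
  have "t = ten2 sc ?qs"
  proof (rule tensors2_eqI[OF t q])
    fix f g assume fg: "lin sc f" "lin sc g"
    have "t (pr f g) = t (pr (\<lambda>x. f (P x)) (\<lambda>x. g (P x)))"
      using P1[OF fg] P2[OF linP[OF fg(1)] fg(2)] by simp
    also have "\<dots> = ten2 sc ?qs (pr f g)"
      unfolding ps(2) by (simp add: ten2_eval fg linP o_def case_prod_unfold)
    finally show "t (pr f g) = ten2 sc ?qs (pr f g)" .
  qed
  thus ?thesis using q by simp
qed

section \<open>Convolution of functionals on a subspace\<close>

lemma sum_list_concat: "(sum_list (concat xss) :: 'a::monoid_add) = sum_list (map sum_list xss)"
  by (induction xss) auto

text \<open>The product dual to \<open>\<Delta>\<close>. Going through the projection onto
  \<open>D\<close> makes it a functional on the whole type, while \<open>\<Delta>\<close> is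
  constrained on \<open>D\<close> alone.\<close>

definition conv :: "('k::field \<Rightarrow> 'd::ab_group_add \<Rightarrow> 'd) \<Rightarrow> 'd set \<Rightarrow> ('d \<Rightarrow> ('d, 'k) tensor) \<Rightarrow>
    ('d \<Rightarrow> 'k) \<Rightarrow> ('d \<Rightarrow> 'k) \<Rightarrow> 'd \<Rightarrow> 'k" where
  "conv sd D \<Delta> f g = (\<lambda>x. \<Delta> (prj sd D x) (pr f g))"

text \<open>Coassociativity is split off into \<open>coalg\<close>, because for the tensor square of
  Cot it is obtained from \<open>coassoc_sep\<close>, a theorem of this weaker locale.\<close>

locale precoalg =
  fixes sd :: "'k::field \<Rightarrow> 'd::ab_group_add \<Rightarrow> 'd" and D :: "'d set" and \<Delta> :: "'d \<Rightarrow> ('d, 'k) tensor"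
  assumes vs: "vector_space sd" and sub: "subspace_of sd D"
    and comult_in: "x \<in> D \<Longrightarrow> \<Delta> x \<in> tensors sd 2 D"
    and comult_add: "x \<in> D \<Longrightarrow> y \<in> D \<Longrightarrow> \<Delta> (x + y) = \<Delta> x + \<Delta> y"
    and comult_scale: "x \<in> D \<Longrightarrow> \<Delta> (sd c x) = tscale c (\<Delta> x)"
begin

abbreviation "P \<equiv> prj sd D"
abbreviation "cv \<equiv> conv sd D \<Delta>"

lemma P: "P x \<in> D" "x \<in> D \<Longrightarrow> P x = x" "P (x + y) = P x + P y" "P (sd c x) = sd c (P x)"
  using is_prj_prj[OF vs sub] by (auto simp: is_prj_def)

lemma lin_cv: "lin sd (cv f g)"
  by (auto simp: lin_def conv_def P comult_add comult_scale tscale_def)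

lemma cv_P: "cv f g (P x) = cv f g x"
  by (simp add: conv_def P)

lemma cv_D: "x \<in> D \<Longrightarrow> cv f g x = \<Delta> x (pr f g)"
  by (simp add: conv_def P)

lemma lin_P: "lin sd f \<Longrightarrow> lin sd (\<lambda>x. f (P x))"
  by (auto simp: lin_def P)

lemma cv_cong:
  assumes "lin sd f" "lin sd f'" "lin sd g" "lin sd g'" "\<And>x. x \<in> D \<Longrightarrow> f x = f' x" "\<And>x. x \<in> D \<Longrightarrow> g x = g' x"
  shows "cv f g = cv f' g'"
proof
  fix x
  obtain ps where ps: "set ps \<subseteq> D \<times> D" "\<Delta> (P x) = ten2 sd ps"
    using tensors2E[OF comult_in[OF P(1)]] by blast
  show "cv f g x = cv f' g' x"
    unfolding conv_def ps(2) ten2_eval[OF assms(1,3)] ten2_eval[OF assms(2,4)]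
    by (rule arg_cong[where f=sum_list], rule map_cong) (use ps(1) assms in auto)
qed

text \<open>The two iterated comultiplications of \<open>x\<close> are built as tensors of rank
  three over \<open>D\<close>. Their values at \<open>(f, g, h)\<close> are the two bracketings of
  the convolution, so \<open>tensors_sep\<close> carries equality from \<open>E\<close> to all
  functionals.\<close>

theorem coassoc_sep:
  assumes E: "\<And>e. e \<in> E \<Longrightarrow> lin sd e" "\<And>x. x \<in> D \<Longrightarrow> (\<And>e. e \<in> E \<Longrightarrow> e x = 0) \<Longrightarrow> x = 0"
    and as: "\<And>f g h x. f \<in> E \<Longrightarrow> g \<in> E \<Longrightarrow> h \<in> E \<Longrightarrow> x \<in> D \<Longrightarrow> cv (cv f g) h x = cv f (cv g h) x"
    and x: "x \<in> D" and fgh: "lin sd f" "lin sd g" "lin sd h"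
  shows "cv (cv f g) h x = cv f (cv g h) x"
proof -
  define R where "R a = (SOME ps. set ps \<subseteq> D \<times> D \<and> \<Delta> a = ten2 sd ps)" for a
  have R: "set (R a) \<subseteq> D \<times> D \<and> \<Delta> a = ten2 sd (R a)" if "a \<in> D" for a
    unfolding R_def by (rule someI_ex) (use tensors2E[OF comult_in[OF that]] in blast)
  define us where "us = concat (map (\<lambda>(a, b). map (\<lambda>(c, d). [c, d, b]) (R a)) (R x))"
  define ws where "ws = concat (map (\<lambda>(a, b). map (\<lambda>(c, d). [a, c, d]) (R b)) (R x))"
  have usD: "\<forall>v\<in>set us. length v = 3 \<and> set v \<subseteq> D" unfolding us_def
    by clarsimp (use R x in blast)
  have wsD: "\<forall>v\<in>set ws. length v = 3 \<and> set v \<subseteq> D" unfolding ws_def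
    by clarsimp (use R x in blast)
  define t where "t = sum_list (map (ptensl sd) us)"
  define t' where "t' = sum_list (map (ptensl sd) ws)"
  have p3: "(\<Prod>i<3. fs i ([a, b, c] ! i)) = fs 0 a * fs 1 b * fs 2 c"
    for fs :: "nat \<Rightarrow> 'd \<Rightarrow> 'k" and a b c
    by (simp add: numeral_3_eq_3 numeral_2_eq_2)
  have te: "t fs = cv (cv (fs 0) (fs 1)) (fs 2) x" if l: "\<forall>i<3. lin sd (fs i)" for fs
  proof -
    have "t fs = (\<Sum>(a, b)\<leftarrow>R x. \<Sum>(c, d)\<leftarrow>R a. fs 0 c * fs 1 d * fs 2 b)"
      using sum_ptensl_eval[of us 3 sd fs] usD l unfolding t_def us_def
      by (simp add: map_concat sum_list_concat o_def case_prod_unfold p3 del: One_nat_def)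
    also have "\<dots> = (\<Sum>(a, b)\<leftarrow>R x. cv (fs 0) (fs 1) a * fs 2 b)"
    proof (rule arg_cong[where f=sum_list], rule map_cong[OF refl], clarify)
      fix a b assume "(a, b) \<in> set (R x)"
      hence "a \<in> D" using R[OF x] by auto
      thus "(\<Sum>(c, d)\<leftarrow>R a. fs 0 c * fs 1 d * fs 2 b) = cv (fs 0) (fs 1) a * fs 2 b"
        using R[of a] l by (simp add: cv_D ten2_eval sum_list_mult_const case_prod_unfold)
    qed
    also have "\<dots> = cv (cv (fs 0) (fs 1)) (fs 2) x"
      using R[OF x] l by (simp add: cv_D[OF x] ten2_eval lin_cv)
    finally show ?thesis .
  qed
  have te': "t' fs = cv (fs 0) (cv (fs 1) (fs 2)) x" if l: "\<forall>i<3. lin sd (fs i)" for fs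
  proof -
    have "t' fs = (\<Sum>(a, b)\<leftarrow>R x. \<Sum>(c, d)\<leftarrow>R b. fs 0 a * fs 1 c * fs 2 d)"
      using sum_ptensl_eval[of ws 3 sd fs] wsD l unfolding t'_def ws_def
      by (simp add: map_concat sum_list_concat o_def case_prod_unfold p3 del: One_nat_def)
    also have "\<dots> = (\<Sum>(a, b)\<leftarrow>R x. fs 0 a * cv (fs 1) (fs 2) b)"
    proof (rule arg_cong[where f=sum_list], rule map_cong[OF refl], clarify)
      fix a b assume "(a, b) \<in> set (R x)"
      hence "b \<in> D" using R[OF x] by auto
      thus "(\<Sum>(c, d)\<leftarrow>R b. fs 0 a * fs 1 c * fs 2 d) = fs 0 a * cv (fs 1) (fs 2) b"
        using R[of b] l by (simp add: cv_D ten2_eval sum_list_const_mult case_prod_unfold mult.assoc)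
    qed
    also have "\<dots> = cv (fs 0) (cv (fs 1) (fs 2)) x"
      using R[OF x] l by (simp add: cv_D[OF x] ten2_eval lin_cv)
    finally show ?thesis .
  qed
  have tt: "t = t'"
  proof (rule tensors_sep[OF vs sub E, where n=3])
    show "t \<in> tensors sd 3 D" "t' \<in> tensors sd 3 D" unfolding t_def t'_def tensors_def using usD wsD by blast+
    show "t fs = t' fs" if "\<And>i. i < 3 \<Longrightarrow> fs i \<in> E" for fs
      using te[of fs] te'[of fs] as[of "fs 0" "fs 1" "fs 2" x] that E(1) x by auto
  qed auto
  define fs where "fs = (\<lambda>i::nat. if i = 0 then f else if i = 1 then g else h)"
  have "\<forall>i<3. lin sd (fs i)" using fgh by (auto simp: fs_def)
  from te[OF this] te'[OF this] tt show ?thesis by (simp add: fs_def)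
qed

end

locale coalg = precoalg +
  assumes coassoc: "x \<in> D \<Longrightarrow> lin sd f \<Longrightarrow> lin sd g \<Longrightarrow> lin sd h \<Longrightarrow> cv (cv f g) h x = cv f (cv g h) x"
begin

lemma cv_assoc: "lin sd f \<Longrightarrow> lin sd g \<Longrightarrow> lin sd h \<Longrightarrow> cv (cv f g) h = cv f (cv g h)"
  using coassoc[OF P(1)] cv_P by (metis ext)

end

section \<open>Graded Hopf algebras\<close>

context precoalg
begin

text \<open>Sweedler notation: a fixed list of pure tensors over \<open>D\<close> with sum
  \<open>\<Delta> a\<close>.\<close>

definition rep :: "'d \<Rightarrow> ('d \<times> 'd) list" where
  "rep a = (SOME ps. set ps \<subseteq> D \<times> D \<and> \<Delta> a = ten2 sd ps)"

lemma rep: "a \<in> D \<Longrightarrow> set (rep a) \<subseteq> D \<times> D" "a \<in> D \<Longrightarrow> \<Delta> a = ten2 sd (rep a)"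
proof -
  have "set (rep a) \<subseteq> D \<times> D \<and> \<Delta> a = ten2 sd (rep a)" if a: "a \<in> D" for a
  proof -
    obtain ps where "set ps \<subseteq> D \<times> D" "\<Delta> a = ten2 sd ps"
      by (rule tensors2E[OF comult_in[OF a]])
    hence "\<exists>ps. set ps \<subseteq> D \<times> D \<and> \<Delta> a = ten2 sd ps" by (intro exI conjI)
    thus ?thesis unfolding rep_def by (rule someI_ex)
  qed
  thus "a \<in> D \<Longrightarrow> set (rep a) \<subseteq> D \<times> D" "a \<in> D \<Longrightarrow> \<Delta> a = ten2 sd (rep a)" by blast+
qed

lemma cv_rep: "a \<in> D \<Longrightarrow> lin sd f \<Longrightarrow> lin sd g \<Longrightarrow> cv f g a = (\<Sum>(c, d)\<leftarrow>rep a. f c * g d)"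
  using rep[of a] by (simp add: cv_D ten2_eval)

text \<open>The separate domain \<open>D'\<close> is there because the definitions apply
  \<open>tapp\<close> to comultiplications sometimes over \<open>UNIV\<close> and sometimes over the
  carrier itself.\<close>

lemma tapp_comult:
  assumes "vector_space s" "subspace_of sd D'" "D \<subseteq> D'" "bilin sd D' s (\<lambda>x y. \<beta> [x, y])" "a \<in> D"
  shows "tapp sd 2 D' \<beta> (\<Delta> a) = (\<Sum>(c, d)\<leftarrow>rep a. \<beta> [c, d])"
  unfolding rep(2)[OF assms(5)]
  by (rule tapp2[OF vs assms(1,2,4)]) (use rep(1)[OF assms(5)] assms(3) in blast)

lemma tapp_comult_add:
  assumes "vector_space s" "subspace_of sd D'" "D \<subseteq> D'" "bilin sd D' s (\<lambda>x y. \<beta> [x, y])" "a \<in> D" "b \<in> D"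
  shows "tapp sd 2 D' \<beta> (\<Delta> (a + b)) = tapp sd 2 D' \<beta> (\<Delta> a) + tapp sd 2 D' \<beta> (\<Delta> b)"
  unfolding comult_add[OF assms(5,6)]
  by (rule tapp2_add[OF vs assms(1,2,4)]) (use comult_in assms tensors_mono in blast)+

lemma tapp_comult_scale:
  assumes "vector_space s" "subspace_of sd D'" "D \<subseteq> D'" "bilin sd D' s (\<lambda>x y. \<beta> [x, y])" "a \<in> D"
  shows "tapp sd 2 D' \<beta> (\<Delta> (sd c a)) = s c (tapp sd 2 D' \<beta> (\<Delta> a))"
  unfolding comult_scale[OF assms(5)]
  by (rule tapp2_scale[OF vs assms(1,2,4)]) (use comult_in assms tensors_mono in blast)+

end

lemma nth1: "(x # y # xs) ! 1 = y"
  by simp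

lemma sum_list_distrib_scale:
  "vector_space s \<Longrightarrow> s c (\<Sum>x\<leftarrow>xs. f x) = (\<Sum>x\<leftarrow>xs. s c (f x))"
  by (simp add: s_sum_list o_def)

locale graded_hopf_loc =
  fixes X :: "('h::ab_group_add, 'k::field) ghopf"
  assumes graded_hopf: "graded_hopf X"
begin

abbreviation "sc \<equiv> hscale X"
abbreviation "m \<equiv> hmult X"
abbreviation "p \<equiv> proj X"
abbreviation "G \<equiv> hgrad X"
abbreviation "\<Delta> \<equiv> hcomult X"
abbreviation "\<epsilon> \<equiv> hcounit X"

lemma hopf: "hopf_alg X"
  using graded_hopf by (simp add: graded_hopf_def)

lemma m_add_conj: "\<forall>x y z. m (x + y) z = m x z + m y z \<and> m z (x + y) = m z x + m z y"
  and m_scale_conj: "\<forall>c x y. m (sc c x) y = sc c (m x y) \<and> m x (sc c y) = sc c (m x y)"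
  and m_assoc_conj: "\<forall>x y z. m (m x y) z = m x (m y z)"
  and \<epsilon>_m_conj: "\<forall>x y. \<epsilon> (m x y) = \<epsilon> x * \<epsilon> y"
  and vsX: "vector_space sc"
  and \<epsilon>_lin: "lin sc \<epsilon>"
  using hopf unfolding hopf_alg_def Let_def by - (elim conjE, assumption)+

lemma m_add: "m (x + y) z = m x z + m y z" "m z (x + y) = m z x + m z y"
  and m_scale: "m (sc c x) y = sc c (m x y)" "m x (sc c y) = sc c (m x y)"
  and m_assoc: "m (m x y) z = m x (m y z)"
  and \<epsilon>_m: "\<epsilon> (m x y) = \<epsilon> x * \<epsilon> y"
  using m_add_conj m_scale_conj m_assoc_conj \<epsilon>_m_conj by blast+

lemma lin_m: "lin sc f \<Longrightarrow> lin sc (\<lambda>x. f (m x y))" "lin sc f \<Longrightarrow> lin sc (\<lambda>x. f (m y x))"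
  by (auto simp: lin_def m_add m_scale)

lemma m_0: "m 0 x = 0" "m x 0 = 0"
  using m_add(1)[of 0 0 x] m_add(2)[of x 0 0] by simp_all

lemma m_sum: "m (sum f S) x = (\<Sum>i\<in>S. m (f i) x)" "m x (sum f S) = (\<Sum>i\<in>S. m x (f i))"
  by (induction S rule: infinite_finite_induct; simp add: m_0 m_add)+

sublocale precoalg sc UNIV \<Delta>
proof (rule precoalg.intro)
  show "vector_space sc" by (rule vsX)
  show "subspace_of sc UNIV" by simp
  show "\<Delta> x \<in> tensors sc 2 UNIV" "\<Delta> (x + y) = \<Delta> x + \<Delta> y" "\<Delta> (sc c x) = tscale c (\<Delta> x)" for x y c
    using hopf unfolding hopf_alg_def Let_def by (elim conjE, blast)+
qed

lemma prj_UNIV: "prj sc UNIV = (\<lambda>x. x)"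
  using P(2) by auto

lemma cv_def: "cv f g = (\<lambda>x. \<Delta> x (pr f g))"
  by (simp add: conv_def prj_UNIV)

lemma coassoc_raw: "tapp sc 2 UNIV (\<lambda>v. tapp sc 2 UNIV (\<lambda>w. ptensl sc [w!0, w!1, v!1]) (\<Delta> (v!0))) (\<Delta> x)
        = tapp sc 2 UNIV (\<lambda>v. tapp sc 2 UNIV (\<lambda>w. ptensl sc [v!0, w!0, w!1]) (\<Delta> (v!1))) (\<Delta> x)"
  using hopf unfolding hopf_alg_def Let_def by blast

lemma ptensl3_lin:
  "ptensl sc [x + y, a, b] = ptensl sc [x, a, b] + ptensl sc [y, a, b]"
  "ptensl sc [a, x + y, b] = ptensl sc [a, x, b] + ptensl sc [a, y, b]"
  "ptensl sc [a, b, x + y] = ptensl sc [a, b, x] + ptensl sc [a, b, y]"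
  "ptensl sc [sc c x, a, b] = tscale c (ptensl sc [x, a, b])"
  "ptensl sc [a, sc c x, b] = tscale c (ptensl sc [a, x, b])"
  "ptensl sc [a, b, sc c x] = tscale c (ptensl sc [a, b, x])"
  using mlin_ptensl[of sc UNIV 3, unfolded mlin_def, rule_format, of "[x, a, b]" 0]
   mlin_ptensl[of sc UNIV 3, unfolded mlin_def, rule_format, of "[a, x, b]" "Suc 0"]
   mlin_ptensl[of sc UNIV 3, unfolded mlin_def, rule_format, of "[a, b, x]" "Suc (Suc 0)"]
  by (simp_all add: numeral_3_eq_3)

lemma ptensl3_eval:
  assumes "lin sc f" "lin sc g" "lin sc h"
  shows "ptensl sc [a, b, c] (\<lambda>i. if i = 0 then f else if i = 1 then g else h) = f a * g b * h c"
  using assms by (simp add: ptensl_def numeral_3_eq_3 less_Suc_eq)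

text \<open>Evaluating the coassociativity axiom, an equation of rank three tensors, at
  \<open>(f, g, h)\<close> gives the two bracketings. The inner \<open>tapp\<close> must be shown
  bilinear in the outer entries (\<open>B1\<close>, \<open>B2\<close>) before the outer one can be
  computed.\<close>

sublocale coalg sc UNIV \<Delta>
proof
  fix x f g h assume l: "lin sc f" "lin sc g" "lin sc h"
  let ?fs = "\<lambda>i::nat. if i = 0 then f else if i = 1 then g else h"
  have b1: "bilin sc UNIV tscale (\<lambda>a b. ptensl sc [a, b, c])" for c
    by (rule bilinI) (simp_all add: ptensl3_lin)
  have b2: "bilin sc UNIV tscale (\<lambda>a b. ptensl sc [c, a, b])" for c
    by (rule bilinI) (simp_all add: ptensl3_lin)
  have t1: "tapp sc 2 UNIV (\<lambda>w. ptensl sc [w!0, w!1, y]) (\<Delta> a) = (\<Sum>(c, d)\<leftarrow>rep a. ptensl sc [c, d, y])" for a y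
    by (subst tapp_comult[OF vector_space_tscale]) (auto simp: b1)
  have t2: "tapp sc 2 UNIV (\<lambda>w. ptensl sc [y, w!0, w!1]) (\<Delta> a) = (\<Sum>(c, d)\<leftarrow>rep a. ptensl sc [y, c, d])" for a y
    by (subst tapp_comult[OF vector_space_tscale]) (auto simp: b2)
  have B1: "bilin sc UNIV tscale (\<lambda>a b. tapp sc 2 UNIV (\<lambda>w. ptensl sc [w!0, w!1, b]) (\<Delta> a))"
  proof (rule bilinI)
    fix x y z c
    show "tapp sc 2 UNIV (\<lambda>w. ptensl sc [w!0, w!1, z]) (\<Delta> (x + y)) =
      tapp sc 2 UNIV (\<lambda>w. ptensl sc [w!0, w!1, z]) (\<Delta> x) + tapp sc 2 UNIV (\<lambda>w. ptensl sc [w!0, w!1, z]) (\<Delta> y)"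
      by (rule tapp_comult_add[OF vector_space_tscale]) (auto simp: b1)
    show "tapp sc 2 UNIV (\<lambda>w. ptensl sc [w!0, w!1, z]) (\<Delta> (sc c x)) =
      tscale c (tapp sc 2 UNIV (\<lambda>w. ptensl sc [w!0, w!1, z]) (\<Delta> x))"
      by (rule tapp_comult_scale[OF vector_space_tscale]) (auto simp: b1)
  qed (simp_all only: t1, simp_all only: ptensl3_lin case_prod_unfold sum_list_addf sum_list_distrib_scale[OF vector_space_tscale])
  have B2: "bilin sc UNIV tscale (\<lambda>b a. tapp sc 2 UNIV (\<lambda>w. ptensl sc [b, w!0, w!1]) (\<Delta> a))"
  proof (rule bilinI)
    fix x y z c
    show "tapp sc 2 UNIV (\<lambda>w. ptensl sc [z, w!0, w!1]) (\<Delta> (x + y)) =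
      tapp sc 2 UNIV (\<lambda>w. ptensl sc [z, w!0, w!1]) (\<Delta> x) + tapp sc 2 UNIV (\<lambda>w. ptensl sc [z, w!0, w!1]) (\<Delta> y)"
      by (rule tapp_comult_add[OF vector_space_tscale]) (auto simp: b2)
    show "tapp sc 2 UNIV (\<lambda>w. ptensl sc [z, w!0, w!1]) (\<Delta> (sc c x)) =
      tscale c (tapp sc 2 UNIV (\<lambda>w. ptensl sc [z, w!0, w!1]) (\<Delta> x))"
      by (rule tapp_comult_scale[OF vector_space_tscale]) (auto simp: b2)
  qed (simp_all only: t2, simp_all only: ptensl3_lin case_prod_unfold sum_list_addf sum_list_distrib_scale[OF vector_space_tscale])
  have "tapp sc 2 UNIV (\<lambda>v. tapp sc 2 UNIV (\<lambda>w. ptensl sc [w!0, w!1, v!1]) (\<Delta> (v!0))) (\<Delta> x) ?fs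
    = (\<Sum>(a, b)\<leftarrow>rep x. \<Sum>(c, d)\<leftarrow>rep a. f c * g d * h b)"
    by (subst tapp_comult[OF vector_space_tscale, where a = x])
       (auto simp: B1[unfolded t1 case_prod_unfold] t1 nth1 simp del: One_nat_def simp: case_prod_unfold sum_list_fun_apply o_def ptensl3_eval[OF l])
  also have "\<dots> = cv (cv f g) h x"
    by (simp add: cv_rep lin_cv l sum_list_mult_const case_prod_unfold)
  finally have 1: "tapp sc 2 UNIV (\<lambda>v. tapp sc 2 UNIV (\<lambda>w. ptensl sc [w!0, w!1, v!1]) (\<Delta> (v!0))) (\<Delta> x) ?fs
    = cv (cv f g) h x" .
  have "tapp sc 2 UNIV (\<lambda>v. tapp sc 2 UNIV (\<lambda>w. ptensl sc [v!0, w!0, w!1]) (\<Delta> (v!1))) (\<Delta> x) ?fs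
    = (\<Sum>(a, b)\<leftarrow>rep x. \<Sum>(c, d)\<leftarrow>rep b. f a * g c * h d)"
    by (subst tapp_comult[OF vector_space_tscale, where a = x])
       (auto simp: B2[unfolded t2 case_prod_unfold] t2 nth1 simp del: One_nat_def simp: case_prod_unfold sum_list_fun_apply o_def ptensl3_eval[OF l])
  also have "\<dots> = cv f (cv g h) x"
    by (simp add: cv_rep lin_cv l sum_list_const_mult case_prod_unfold mult.assoc)
  finally show "cv (cv f g) h x = cv f (cv g h) x" using 1 coassoc_raw[of x] by simp
qed

lemma comult_mult:
  assumes "lin sc f" "lin sc g"
  shows "cv f g (m x y) = (\<Sum>(a, b)\<leftarrow>rep x. \<Sum>(c, d)\<leftarrow>rep y. f (m a c) * g (m b d))"
proof -
  have b1: "bilin sc UNIV tscale (\<lambda>c d. ptensl sc [m a c, m b d])" for a b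
    by (rule bilinI) (use bilin_ptensl[of sc UNIV] in \<open>simp_all add: m_add m_scale bilin_def\<close>)
  have t1: "tapp sc 2 UNIV (\<lambda>w. ptensl sc [m a (w!0), m b (w!1)]) (\<Delta> y) = (\<Sum>(c, d)\<leftarrow>rep y. ptensl sc [m a c, m b d])" for a b
    by (subst tapp_comult[OF vector_space_tscale]) (auto simp: b1)
  have B: "bilin sc UNIV tscale (\<lambda>a b. tapp sc 2 UNIV (\<lambda>w. ptensl sc [m a (w!0), m b (w!1)]) (\<Delta> y))"
    unfolding t1
    by (rule bilinI) (use bilin_ptensl[of sc UNIV] in \<open>simp_all add: m_add m_scale bilin_def case_prod_unfold sum_list_addf sum_list_distrib_scale[OF vector_space_tscale]\<close>)
  have "\<Delta> (m x y) = tapp sc 2 UNIV (\<lambda>v. tapp sc 2 UNIV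
                 (\<lambda>w. ptensl sc [m (v!0) (w!0), m (v!1) (w!1)]) (\<Delta> y)) (\<Delta> x)"
    using hopf unfolding hopf_alg_def Let_def by blast
  also have "\<dots> = (\<Sum>(a, b)\<leftarrow>rep x. \<Sum>(c, d)\<leftarrow>rep y. ptensl sc [m a c, m b d])"
    by (subst tapp_comult[OF vector_space_tscale, where a = x]) (auto simp: B[unfolded t1] t1 nth1 simp del: One_nat_def)
  finally show ?thesis
    by (simp add: cv_def case_prod_unfold sum_list_fun_apply o_def ptensl2_eval assms)
qed

section \<open>The grading, its projections, and convolution\<close>

lemma G_sub: "subspace_of sc (G n)"
  using graded_hopf by (simp add: graded_hopf_def)

lemma p_decomp: "dsum_decomp G x (\<lambda>n. p n x)"
proof -
  have "\<exists>!c. dsum_decomp G x c" using graded_hopf by (simp add: graded_hopf_def)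
  hence "dsum_decomp G x (THE c. dsum_decomp G x c)" by (rule theI')
  thus ?thesis by (simp add: proj_def)
qed

lemma p_unique: "dsum_decomp G x c \<Longrightarrow> p n x = c n"
  using graded_hopf p_decomp[of x] unfolding graded_hopf_def by metis

lemma p_in: "p n x \<in> G n"
  and p_fin: "finite {n. p n x \<noteq> 0}"
  and p_sum: "(\<Sum>n | p n x \<noteq> 0. p n x) = x"
  using p_decomp[of x] by (auto simp: dsum_decomp_def)

lemma p_sum': "finite S \<Longrightarrow> {n. p n x \<noteq> 0} \<subseteq> S \<Longrightarrow> (\<Sum>n\<in>S. p n x) = x"
  using p_sum[of x] by (subst (asm) sum.mono_neutral_left[of S]) auto

lemma p_uniqueI:
  assumes "finite S" "\<And>n. c n \<in> G n" "\<And>n. n \<notin> S \<Longrightarrow> c n = 0" "x = sum c S"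
  shows "p n x = c n"
proof (rule p_unique)
  have "{n. c n \<noteq> 0} \<subseteq> S" using assms(3) by auto
  thus "dsum_decomp G x c"
    using assms unfolding dsum_decomp_def by (auto intro: finite_subset sum.mono_neutral_right)
qed

lemma p_add: "p n (x + y) = p n x + p n y"
proof -
  let ?S = "{n. p n x \<noteq> 0} \<union> {n. p n y \<noteq> 0}"
  show ?thesis
    by (rule p_uniqueI[of ?S "\<lambda>n. p n x + p n y"])
       (use p_fin in \<open>auto intro!: subspace_of_add[OF G_sub] p_in simp: sum.distrib p_sum'\<close>)
qed

lemma p_scale: "p n (sc c x) = sc c (p n x)"
proof -
  interpret v: vector_space sc by (rule vsX)
  show ?thesis
    by (rule p_uniqueI[of "{n. p n x \<noteq> 0}" "\<lambda>n. sc c (p n x)"])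
       (use p_fin in \<open>auto intro!: subspace_of_scale[OF G_sub] p_in simp: p_sum simp flip: v.scale_sum_right\<close>)
qed

lemma p_G: "x \<in> G n \<Longrightarrow> p k x = (if k = n then x else 0)"
  by (rule p_uniqueI[of "{n}"]) (use G_sub in \<open>auto simp: subspace_of_def\<close>)

lemma p_p: "p k (p n x) = (if k = n then p n x else 0)"
  using p_G[OF p_in] by auto

lemma p_0: "p n 0 = 0"
  using p_add[of n 0 0] by simp

lemma lin_p: "lin sc f \<Longrightarrow> lin sc (\<lambda>x. f (p n x))"
  by (auto simp: lin_def p_add p_scale)

lemma p_sum_f: "p n (sum f S) = (\<Sum>i\<in>S. p n (f i))"
  by (induction S rule: infinite_finite_induct) (auto simp: p_0 p_add)

lemma m_G: "x \<in> G i \<Longrightarrow> y \<in> G j \<Longrightarrow> m x y \<in> G (i + j)"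
  and one_G: "hone X \<in> G 0"
  and \<epsilon>_G: "0 < n \<Longrightarrow> x \<in> G n \<Longrightarrow> \<epsilon> x = 0"
  using graded_hopf by (auto simp: graded_hopf_def)

lemma p_m: "p n (m x y) = (\<Sum>i\<le>n. m (p i x) (p (n - i) y))"
proof -
  \<comment> \<open>\<open>N\<close> bounds \<open>n\<close> and all degrees occurring in
    \<open>x\<close> and \<open>y\<close>, so that every sum can be taken over the same
    range.\<close>
  define N where "N = n + Max (insert 0 ({n. p n x \<noteq> 0} \<union> {n. p n y \<noteq> 0}))"
  have "{n. p n x \<noteq> 0} \<subseteq> {..N}" "{n. p n y \<noteq> 0} \<subseteq> {..N}"
    unfolding N_def using p_fin[of x] p_fin[of y] by (auto intro!: trans_le_add2 Max_ge)
  hence "x = (\<Sum>i\<le>N. p i x)" "y = (\<Sum>i\<le>N. p i y)" by (simp_all add: p_sum')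
  hence "p n (m x y) = p n (m (\<Sum>i\<le>N. p i x) (\<Sum>i\<le>N. p i y))" by simp
  also have "\<dots> = (\<Sum>i\<le>N. \<Sum>j\<le>N. p n (m (p i x) (p j y)))"
    by (simp add: m_sum p_sum_f) (rule sum.swap)
  also have "\<dots> = (\<Sum>i\<le>N. \<Sum>j\<le>N. if i \<le> n \<and> j = n - i then m (p i x) (p (n - i) y) else 0)"
    by (intro sum.cong refl) (subst p_G[OF m_G[OF p_in p_in]], auto)
  also have "\<dots> = (\<Sum>i\<le>N. if i \<le> n then m (p i x) (p (n - i) y) else 0)"
    by (intro sum.cong refl) (auto simp: N_def)
  also have "\<dots> = (\<Sum>i\<le>n. m (p i x) (p (n - i) y))"
    by (rule sum.mono_neutral_cong_right) (auto simp: N_def)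
  finally show ?thesis .
qed

lemma p0_m: "p 0 (m x y) = m (p 0 x) (p 0 y)"
  and p1_m: "p (Suc 0) (m x y) = m (p 0 x) (p (Suc 0) y) + m (p (Suc 0) x) (p 0 y)"
  by (simp_all add: p_m atMost_Suc)

lemma \<epsilon>_p0: "\<epsilon> (p 0 x) = \<epsilon> x"
proof -
  have "\<epsilon> x = (\<Sum>n\<in>insert 0 {n. p n x \<noteq> 0}. \<epsilon> (p n x))"
    by (subst p_sum'[symmetric, of "insert 0 {n. p n x \<noteq> 0}"]) (auto simp: p_fin lin_sum[OF \<epsilon>_lin])
  also have "\<dots> = (\<Sum>n\<in>{0}. \<epsilon> (p n x))"
    by (rule sum.mono_neutral_right) (auto simp: p_fin intro!: \<epsilon>_G[OF _ p_in])
  finally show ?thesis by simp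
qed

lemma comult_G:
  assumes "x \<in> G n"
  obtains ps where "\<Delta> x = ten2 sc ps" "\<And>a b. (a, b) \<in> set ps \<Longrightarrow> \<exists>i\<le>n. a \<in> G i \<and> b \<in> G (n - i)"
proof -
  have "\<Delta> x \<in> gtensors2 sc G n" using assms graded_hopf by (simp add: graded_hopf_def)
  then obtain us where us: "\<Delta> x = sum_list (map (ptensl sc) us)"
    "\<forall>v\<in>set us. \<exists>i\<le>n. \<exists>a b. v = [a, b] \<and> a \<in> G i \<and> b \<in> G (n - i)"
    unfolding gtensors2_def by blast
  let ?ps = "map (\<lambda>v. (v ! 0, v ! 1)) us"
  have "map (\<lambda>(a, b). [a, b]) ?ps = us" using us(2) by (fastforce intro!: map_idI)
  hence "\<Delta> x = ten2 sc ?ps" unfolding ten2_alt us(1) by simp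
  moreover have "\<exists>i\<le>n. a \<in> G i \<and> b \<in> G (n - i)" if "(a, b) \<in> set ?ps" for a b
    using us(2) that by fastforce
  ultimately show ?thesis using that by blast
qed

text \<open>\<open>\<Delta> x\<close> is a sum of terms in \<open>G i\<close> \<otimes>
  \<open>G (n - i)\<close>, so the degree of one factor determines that of the other: projecting
  both factors has the same effect as projecting one, or gives 0.\<close>

lemma cv_eval_G:
  assumes "x \<in> G n" "lin sc f" "lin sc g"
  shows "cv (\<lambda>x. f (p i x)) (\<lambda>x. g (p j x)) x = (if i + j = n then cv (\<lambda>x. f (p i x)) g x else 0)"
    and "cv (\<lambda>x. f (p i x)) (\<lambda>x. g (p j x)) x = (if i + j = n then cv f (\<lambda>x. g (p j x)) x else 0)"
proof -
  obtain ps where ps: "\<Delta> x = ten2 sc ps" "\<And>a b. (a, b) \<in> set ps \<Longrightarrow> \<exists>i\<le>n. a \<in> G i \<and> b \<in> G (n - i)"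
    using comult_G[OF assms(1)] by blast
  have l: "lin sc (\<lambda>x. f (p i x))" "lin sc (\<lambda>x. g (p j x))" using assms lin_p by auto
  have 0: "f 0 = 0" "g 0 = 0" using assms lin_0 by auto
  have e: "cv f' g' x = (\<Sum>(a, b)\<leftarrow>ps. f' a * g' b)" if "lin sc f'" "lin sc g'" for f' g'
    unfolding cv_def ps(1) by (rule ten2_eval[OF that])
  have *: "f (p i a) * g (p j b) = (if i + j = n then f (p i a) * g b else 0)"
     "f (p i a) * g (p j b) = (if i + j = n then f a * g (p j b) else 0)" if "(a, b) \<in> set ps" for a b
    using ps(2)[OF that] by (auto simp: p_G 0 split: if_splits)
  have "(\<Sum>(a, b)\<leftarrow>ps. f (p i a) * g (p j b)) = (\<Sum>(a, b)\<leftarrow>ps. if i + j = n then f (p i a) * g b else 0)"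
   "(\<Sum>(a, b)\<leftarrow>ps. f (p i a) * g (p j b)) = (\<Sum>(a, b)\<leftarrow>ps. if i + j = n then f a * g (p j b) else 0)"
    by (rule arg_cong[where f=sum_list], rule map_cong[OF refl]; use * in \<open>simp add: case_prod_beta\<close>)+
  thus "cv (\<lambda>x. f (p i x)) (\<lambda>x. g (p j x)) x = (if i + j = n then cv (\<lambda>x. f (p i x)) g x else 0)"
    and "cv (\<lambda>x. f (p i x)) (\<lambda>x. g (p j x)) x = (if i + j = n then cv f (\<lambda>x. g (p j x)) x else 0)"
    using e assms l by (auto simp: case_prod_unfold)
qed

lemma lin_eq_sum_p:
  assumes "lin sc f" shows "f x = (\<Sum>n | p n x \<noteq> 0. f (p n x))"
  using p_sum[of x] lin_sum[OF assms, of "\<lambda>n. p n x"] by metis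

text \<open>Invariance under \<open>p i\<close> says that a functional vanishes outside degree
  \<open>i\<close>; in this form, which is the one used in \<open>valid\<close>, convolution adds
  degrees.\<close>

lemma cv_graded:
  assumes "lin sc f" "lin sc g" "\<And>x. f (p i x) = f x" "\<And>x. g (p j x) = g x"
  shows "cv f g (p (i + j) x) = cv f g x"
proof -
  have *: "cv f g (p n x) = 0" if "n \<noteq> i + j" for n
    using cv_eval_G(1)[OF p_in assms(1,2), of i j n x] that assms(3,4) by simp
  have "cv f g x = (\<Sum>n\<in>insert (i + j) {n. p n x \<noteq> 0}. cv f g (p n x))"
    by (subst p_sum'[symmetric, of "insert (i + j) {n. p n x \<noteq> 0}"]) (auto simp: p_fin lin_sum[OF lin_cv])
  also have "\<dots> = (\<Sum>n\<in>{i + j}. cv f g (p n x))"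
    by (rule sum.mono_neutral_right) (auto simp: p_fin *)
  finally show ?thesis by simp
qed

end

section \<open>Pure functionals on the cotensor coalgebra\<close>

lemma sum_sum_list_swap: "(\<Sum>i\<in>S. \<Sum>v\<leftarrow>us. f i v) = (\<Sum>v\<leftarrow>us. \<Sum>i\<in>S. (f i v :: 'a::comm_monoid_add))"
  by (induction us) (auto simp: sum.distrib)

text \<open>Isolates the first slot, where the left coaction acts in the comultiplication of Cot.
  The variant \<open>mlin_snocI\<close> isolates the last slot for the right coaction.\<close>

lemma mlin_ConsI:
  assumes "\<And>ys x y c. length ys = n \<Longrightarrow> set ys \<subseteq> D \<Longrightarrow> x \<in> D \<Longrightarrow> y \<in> D \<Longrightarrow>
      \<beta> ((x + y) # ys) = \<beta> (x # ys) + \<beta> (y # ys) \<and> \<beta> (sc c x # ys) = s c (\<beta> (x # ys))"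
    and "\<And>x. x \<in> D \<Longrightarrow> mlin sc D n s (\<lambda>ys. \<beta> (x # ys))"
  shows "mlin sc D (Suc n) s \<beta>"
  unfolding mlin_def
proof (intro allI impI, goal_cases)
  case (1 v i x y c)
  then obtain z zs where v: "v = z # zs" "length zs = n" by (cases v) auto
  show ?case
  proof (cases i)
    case 0
    thus ?thesis using assms(1)[of zs x y c] 1 v by simp
  next
    case (Suc j)
    thus ?thesis using assms(2)[of z, unfolded mlin_def, rule_format, of zs j x y c] 1 v by simp
  qed
qed

lemma mlin_snocI:
  assumes "\<And>ys x y c. length ys = n \<Longrightarrow> set ys \<subseteq> D \<Longrightarrow> x \<in> D \<Longrightarrow> y \<in> D \<Longrightarrow>
      \<beta> (ys @ [x + y]) = \<beta> (ys @ [x]) + \<beta> (ys @ [y]) \<and> \<beta> (ys @ [sc c x]) = s c (\<beta> (ys @ [x]))"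
    and "\<And>x. x \<in> D \<Longrightarrow> mlin sc D n s (\<lambda>ys. \<beta> (ys @ [x]))"
  shows "mlin sc D (Suc n) s \<beta>"
  unfolding mlin_def
proof (intro allI impI, goal_cases)
  case (1 v i x y c)
  then obtain z zs where v: "v = zs @ [z]" "length zs = n" by (cases v rule: rev_cases) auto
  show ?case
  proof (cases "i = n")
    case True
    hence "i = length zs" using v by simp
    thus ?thesis using assms(1)[of zs x y c] 1 v(1) v(2)[symmetric] by (simp add: list_update_length)
  next
    case False
    thus ?thesis using assms(2)[of z, unfolded mlin_def, rule_format, of zs i x y c] 1 v
      by (simp add: list_update_append1)
  qed
qed

lemma mlin_snoc:
  assumes "mlin sc D (Suc n) s \<beta>" "x \<in> D"
  shows "mlin sc D n s (\<lambda>v. \<beta> (v @ [x]))"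
  unfolding mlin_def
proof (intro allI impI, goal_cases)
  case (1 v i a b c)
  show ?case using assms(1)[unfolded mlin_def, rule_format, of "v @ [x]" i a b c] 1 assms(2)
    by (simp add: list_update_append1)
qed

lemma mlin_sum_list:
  assumes "vector_space s" "\<And>q. q \<in> set qs \<Longrightarrow> mlin sc D n s (\<beta> q)"
  shows "mlin sc D n s (\<lambda>v. \<Sum>q\<leftarrow>qs. \<beta> q v)"
  using assms(2)
proof (induction qs)
  case Nil
  show ?case by (simp add: mlin_def vs_zero_right[OF assms(1)])
next
  case (Cons q qs)
  interpret vector_space s by fact
  have "mlin sc D n s (\<beta> q)" "mlin sc D n s (\<lambda>v. \<Sum>q\<leftarrow>qs. \<beta> q v)" using Cons by auto
  thus ?case unfolding mlin_def by (simp add: algebra_simps)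
qed

lemma mlin_comp:
  assumes "mlin sc D n s \<beta>" "\<And>x y. L (x + y) = L x + L y" "\<And>c x. L (s c x) = s' c (L x)"
  shows "mlin sc D n s' (\<lambda>v. L (\<beta> v))"
  using assms unfolding mlin_def by simp

lemma ptensl_pair_lin:
  fixes sc :: "'k::field \<Rightarrow> 'x::ab_group_add \<Rightarrow> 'x"
  shows
  "ptensl sc [x + y, a] = ptensl sc [x, a] + ptensl sc [y, a]"
  "ptensl sc [a, x + y] = ptensl sc [a, x] + ptensl sc [a, y]"
  "ptensl sc [sc c x, a] = tscale c (ptensl sc [x, a])"
  "ptensl sc [a, sc c x] = tscale c (ptensl sc [a, x])"
  using bilin_ptensl[of sc UNIV] by (simp_all add: bilin_def)

lemma ptensl_1_lin:
  "ptensl sc [x + y] = ptensl sc [x] + ptensl sc [y :: 'x::ab_group_add]"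
  "ptensl sc [sc c x] = tscale c (ptensl sc [x])"
  by (auto simp: ptensl_def fun_eq_iff tscale_def lin_add lin_scale)

definition app :: "('x \<Rightarrow> 'k::field) list \<Rightarrow> 'x list \<Rightarrow> 'k" where
  "app gs xs = (\<Prod>(g, x)\<leftarrow>zip gs xs. g x)"

lemma app_simps [simp]:
  "app [] xs = 1" "app (g # gs) (x # xs) = g x * app gs xs"
  "length gs = length xs \<Longrightarrow> app (gs @ hs) (xs @ ys) = app gs xs * app hs ys"
  by (auto simp: app_def)

lemma ptensl_nth:
  assumes "length gs = length xs" "\<forall>g\<in>set gs. lin sc g"
  shows "ptensl sc xs (nth gs) = app gs xs"
proof -
  have "(\<Prod>i<length xs. (gs ! i) (xs ! i)) = app gs xs"
    using assms(1) by (induction rule: list_induct2) (auto simp: prod.lessThan_Suc_shift simp del: prod.lessThan_Suc)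
  thus ?thesis using assms by (auto simp: ptensl_def)
qed

lemma tensors_as_sum:
  assumes "t \<in> tensors sc n D"
  obtains vs where "t = sum_list (map (ptensl sc) vs)" "\<And>v. v \<in> set vs \<Longrightarrow> length v = n \<and> set v \<subseteq> D"
  using assms unfolding tensors_def by blast

text \<open>\<open>Inl a\<close> stands for \<open>a\<close> in degree 0, and \<open>Inr [g\<^sub>1, \<dots>, g\<^sub>n]\<close> for \<open>g\<^sub>1 \<otimes> \<dots> \<otimes> g\<^sub>n\<close> in degree \<open>n \<ge> 1\<close>;
the empty list is excluded by \<open>valid\<close> below.\<close>

type_synonym ('x, 'k) idx = "('x \<Rightarrow> 'k) + ('x \<Rightarrow> 'k) list"

text \<open>Degree 0 of a family is stored as a 1-tensor, hence the constant sequence. An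
  \<open>n\<close>-tensor reads only the first \<open>n\<close> functionals, so the values of
  \<open>nth gs\<close> past the end of the list are harmless.\<close>

fun ev :: "('x, 'k) idx \<Rightarrow> ('x, 'k) cot \<Rightarrow> 'k::field" where
  "ev (Inl a) x = x 0 (\<lambda>_. a)"
| "ev (Inr gs) x = x (length gs) (nth gs)"

fun deg :: "('x, 'k) idx \<Rightarrow> nat" where
  "deg (Inl a) = 0"
| "deg (Inr gs) = length gs"

lemma lin_ev: "lin cscale (ev I)"
  by (cases I) (auto simp: lin_def cscale_def tscale_def)

lemma embn_lin: "embn k (t + t') = embn k t + embn k (t' :: ('x, 'k::field) tensor)" "embn k (tscale c t) = cscale c (embn k t :: ('x, 'k) cot)"
  by (auto simp: embn_def cscale_def tscale_def fun_eq_iff)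

lemma ev_embn: "ev (Inr gs) (embn k t) = (if length gs = k then t (nth gs) else 0)"
  "k > 0 \<Longrightarrow> ev (Inl a) (embn k t) = 0"
  by (auto simp: embn_def)

context graded_hopf_loc
begin

section \<open>The coactions of the associated couple\<close>

abbreviation "C \<equiv> assoc_couple X"

lemma C_simps [simp]: "csc C = sc" "cA C = G 0" "cM C = G (Suc 0)" "cmult C = m" "cone C = hone X"
  "ccomult C = \<Delta>" "ccounit C = \<epsilon>" "clact C = m" "cract C = m"
  by (auto simp: assoc_couple_def)

text \<open>Sweedler terms of the left coaction. The projections force the factors into
  \<open>G 0\<close> and \<open>G (Suc 0)\<close> for every \<open>a\<close>.\<close>

definition repl :: "'h \<Rightarrow> ('h \<times> 'h) list" where
  "repl a = map (\<lambda>(c, d). (p 0 c, p (Suc 0) d)) (rep a)"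

definition repr :: "'h \<Rightarrow> ('h \<times> 'h) list" where
  "repr a = map (\<lambda>(c, d). (p (Suc 0) c, p 0 d)) (rep a)"

lemma repl_in: "set (repl a) \<subseteq> G 0 \<times> G (Suc 0)"
  and repr_in: "set (repr a) \<subseteq> G (Suc 0) \<times> G 0"
  by (auto simp: repl_def repr_def p_in)

lemma crhol: "crhol C a = ten2 sc (repl a)"
proof -
  have "bilin sc UNIV tscale (\<lambda>x y. ptensl sc [p 0 x, p (Suc 0) y])"
    by (rule bilinI) (simp_all add: p_add p_scale ptensl_pair_lin)
  thus ?thesis
    unfolding assoc_couple_def
    by (simp, subst tapp_comult[OF vector_space_tscale])
       (auto simp: ten2_def repl_def o_def case_prod_unfold)
qed

lemma crhor: "crhor C a = ten2 sc (repr a)"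
proof -
  have "bilin sc UNIV tscale (\<lambda>x y. ptensl sc [p (Suc 0) x, p 0 y])"
    by (rule bilinI) (simp_all add: p_add p_scale ptensl_pair_lin)
  thus ?thesis
    unfolding assoc_couple_def
    by (simp, subst tapp_comult[OF vector_space_tscale])
       (auto simp: ten2_def repr_def o_def case_prod_unfold)
qed

lemma repl_sum: "lin sc f \<Longrightarrow> lin sc g \<Longrightarrow> (\<Sum>(c, d)\<leftarrow>repl a. f c * g d) = cv (\<lambda>x. f (p 0 x)) (\<lambda>x. g (p (Suc 0) x)) a"
  and repr_sum: "lin sc f \<Longrightarrow> lin sc g \<Longrightarrow> (\<Sum>(c, d)\<leftarrow>repr a. f c * g d) = cv (\<lambda>x. f (p (Suc 0) x)) (\<lambda>x. g (p 0 x)) a"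
  by (simp_all add: cv_rep lin_p repl_def repr_def o_def case_prod_unfold)

lemma crhol_eval: "lin sc f \<Longrightarrow> lin sc g \<Longrightarrow> crhol C a (pr f g) = cv (\<lambda>x. f (p 0 x)) (\<lambda>x. g (p (Suc 0) x)) a"
  and crhor_eval: "lin sc f \<Longrightarrow> lin sc g \<Longrightarrow> crhor C a (pr f g) = cv (\<lambda>x. f (p (Suc 0) x)) (\<lambda>x. g (p 0 x)) a"
  by (simp_all add: crhol crhor ten2_eval repl_sum repr_sum)

sublocale L: precoalg sc UNIV "crhol C"
proof (rule precoalg.intro)
  show in2: "crhol C x \<in> tensors sc 2 UNIV" for x
    unfolding crhol by (rule ten2_in) auto
  show "crhol C (x + y) = crhol C x + crhol C y" for x y
    by (rule tensors2_eqI[OF in2 tensors_add[OF in2 in2]]) (simp add: crhol_eval lin_add[OF lin_cv])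
  show "crhol C (sc c x) = tscale c (crhol C x)" for c x
    by (rule tensors2_eqI[OF in2 tensors_scale[OF in2]]) (auto simp: tscale_def crhol_eval lin_scale[OF lin_cv])
qed (auto simp: vsX)

sublocale R: precoalg sc UNIV "crhor C"
proof (rule precoalg.intro)
  show in2: "crhor C x \<in> tensors sc 2 UNIV" for x
    unfolding crhor by (rule ten2_in) auto
  show "crhor C (x + y) = crhor C x + crhor C y" for x y
    by (rule tensors2_eqI[OF in2 tensors_add[OF in2 in2]]) (simp add: crhor_eval lin_add[OF lin_cv])
  show "crhor C (sc c x) = tscale c (crhor C x)" for c x
    by (rule tensors2_eqI[OF in2 tensors_scale[OF in2]]) (auto simp: tscale_def crhor_eval lin_scale[OF lin_cv])
qed (auto simp: vsX)

lemma tapp_crhol: "vector_space s \<Longrightarrow> bilin sc UNIV s (\<lambda>x y. \<beta> [x, y]) \<Longrightarrow>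
    tapp sc 2 UNIV \<beta> (crhol C a) = (\<Sum>(c, d)\<leftarrow>repl a. \<beta> [c, d])"
  and tapp_crhor: "vector_space s \<Longrightarrow> bilin sc UNIV s (\<lambda>x y. \<beta> [x, y]) \<Longrightarrow>
    tapp sc 2 UNIV \<beta> (crhor C a) = (\<Sum>(c, d)\<leftarrow>repr a. \<beta> [c, d])"
  by (simp_all add: crhol crhor tapp2[OF vsX])

lemma emb0_lin: "emb0 C (a + b) = emb0 C a + emb0 C b" "emb0 C (sc c a) = cscale c (emb0 C a)"
  by (auto simp: emb0_def cscale_def tscale_def fun_eq_iff ptensl_1_lin)

lemma ev_emb0: "ev (Inr (g # gs)) (emb0 C a) = 0" "lin sc f \<Longrightarrow> ev (Inl f) (emb0 C a) = f a"
  by (auto simp: emb0_def ptensl_def)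

section \<open>The comultiplication of Cot on pure tensors\<close>

abbreviation (input) "bL k ys \<equiv> (\<lambda>w. ptensl cscale [emb0 C (w!0), embn k (ptensl sc ((w!1) # ys))])"
abbreviation (input) "bR k ys \<equiv> (\<lambda>w. ptensl cscale [embn k (ptensl sc (ys @ [w!0])), emb0 C (w!1)])"

lemma ptensl_Cons_lin: "ptensl sc ((x + y) # ys) = ptensl sc (x # ys) + ptensl sc (y # ys)"
    "ptensl sc (sc c x # ys) = tscale c (ptensl sc (x # ys))"
  using mlin_head[OF mlin_ptensl[of sc UNIV "Suc (length ys)"], of ys x y] by simp_all

lemma ptensl_snoc_lin: "ptensl sc (ys @ [x + y]) = ptensl sc (ys @ [x]) + ptensl sc (ys @ [y])"
    "ptensl sc (ys @ [sc c x]) = tscale c (ptensl sc (ys @ [x]))"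
  using mlin_ptensl[of sc UNIV "Suc (length ys)", unfolded mlin_def, rule_format, of "ys @ [x]" "length ys" x y c]
  by simp_all

lemma bilin_bL: "bilin sc UNIV tscale (\<lambda>x y. bL k ys [x, y])"
  by (rule bilinI) (simp_all add: emb0_lin embn_lin ptensl_Cons_lin ptensl_pair_lin)

lemma bilin_bR: "bilin sc UNIV tscale (\<lambda>x y. bR k ys [x, y])"
  by (rule bilinI) (simp_all add: emb0_lin embn_lin ptensl_snoc_lin ptensl_pair_lin)

lemma mlin_L:
  assumes "k > 0"
  shows "mlin sc UNIV k tscale (\<lambda>v. tapp sc 2 UNIV (bL k (tl v)) (crhol C (v!0)))"
proof -
  obtain n where k: "k = Suc n" using assms by (cases k) auto
  have "mlin sc UNIV (Suc n) tscale (\<lambda>v. tapp sc 2 UNIV (bL k (tl v)) (crhol C (v!0)))"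
  proof (rule mlin_ConsI, goal_cases)
    case (1 ys x y c)
    show ?case
      using L.tapp_comult_add[OF vector_space_tscale, of UNIV "bL k ys" x y, OF _ _ bilin_bL]
       L.tapp_comult_scale[OF vector_space_tscale, of UNIV "bL k ys" x c, OF _ _ bilin_bL] by simp
  next
    case (2 x)
    have "mlin sc UNIV n tscale (\<lambda>ys. \<Sum>q\<leftarrow>repl x. ptensl cscale [emb0 C (fst q), embn k (ptensl sc (snd q # ys))])"
    proof (rule mlin_sum_list[OF vector_space_tscale])
      fix q :: "'h \<times> 'h"
      have "mlin sc UNIV n tscale (\<lambda>ys. ptensl sc (snd q # ys))"
        by (rule mlin_Cons[OF mlin_ptensl]) simp
      thus "mlin sc UNIV n tscale (\<lambda>ys. ptensl cscale [emb0 C (fst q), embn k (ptensl sc (snd q # ys))])"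
        by (rule mlin_comp[of _ _ _ _ _ "\<lambda>t. ptensl cscale [emb0 C (fst q), embn k t]"])
           (simp_all add: embn_lin ptensl_pair_lin)
    qed
    thus ?case by (simp add: tapp_crhol[OF vector_space_tscale bilin_bL, simplified] case_prod_unfold)
  qed
  thus ?thesis using k by simp
qed

lemma mlin_R:
  assumes "k > 0"
  shows "mlin sc UNIV k tscale (\<lambda>v. tapp sc 2 UNIV (bR k (butlast v)) (crhor C (last v)))"
proof -
  obtain n where k: "k = Suc n" using assms by (cases k) auto
  have "mlin sc UNIV (Suc n) tscale (\<lambda>v. tapp sc 2 UNIV (bR k (butlast v)) (crhor C (last v)))"
  proof (rule mlin_snocI, goal_cases)
    case (1 ys x y c)
    show ?case
      using R.tapp_comult_add[OF vector_space_tscale, of UNIV "bR k ys" x y, OF _ _ bilin_bR]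
       R.tapp_comult_scale[OF vector_space_tscale, of UNIV "bR k ys" x c, OF _ _ bilin_bR] by simp
  next
    case (2 x)
    have "mlin sc UNIV n tscale (\<lambda>ys. \<Sum>q\<leftarrow>repr x. ptensl cscale [embn k (ptensl sc (ys @ [fst q])), emb0 C (snd q)])"
    proof (rule mlin_sum_list[OF vector_space_tscale])
      fix q :: "'h \<times> 'h"
      have "mlin sc UNIV n tscale (\<lambda>ys. ptensl sc (ys @ [fst q]))"
        by (rule mlin_snoc[OF mlin_ptensl]) simp
      thus "mlin sc UNIV n tscale (\<lambda>ys. ptensl cscale [embn k (ptensl sc (ys @ [fst q])), emb0 C (snd q)])"
        by (rule mlin_comp[of _ _ _ _ _ "\<lambda>t. ptensl cscale [embn k t, emb0 C (snd q)]"])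
           (simp_all add: embn_lin ptensl_pair_lin)
    qed
    thus ?case by (simp add: tapp_crhor[OF vector_space_tscale bilin_bR, simplified] case_prod_unfold)
  qed
  thus ?thesis using k by simp
qed

lemma mlin_M:
  assumes "i < k"
  shows "mlin sc UNIV k tscale (\<lambda>v. ptensl cscale [embn i (ptensl sc (take i v)), embn (k - i) (ptensl sc (drop i v))])"
  unfolding mlin_def
proof (intro allI impI, goal_cases)
  case (1 v l x y c)
  show ?case
  proof (cases "l < i")
    case True
    have "length (take i v) = i" using 1 assms by simp
    thus ?thesis
      using mlin_ptensl[of sc UNIV i, unfolded mlin_def, rule_format, of "take i v" l x y c] True
      by (simp add: take_update_swap embn_lin ptensl_pair_lin)
  next
    case False
    have "length (drop i v) = k - i" using 1 assms by simp
    thus ?thesis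
      using mlin_ptensl[of sc UNIV "k - i", unfolded mlin_def, rule_format, of "drop i v" "l - i" x y c] False 1
      by (simp add: drop_update_swap embn_lin ptensl_pair_lin)
  qed
qed

definition lpairs :: "nat \<Rightarrow> 'h list \<Rightarrow> (('h, 'k) cot \<times> ('h, 'k) cot) list" where
  "lpairs k v = map (\<lambda>(a, b). (emb0 C a, embn k (ptensl sc (b # tl v)))) (repl (v ! 0))"

definition rpairs :: "nat \<Rightarrow> 'h list \<Rightarrow> (('h, 'k) cot \<times> ('h, 'k) cot) list" where
  "rpairs k v = map (\<lambda>(a, b). (embn k (ptensl sc (butlast v @ [a])), emb0 C b)) (repr (last v))"

definition mpairs :: "nat \<Rightarrow> 'h list \<Rightarrow> (('h, 'k) cot \<times> ('h, 'k) cot) list" where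
  "mpairs k v = map (\<lambda>i. (embn i (ptensl sc (take i v)), embn (k - i) (ptensl sc (drop i v)))) [1..<k]"

lemma comult_hom_pos:
  assumes k: "k > 0" and vs: "\<And>v. v \<in> set vs \<Longrightarrow> length v = k"
  shows "comult_hom C k (sum_list (map (ptensl sc) vs)) = (\<Sum>v\<leftarrow>vs. ten2 cscale (lpairs k v @ mpairs k v @ rpairs k v))"
proof -
  have vs': "\<forall>v\<in>set vs. length v = k \<and> set v \<subseteq> UNIV" using vs by simp
  have 1: "tapp sc k UNIV (\<lambda>v. tapp sc 2 UNIV (bL k (tl v)) (crhol C (v!0))) (sum_list (map (ptensl sc) vs))
     = (\<Sum>v\<leftarrow>vs. ten2 cscale (lpairs k v))"
    by (subst tapp_sum_ptensl[OF vsX vector_space_tscale subspace_of_UNIV mlin_L[OF k] vs'])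
      (simp add: tapp_crhol[OF vector_space_tscale bilin_bL, simplified] lpairs_def ten2_def o_def case_prod_unfold)
  have 3: "tapp sc k UNIV (\<lambda>v. tapp sc 2 UNIV (bR k (butlast v)) (crhor C (last v))) (sum_list (map (ptensl sc) vs))
     = (\<Sum>v\<leftarrow>vs. ten2 cscale (rpairs k v))"
    by (subst tapp_sum_ptensl[OF vsX vector_space_tscale subspace_of_UNIV mlin_R[OF k] vs'])
      (simp add: tapp_crhor[OF vector_space_tscale bilin_bR, simplified] rpairs_def ten2_def o_def case_prod_unfold)
  have "(\<Sum>i\<in>{1..<k}. tapp sc k UNIV
           (\<lambda>v. ptensl cscale [embn i (ptensl sc (take i v)), embn (k - i) (ptensl sc (drop i v))]) (sum_list (map (ptensl sc) vs)))
    = (\<Sum>i\<in>{1..<k}. \<Sum>v\<leftarrow>vs. ptensl cscale [embn i (ptensl sc (take i v)), embn (k - i) (ptensl sc (drop i v))])"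
    by (rule sum.cong[OF refl], subst tapp_sum_ptensl[OF vsX vector_space_tscale subspace_of_UNIV mlin_M vs']) auto
  also have "\<dots> = (\<Sum>v\<leftarrow>vs. \<Sum>i\<in>{1..<k}. ptensl cscale [embn i (ptensl sc (take i v)), embn (k - i) (ptensl sc (drop i v))])"
    by (rule sum_sum_list_swap)
  also have "\<dots> = (\<Sum>v\<leftarrow>vs. ten2 cscale (mpairs k v))"
    by (simp add: mpairs_def ten2_def o_def sum_list_distinct_conv_sum_set)
  finally show ?thesis using k
    unfolding comult_hom_def Let_def by (simp add: 1[simplified] 3[simplified] ten2_simps sum_list_addf)
qed

lemma comult_hom_0: 
  assumes "\<Delta> a = ten2 sc ps"
  shows "comult_hom C 0 (ptensl sc [a]) = ten2 cscale (map (\<lambda>(b, c). (emb0 C b, emb0 C c)) ps)"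
proof -
  have b: "bilin sc UNIV tscale (\<lambda>x y. ptensl cscale [emb0 C x, emb0 C y])"
    by (rule bilinI) (simp_all add: emb0_lin ptensl_pair_lin)
  have "mlin sc UNIV 1 tscale (\<lambda>v. tapp sc 2 UNIV (\<lambda>w. ptensl cscale [emb0 C (w!0), emb0 C (w!1)]) (\<Delta> (v!0)))"
    unfolding One_nat_def
  proof (rule mlin_ConsI, goal_cases)
    case (1 ys x y c)
    show ?case
      using tapp_comult_add[OF vector_space_tscale, of UNIV "\<lambda>w. ptensl cscale [emb0 C (w!0), emb0 C (w!1)]" x y]
       tapp_comult_scale[OF vector_space_tscale, of UNIV "\<lambda>w. ptensl cscale [emb0 C (w!0), emb0 C (w!1)]" x c] b by simp
  qed (simp add: mlin_def)
  from tapp_sum_ptensl[OF vsX vector_space_tscale subspace_of_UNIV this, of "[[a]]"]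
  show ?thesis unfolding comult_hom_def Let_def
    by (simp add: assms tapp2[OF vsX vector_space_tscale subspace_of_UNIV] b)
       (simp add: ten2_def o_def case_prod_unfold)
qed

text \<open>Functionals on \<open>X\<^sub>0\<close> and \<open>X\<^sub>1\<close> are represented by functionals on \<open>X\<close> that vanish in all other degrees.\<close>

fun valid :: "('h, 'k) idx \<Rightarrow> bool" where
  "valid (Inl a) \<longleftrightarrow> lin sc a \<and> (\<forall>x. a (p 0 x) = a x)"
| "valid (Inr gs) \<longleftrightarrow> gs \<noteq> [] \<and> (\<forall>g\<in>set gs. lin sc g \<and> (\<forall>x. g (p (Suc 0) x) = g x))"

text \<open>The product of the tensor algebra of the dual of \<open>X\<^sub>1\<close> over the convolution algebra dual to \<open>X\<^sub>0\<close>,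
except that the balancing relation between adjacent factors is not imposed.\<close>

fun mul :: "('h, 'k) idx \<Rightarrow> ('h, 'k) idx \<Rightarrow> ('h, 'k) idx" where
  "mul (Inl a) (Inl b) = Inl (cv a b)"
| "mul (Inl a) (Inr gs) = Inr (cv a (hd gs) # tl gs)"
| "mul (Inr gs) (Inl b) = Inr (butlast gs @ [cv (last gs) b])"
| "mul (Inr gs) (Inr hs) = Inr (gs @ hs)"

lemma cv_deg:
  assumes "lin sc f" "lin sc g"
  shows "(\<And>x. f (p 0 x) = f x) \<Longrightarrow> (\<And>x. g (p 0 x) = g x) \<Longrightarrow> cv f g (p 0 x) = cv f g x"
   "(\<And>x. f (p 0 x) = f x) \<Longrightarrow> (\<And>x. g (p (Suc 0) x) = g x) \<Longrightarrow> cv f g (p (Suc 0) x) = cv f g x"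
   "(\<And>x. f (p (Suc 0) x) = f x) \<Longrightarrow> (\<And>x. g (p 0 x) = g x) \<Longrightarrow> cv f g (p (Suc 0) x) = cv f g x"
  using cv_graded[OF assms, of 0 0] cv_graded[OF assms, of 0 1] cv_graded[OF assms, of 1 0] by auto

lemma valid_mul: "valid I \<Longrightarrow> valid J \<Longrightarrow> valid (mul I J)"
  by (cases "(I, J)" rule: mul.cases)
     (auto simp: lin_cv cv_deg neq_Nil_conv dest: in_set_butlastD)

lemma deg_mul: "valid I \<Longrightarrow> valid J \<Longrightarrow> deg (mul I J) = deg I + deg J"
  by (cases "(I, J)" rule: mul.cases) (auto simp: neq_Nil_conv)

text \<open>The excluded pattern is a functional of degree 0 between two words: one bracketing
  merges it into the last letter on its left, the other into the first letter on its right. In every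
  other pattern both bracketings touch the same letters and associativity of convolution
  suffices.\<close>

lemma mul_assoc:
  assumes "valid I" "valid J" "valid K" "\<not> (isl J \<and> \<not> isl I \<and> \<not> isl K)"
  shows "mul (mul I J) K = mul I (mul J K)"
proof -
  have *: "gs = [] \<or> (\<exists>hs g. gs = hs @ [g])" for gs :: "('h \<Rightarrow> 'k) list" by (cases gs rule: rev_cases) auto
  show ?thesis
  proof (cases I; cases J; cases K)
    fix a gs b assume [simp]: "I = Inl a" "J = Inr gs" "K = Inl b"
    show ?thesis
    proof (cases gs rule: rev_cases)
      case (snoc hs g)
      thus ?thesis using assms by (cases hs) (auto simp: cv_assoc)
    qed (use assms in auto)
  next
    fix gs a b assume [simp]: "I = Inr gs" "J = Inl a" "K = Inl b"
    show ?thesis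
      using assms by (cases gs rule: rev_cases) (auto simp: cv_assoc)
  next
    fix gs hs a assume [simp]: "I = Inr gs" "J = Inr hs" "K = Inl a"
    show ?thesis using assms by (auto simp: butlast_append)
  qed (use assms in \<open>auto simp: cv_assoc\<close>)
qed

end

section \<open>Duality between the comultiplication of Cot and the product of pure
  functionals\<close>

lemma sum_list_zero: "(\<And>x. x \<in> set xs \<Longrightarrow> f x = 0) \<Longrightarrow> (\<Sum>x\<leftarrow>xs. f x) = (0 :: 'a::comm_monoid_add)"
  by (induction xs) auto

lemma ptensl_zero: "ptensl sc [0 :: 'x::ab_group_add] = 0"
  by (auto simp: ptensl_def fun_eq_iff lin_0)

context graded_hopf_loc
begin

lemma valid_eta: "valid (Inl a) \<Longrightarrow> (\<lambda>x. a (p 0 x)) = a" "valid (Inr gs) \<Longrightarrow> g \<in> set gs \<Longrightarrow> (\<lambda>x. g (p (Suc 0) x)) = g"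
  by auto

text \<open>By degree, at most one of the three groups of terms pairs nontrivially with
  \<open>I\<close> and \<open>J\<close>: the left coaction if only \<open>J\<close> is a word, the
  right coaction if only \<open>I\<close> is, and the deconcatenations if both are. The clauses of
  \<open>mul\<close> record exactly these pairings.\<close>

lemma comult_hom_eval1:
  assumes k: "k > 0" "length v = k" and I: "valid I" "valid J"
  shows "ten2 cscale (lpairs k v @ mpairs k v @ rpairs k v) (pr (ev I) (ev J)) = ev (mul I J) (embn k (ptensl sc v))"
proof -
  have S: "ten2 cscale qs (pr (ev I) (ev J)) = (\<Sum>(a, b)\<leftarrow>qs. ev I a * ev J b)" for qs
    by (rule ten2_eval[OF lin_ev lin_ev])
  have lz: "(\<Sum>(a, b)\<leftarrow>lpairs k v. ev I a * ev J b) = 0" if "\<not> isl I \<or> isl J"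
    by (rule sum_list_zero) (use that I k in \<open>cases I; cases J; auto simp: lpairs_def neq_Nil_conv ev_emb0 ev_embn simp del: ev.simps\<close>)
  have rz: "(\<Sum>(a, b)\<leftarrow>rpairs k v. ev I a * ev J b) = 0" if "isl I \<or> \<not> isl J"
    by (rule sum_list_zero) (use that I k in \<open>cases I; cases J; auto simp: rpairs_def neq_Nil_conv ev_emb0 ev_embn simp del: ev.simps\<close>)
  have mz: "(\<Sum>(a, b)\<leftarrow>mpairs k v. ev I a * ev J b) = 0" if "isl I \<or> isl J"
    by (rule sum_list_zero) (use that I k in \<open>cases I; cases J; auto simp: mpairs_def neq_Nil_conv ev_emb0 ev_embn simp del: ev.simps\<close>)
  show ?thesis
  proof (cases I; cases J)
    fix a b assume [simp]: "I = Inl a" "J = Inl b"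
    show ?thesis using lz mz rz k by (simp only: S) (simp add: ev_embn del: ev.simps)
  next
    fix a gs assume IJ [simp]: "I = Inl a" "J = Inr gs"
    obtain g gs' where gs: "gs = g # gs'" using I by (cases gs) auto
    obtain x xs where v: "v = x # xs" using k by (cases v) auto
    have l: "lin sc a" "lin sc g" "\<forall>h\<in>set gs'. lin sc h" using I gs by auto
    have "(\<Sum>(a, b)\<leftarrow>lpairs k v. ev I a * ev J b) =
      (\<Sum>(c, d)\<leftarrow>repl x. a c * (if length gs = k then g d * app gs' xs else 0))"
      by (simp add: lpairs_def o_def case_prod_unfold ev_emb0 ev_embn l v del: ev.simps)
         (use k l v gs in \<open>simp add: ptensl_nth cong: if_cong\<close>)
    also have "\<dots> = (if length gs = k then (\<Sum>(c, d)\<leftarrow>repl x. a c * g d) * app gs' xs else 0)"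
      by (auto simp: sum_list_mult_const[symmetric] case_prod_unfold mult.assoc)
    also have "(\<Sum>(c, d)\<leftarrow>repl x. a c * g d) = cv a g x"
      using valid_eta(1)[of a] valid_eta(2)[of gs g] I gs by (simp add: repl_sum[OF l(1,2)])
    finally show ?thesis using mz rz k l gs v
      by (simp only: S) (auto simp: S ev_embn ptensl_nth lin_cv simp del: ev.simps)
  next
    fix b gs assume IJ [simp]: "I = Inr gs" "J = Inl b"
    obtain g gs' where gs: "gs = gs' @ [g]" using I by (cases gs rule: rev_cases) auto
    obtain x xs where v: "v = xs @ [x]" using k by (cases v rule: rev_cases) auto
    have l: "lin sc b" "lin sc g" "\<forall>h\<in>set gs'. lin sc h" using I gs by auto
    have "(\<Sum>(a, b)\<leftarrow>rpairs k v. ev I a * ev J b) =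
      (\<Sum>(c, d)\<leftarrow>repr x. (if length gs = k then app gs' xs * g c else 0) * b d)"
      by (simp add: rpairs_def o_def case_prod_unfold ev_emb0 ev_embn l v del: ev.simps)
         (use k l v gs in \<open>simp add: ptensl_nth cong: if_cong\<close>)
    also have "\<dots> = (if length gs = k then app gs' xs * (\<Sum>(c, d)\<leftarrow>repr x. g c * b d) else 0)"
      by (auto simp: sum_list_const_mult[symmetric] case_prod_unfold mult.assoc)
    also have "(\<Sum>(c, d)\<leftarrow>repr x. g c * b d) = cv g b x"
      using valid_eta(1)[of b] valid_eta(2)[of gs g] I gs by (simp add: repr_sum[OF l(2,1)])
    finally show ?thesis using mz lz k l gs v
      by (simp only: S) (auto simp: S ev_embn ptensl_nth lin_cv simp del: ev.simps)
  next
    fix gs hs assume IJ [simp]: "I = Inr gs" "J = Inr hs"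
    have l: "\<forall>h\<in>set gs. lin sc h" "\<forall>h\<in>set hs. lin sc h" "gs \<noteq> []" "hs \<noteq> []" using I by auto
    have "(\<Sum>(a, b)\<leftarrow>mpairs k v. ev I a * ev J b) =
        (\<Sum>i\<in>{1..<k}. ev I (embn i (ptensl sc (take i v))) * ev J (embn (k - i) (ptensl sc (drop i v))))"
      unfolding mpairs_def by (simp add: o_def sum_list_distinct_conv_sum_set del: ev.simps)
    also have "\<dots> = (\<Sum>i\<in>{1..<k}. if i = length gs then
       (if length gs + length hs = k then app gs (take i v) * app hs (drop i v) else 0) else 0)"
      by (rule sum.cong[OF refl], use k l in \<open>auto simp: ev_embn ptensl_nth simp del: ev.simps\<close>)
    also have "\<dots> = (if length gs + length hs = k then app gs (take (length gs) v) * app hs (drop (length gs) v) else 0)"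
    proof (subst sum.delta)
      have "0 < length gs" "0 < length hs" using l by simp_all
      thus "(if length gs \<in> {1..<k} then if length gs + length hs = k then app gs (take (length gs) v) * app hs (drop (length gs) v) else 0 else 0) =
        (if length gs + length hs = k then app gs (take (length gs) v) * app hs (drop (length gs) v) else 0)"
        by (auto simp: Suc_le_eq)
    qed simp
    also have "\<dots> = (if length gs + length hs = k then app (gs @ hs) v else 0)"
      using app_simps(3)[of gs "take (length gs) v" hs "drop (length gs) v"] k by auto
    finally have e: "(\<Sum>(a, b)\<leftarrow>mpairs k v. ev I a * ev J b) = (if length gs + length hs = k then app (gs @ hs) v else 0)" .
    have "ptensl sc v (nth (gs @ hs)) = app (gs @ hs) v" if "length gs + length hs = k"
      by (rule ptensl_nth) (use that l k in auto)
    thus ?thesis using rz lz e by (simp only: S) (simp add: ev_embn del: ev.simps)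
  qed
qed

lemma embn_sum_list: "embn k (sum_list ts) = (\<Sum>t\<leftarrow>ts. embn k (t :: ('x, 'kk::field) tensor))"
proof (induction ts)
  case Nil
  show ?case by (auto simp: embn_def fun_eq_iff)
qed (simp only: embn_lin list.map sum_list.Cons)

lemma comult_hom_eval:
  assumes "k > 0" "t \<in> tensors sc k UNIV" "valid I" "valid J"
  shows "comult_hom C k t (pr (ev I) (ev J)) = ev (mul I J) (embn k t)"
proof -
  obtain us where us: "t = sum_list (map (ptensl sc) us)" "\<And>v. v \<in> set us \<Longrightarrow> length v = k \<and> set v \<subseteq> UNIV"
    by (rule tensors_as_sum[OF assms(2)]) blast
  show ?thesis
    unfolding us(1) embn_sum_list lin_sum_list[OF lin_ev]
    by (subst comult_hom_pos[OF assms(1)])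
      (use us(2) in \<open>auto simp: sum_list_fun_apply o_def comult_hom_eval1[OF assms(1) _ assms(3,4)] cong: map_cong\<close>)
qed

lemma comult_hom_eval_0:
  assumes "valid I" "valid J"
  shows "comult_hom C 0 (ptensl sc [a]) (pr (ev I) (ev J)) = ev (mul I J) (emb0 C a)"
proof -
  have e: "comult_hom C 0 (ptensl sc [a]) (pr (ev I) (ev J)) = (\<Sum>(b, c)\<leftarrow>rep a. ev I (emb0 C b) * ev J (emb0 C c))"
    by (simp add: comult_hom_0[OF rep(2)] ten2_eval[OF lin_ev lin_ev] o_def case_prod_unfold)
  have z: "ev (Inr gs) (emb0 C a) = 0" if "gs \<noteq> []" for gs a using that by (cases gs) (auto simp: ev_emb0 simp del: ev.simps)
  show ?thesis using assms unfolding e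
    by (cases I; cases J) (auto simp: z ev_emb0 cv_rep lin_cv case_prod_unfold simp del: ev.simps)
qed

text \<open>The families of tensors without the cotensor conditions.\<close>

definition precot :: "('h, 'k) cot set" where
  "precot = {x. x 0 \<in> {ptensl sc [a] | a. a \<in> G 0} \<and> (\<forall>n>0. x n \<in> tensors sc n (G (Suc 0))) \<and> finite {n. x n \<noteq> 0}}"

lemma precot_sub: "subspace_of cscale precot"
  unfolding subspace_of_def
proof (intro conjI ballI allI)
  show "0 \<in> precot" unfolding precot_def
    by (auto simp: tensors_0 intro!: exI[of _ 0] subspace_of_0[OF G_sub] simp: ptensl_zero)
next
  fix x y assume xy: "x \<in> precot" "y \<in> precot"
  have "{n. (x + y) n \<noteq> 0} \<subseteq> {n. x n \<noteq> 0} \<union> {n. y n \<noteq> 0}" by auto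
  moreover have "\<exists>a. (x + y) 0 = ptensl sc [a] \<and> a \<in> G 0"
  proof -
    obtain a b where "x 0 = ptensl sc [a]" "a \<in> G 0" "y 0 = ptensl sc [b]" "b \<in> G 0"
      using xy unfolding precot_def by blast
    thus ?thesis by (intro exI[of _ "a + b"]) (simp add: ptensl_1_lin subspace_of_add[OF G_sub])
  qed
  ultimately show "x + y \<in> precot" using xy unfolding precot_def
    by (auto intro!: tensors_add intro: finite_subset)
next
  fix c x assume x: "x \<in> precot"
  have "{n. cscale c x n \<noteq> 0} \<subseteq> {n. x n \<noteq> 0}" by (auto simp: cscale_def tscale_def fun_eq_iff)
  moreover have "\<exists>a. cscale c x 0 = ptensl sc [a] \<and> a \<in> G 0"
  proof -
    obtain a where "x 0 = ptensl sc [a]" "a \<in> G 0" using x unfolding precot_def by blast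
    thus ?thesis by (intro exI[of _ "sc c a"]) (simp add: cscale_def ptensl_1_lin subspace_of_scale[OF G_sub])
  qed
  ultimately show "cscale c x \<in> precot" using x unfolding precot_def
    by (auto simp: cscale_def intro!: tensors_scale[OF _ G_sub] intro: finite_subset)
qed

lemma tensors_p:
  assumes "t \<in> tensors sc n (G k)" "\<And>i. i < n \<Longrightarrow> lin sc (fs i)"
  shows "t fs = t (\<lambda>i x. fs i (p k x))"
proof -
  obtain us where us: "t = sum_list (map (ptensl sc) us)" "\<And>v. v \<in> set us \<Longrightarrow> length v = n \<and> set v \<subseteq> G k"
    by (rule tensors_as_sum[OF assms(1)]) blast
  have "ptensl sc v fs = ptensl sc v (\<lambda>i x. fs i (p k x))" if "v \<in> set us" for v
  proof -
    have "p k (v ! i) = v ! i" if "i < n" for i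
    proof -
      have "v ! i \<in> set v" using us(2)[OF \<open>v \<in> set us\<close>] that by auto
      thus ?thesis using p_G[of "v ! i" k k] us(2)[OF \<open>v \<in> set us\<close>] by auto
    qed
    thus ?thesis using us(2)[OF that] assms(2) by (auto simp: ptensl_def lin_p)
  qed
  thus ?thesis unfolding us(1) by (simp add: sum_list_fun_apply o_def cong: map_cong)
qed

lemma tensors_p_ev:
  assumes "x n \<in> tensors sc n (G (Suc 0))" "\<And>i. i < n \<Longrightarrow> lin sc (fs i)"
  shows "x n fs = ev (Inr (map (\<lambda>i x. fs i (p (Suc 0) x)) [0..<n])) x"
  using tensors_p[OF assms] by simp (rule tensors_cong[OF assms(1)], simp)

lemma valid_map: "n > 0 \<Longrightarrow> (\<And>i. i < n \<Longrightarrow> lin sc (fs i)) \<Longrightarrow> valid (Inr (map (\<lambda>i x. fs i (p (Suc 0) x)) [0..<n]))"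
  by (auto simp: lin_p p_p)

text \<open>A tensor over \<open>X\<^sub>1\<close> has the same value when each functional is
  composed with the projection to degree 1, and likewise in degree 0. The composed functionals are
  valid, so valid indices see everything.\<close>

lemma precot_eq:
  assumes "x \<in> precot" "y \<in> precot" "\<And>I. valid I \<Longrightarrow> ev I x = ev I y"
  shows "x = y"
proof
  fix n show "x n = y n"
  proof (cases "n = 0")
    case True
    obtain a b where ab: "x 0 = ptensl sc [a]" "a \<in> G 0" "y 0 = ptensl sc [b]" "b \<in> G 0"
      using assms unfolding precot_def by blast
    have "f a = f b" if f: "lin sc f" for f
    proof -
      have "valid (Inl (\<lambda>x. f (p 0 x)))" using f by (simp add: lin_p p_p)
      from assms(3)[OF this] show ?thesis using ab f by (simp add: ptensl_def lin_p p_G)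
    qed
    hence "a = b" by (rule functional_eqI[OF vsX])
    thus ?thesis using ab True by simp
  next
    case False
    have t: "x n \<in> tensors sc n (G (Suc 0))" "y n \<in> tensors sc n (G (Suc 0))"
      using assms False unfolding precot_def by auto
    show ?thesis
      by (rule tensors_eqI[OF t]) (use False in \<open>simp only: tensors_p_ev[of x n, OF t(1)] tensors_p_ev[of y n, OF t(2)] assms(3) valid_map\<close>)
  qed
qed

lemma precot_sep: "x \<in> precot \<Longrightarrow> (\<And>e. e \<in> ev ` Collect valid \<Longrightarrow> e x = 0) \<Longrightarrow> x = 0"
  by (rule precot_eq[OF _ subspace_of_0[OF precot_sub]]) (auto simp: lin_0[OF lin_ev])

lemma emb0_precot: "a \<in> G 0 \<Longrightarrow> emb0 C a \<in> precot"
  unfolding precot_def emb0_def by (auto simp: tensors_0)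

lemma embn_precot: "n > 0 \<Longrightarrow> t \<in> tensors sc n (G (Suc 0)) \<Longrightarrow> embn n t \<in> precot"
  unfolding precot_def embn_def
  by (auto simp: tensors_0 ptensl_zero intro!: exI[of _ "0::'h"] subspace_of_0[OF G_sub])

lemma comult_hom_precot:
  assumes "k > 0" "t \<in> tensors sc k (G (Suc 0))"
  shows "comult_hom C k t \<in> tensors cscale 2 precot"
proof -
  obtain us where us: "t = sum_list (map (ptensl sc) us)" "\<And>v. v \<in> set us \<Longrightarrow> length v = k \<and> set v \<subseteq> G (Suc 0)"
    by (rule tensors_as_sum[OF assms(2)]) blast
  have *: "ten2 cscale (lpairs k v @ mpairs k v @ rpairs k v) \<in> tensors cscale 2 precot" if v: "v \<in> set us" for v
  proof (rule ten2_in)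
    have l: "length v = k" and s: "set v \<subseteq> G (Suc 0)" using us(2)[OF v] by auto
    have "set (lpairs k v) \<subseteq> precot \<times> precot"
    proof -
      have tl: "set (tl v) \<subseteq> G (Suc 0)" using s by (cases v) auto
      show ?thesis
        using repl_in[of "v ! 0"] assms(1) l tl unfolding lpairs_def
        by (auto intro!: emb0_precot embn_precot ptensl_in_tensors)
    qed
    moreover have "set (rpairs k v) \<subseteq> precot \<times> precot"
      using repr_in[of "last v"] assms(1) l s unfolding rpairs_def
      by (auto intro!: emb0_precot embn_precot ptensl_in_tensors dest!: in_set_butlastD)
    moreover have "set (mpairs k v) \<subseteq> precot \<times> precot"
      using l s unfolding mpairs_def
      by (auto intro!: embn_precot ptensl_in_tensors dest!: in_set_takeD in_set_dropD)
    ultimately show "set (lpairs k v @ mpairs k v @ rpairs k v) \<subseteq> precot \<times> precot" by auto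
  qed
  have "set vs \<subseteq> set us \<Longrightarrow> (\<Sum>v\<leftarrow>vs. ten2 cscale (lpairs k v @ mpairs k v @ rpairs k v)) \<in> tensors cscale 2 precot" for vs
    by (induction vs) (auto simp: tensors_0 intro!: tensors_add *)
  thus ?thesis unfolding us(1) using us(2) by (subst comult_hom_pos[OF assms(1)]) auto
qed

lemma comult_hom_0_precot:
  assumes "a \<in> G 0"
  shows "comult_hom C 0 (ptensl sc [a]) \<in> tensors cscale 2 precot"
proof -
  obtain ps where ps: "\<Delta> a = ten2 sc ps" "\<And>a b. (a, b) \<in> set ps \<Longrightarrow> \<exists>i\<le>0. a \<in> G i \<and> b \<in> G (0 - i)"
    using comult_G[OF assms] by blast
  show ?thesis unfolding comult_hom_0[OF ps(1)]
    by (rule ten2_in) (use ps(2) in \<open>auto intro!: emb0_precot\<close>)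
qed

lemma tensors_sum: "(\<And>i. i \<in> S \<Longrightarrow> f i \<in> tensors s n D) \<Longrightarrow> sum f S \<in> tensors s n D"
  by (induction S rule: infinite_finite_induct) (auto simp: tensors_0 intro!: tensors_add)

lemma cot_comult_precot: "x \<in> precot \<Longrightarrow> cot_comult C x \<in> tensors cscale 2 precot"
  unfolding cot_comult_def
proof (rule tensors_sum)
  fix k assume x: "x \<in> precot"
  show "comult_hom C k (x k) \<in> tensors cscale 2 precot"
  proof (cases "k = 0")
    case True
    obtain a where "x 0 = ptensl sc [a]" "a \<in> G 0" using x unfolding precot_def by blast
    thus ?thesis using True comult_hom_0_precot by simp
  next
    case False
    thus ?thesis using x comult_hom_precot[of k] unfolding precot_def by simp
  qed
qed

lemma sum_fun_apply: "(\<Sum>i\<in>S. f i) x = (\<Sum>i\<in>S. f i x)"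
  by (induction S rule: infinite_finite_induct) auto

text \<open>The main access to the comultiplication of Cot: it is the transpose of
  \<open>mul\<close>. It follows from the homogeneous case by splitting \<open>x\<close> into its
  finitely many components.\<close>

lemma cot_comult_eval:
  assumes x: "x \<in> precot" and I: "valid I" "valid J"
  shows "cot_comult C x (pr (ev I) (ev J)) = ev (mul I J) x"
proof -
  have *: "comult_hom C k (x k) (pr (ev I) (ev J)) = ev (mul I J) (embn k (x k))" for k
  proof (cases "k = 0")
    case True
    obtain a where a: "x 0 = ptensl sc [a]" using x unfolding precot_def by blast
    have "embn 0 (x 0) = emb0 C a" using a by (auto simp: embn_def emb0_def)
    thus ?thesis using True comult_hom_eval_0[OF I] a by simp
  next
    case False
    hence "x k \<in> tensors sc k UNIV" using x tensors_mono[of _ UNIV] unfolding precot_def by blast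
    thus ?thesis using False comult_hom_eval I by simp
  qed
  have fin: "finite {k. x k \<noteq> 0}" using x unfolding precot_def by blast
  have "x = (\<Sum>k | x k \<noteq> 0. embn k (x k))"
  proof
    fix n
    have "(\<Sum>k | x k \<noteq> 0. embn k (x k)) n = (\<Sum>k | x k \<noteq> 0. if k = n then x n else 0)"
      by (subst sum_fun_apply, rule sum.cong) (auto simp: embn_def)
    thus "x n = (\<Sum>k | x k \<noteq> 0. embn k (x k)) n" using fin by (simp add: sum.delta)
  qed
  hence "ev (mul I J) x = (\<Sum>k | x k \<noteq> 0. ev (mul I J) (embn k (x k)))"
    using lin_sum[OF lin_ev, of "mul I J"] by metis
  thus ?thesis unfolding cot_comult_def sum_fun_apply * by simp
qed

text \<open>Inserting a coaction in slot \<open>i\<close> is dual to merging the functionals at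
  \<open>i\<close> and \<open>Suc i\<close> into their convolution; the projections record which of
  the two factors has degree 1.\<close>

lemma coinsert_r:
  assumes t: "t \<in> tensors sc n (G (Suc 0))" and l: "\<And>j. j < Suc n \<Longrightarrow> lin sc (fs j)" and i: "i < n"
  shows "coinsert sc (crhor C) n i t fs =
    t (\<lambda>j. if j < i then fs j else if j = i then cv (\<lambda>x. fs i (p (Suc 0) x)) (\<lambda>x. fs (Suc i) (p 0 x)) else fs (Suc j))"
proof -
  have *: "crhor C a (\<lambda>l. fs (i + l)) = cv (\<lambda>x. fs i (p (Suc 0) x)) (\<lambda>x. fs (Suc i) (p 0 x)) a" for a
    by (subst tensors2_pr[OF R.comult_in]) (use l i in \<open>simp_all add: crhor_eval\<close>)
  show ?thesis unfolding coinsert_def using l by (auto simp: * intro!: arg_cong[where f=t])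
qed

lemma coinsert_l:
  assumes t: "t \<in> tensors sc n (G (Suc 0))" and l: "\<And>j. j < Suc n \<Longrightarrow> lin sc (fs j)" and i: "i < n"
  shows "coinsert sc (crhol C) n i t fs =
    t (\<lambda>j. if j < i then fs j else if j = i then cv (\<lambda>x. fs i (p 0 x)) (\<lambda>x. fs (Suc i) (p (Suc 0) x)) else fs (Suc j))"
proof -
  have *: "crhol C a (\<lambda>l. fs (i + l)) = cv (\<lambda>x. fs i (p 0 x)) (\<lambda>x. fs (Suc i) (p (Suc 0) x)) a" for a
    by (subst tensors2_pr[OF L.comult_in]) (use l i in \<open>simp_all add: crhol_eval\<close>)
  show ?thesis unfolding coinsert_def using l by (auto simp: * intro!: arg_cong[where f=t])
qed

text \<open>The cotensor conditions, as the only instances of associativity not covered by \<open>mul_assoc\<close>.\<close>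

definition balanced :: "('h, 'k) cot \<Rightarrow> bool" where
  "balanced x \<longleftrightarrow> (\<forall>A a B. valid (Inr A) \<longrightarrow> valid (Inl a) \<longrightarrow> valid (Inr B) \<longrightarrow>
     ev (mul (mul (Inr A) (Inl a)) (Inr B)) x = ev (mul (Inr A) (mul (Inl a) (Inr B))) x)"

end

section \<open>The cotensor coalgebra\<close>

context graded_hopf_loc
begin

lemma tscale_apply: "tscale c t fs = c * t fs"
  by (simp add: tscale_def)

lemma cot_carrier_precot: "x \<in> cot_carrier C \<longleftrightarrow> x \<in> precot \<and> (\<forall>n i. Suc i < n \<longrightarrow>
    coinsert sc (crhor C) n i (x n) = coinsert sc (crhol C) n (Suc i) (x n))"
  unfolding cot_carrier_def precot_def cotens_def by auto

lemma carrier_balanced: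
  assumes x: "x \<in> cot_carrier C" shows "balanced x"
  unfolding balanced_def
proof (intro allI impI)
  fix A a B assume v: "valid (Inr A)" "valid (Inl a)" "valid (Inr B)"
  obtain A' g where A: "A = A' @ [g]" using v(1) by (cases A rule: rev_cases) auto
  obtain b B' where B: "B = b # B'" using v(3) by (cases B) auto
  \<comment> \<open>The letters of \<open>A\<close>, then \<open>a\<close>, then the letters of
    \<open>B\<close>: \<open>n + 1\<close> functionals for a tensor of rank \<open>n\<close>. The
    right coaction at \<open>i\<close> merges \<open>g\<close> with \<open>a\<close>, the left
    coaction at \<open>Suc i\<close> merges \<open>a\<close> with \<open>b\<close>, and the cotensor
    condition equates the two results.\<close>
  define fs where "fs = (!) (A' @ [g, a, b] @ B')"
  define i where "i = length A'"
  define n where "n = length A' + 2 + length B'"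
  have fA: "fs j = A' ! j" if "j < i" for j using that by (simp add: fs_def nth_append i_def)
  have fi: "fs i = g" "fs (Suc i) = a" "fs (Suc (Suc i)) = b"
    by (simp_all add: fs_def nth_append i_def)
  have fB: "fs (Suc (Suc (Suc (i + l)))) = B' ! l" for l
    by (simp add: fs_def nth_append i_def)
  have vg: "lin sc g" "(\<lambda>x. g (p (Suc 0) x)) = g" "lin sc b" "(\<lambda>x. b (p (Suc 0) x)) = b"
     "lin sc a" "(\<lambda>x. a (p 0 x)) = a" "\<forall>h\<in>set A'. lin sc h" "\<forall>h\<in>set B'. lin sc h"
    using v A B by auto
  have l: "lin sc (fs j)" if "j < Suc n" for j
  proof -
    have "fs j \<in> set (A' @ [g, a, b] @ B')" unfolding fs_def by (rule nth_mem) (use that in \<open>simp add: n_def\<close>)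
    thus ?thesis using vg by auto
  qed
  have t: "x n \<in> tensors sc n (G (Suc 0))" using x unfolding cot_carrier_precot precot_def n_def by auto
  have "coinsert sc (crhor C) n i (x n) fs = coinsert sc (crhol C) n (Suc i) (x n) fs"
    using x unfolding cot_carrier_precot by (simp add: n_def i_def)
  also have "coinsert sc (crhor C) n i (x n) fs = x n ((!) (A' @ [cv g a, b] @ B'))"
  proof (subst coinsert_r[OF t l])
    show "i < n" by (simp add: i_def n_def)
    show "x n (\<lambda>j. if j < i then fs j else if j = i then cv (\<lambda>x. fs i (p (Suc 0) x)) (\<lambda>x. fs (Suc i) (p 0 x)) else fs (Suc j))
      = x n ((!) (A' @ [cv g a, b] @ B'))"
    proof (rule tensors_cong[OF t])
      fix j assume "j < n"
      consider "j < i" | "j = i" | "j = Suc i" | l where "j = Suc (Suc (i + l))"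
        by (metis Suc_lessI add_Suc less_imp_Suc_add linorder_neqE_nat)
      thus "(if j < i then fs j else if j = i then cv (\<lambda>x. fs i (p (Suc 0) x)) (\<lambda>x. fs (Suc i) (p 0 x)) else fs (Suc j))
         = (A' @ [cv g a, b] @ B') ! j"
        by cases (auto simp: fA fi fB vg, auto simp: i_def nth_append)
    qed
  qed auto
  also have "coinsert sc (crhol C) n (Suc i) (x n) fs = x n ((!) (A' @ [g, cv a b] @ B'))"
  proof (subst coinsert_l[OF t l])
    show "Suc i < n" by (simp add: i_def n_def)
    show "x n (\<lambda>j. if j < Suc i then fs j else if j = Suc i then cv (\<lambda>x. fs (Suc i) (p 0 x)) (\<lambda>x. fs (Suc (Suc i)) (p (Suc 0) x)) else fs (Suc j))
      = x n ((!) (A' @ [g, cv a b] @ B'))"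
    proof (rule tensors_cong[OF t])
      fix j assume "j < n"
      consider "j < i" | "j = i" | "j = Suc i" | l where "j = Suc (Suc (i + l))"
        by (metis Suc_lessI add_Suc less_imp_Suc_add linorder_neqE_nat)
      thus "(if j < Suc i then fs j else if j = Suc i then cv (\<lambda>x. fs (Suc i) (p 0 x)) (\<lambda>x. fs (Suc (Suc i)) (p (Suc 0) x)) else fs (Suc j))
         = (A' @ [g, cv a b] @ B') ! j"
        by cases (auto simp: fA fi fB vg, auto simp: i_def nth_append)
    qed
  qed auto
  finally show "ev (mul (mul (Inr A) (Inl a)) (Inr B)) x = ev (mul (Inr A) (mul (Inl a) (Inr B))) x"
    unfolding A B by (simp add: n_def)
qed

lemma balanced_carrier:
  assumes x: "x \<in> precot" and b: "balanced x" shows "x \<in> cot_carrier C"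
  unfolding cot_carrier_precot
proof (intro conjI allI impI x ext)
  fix n i fs assume i: "Suc i < n"
  have t: "x n \<in> tensors sc n (G (Suc 0))" using x i unfolding precot_def by auto
  show "coinsert sc (crhor C) n i (x n) fs = coinsert sc (crhol C) n (Suc i) (x n) fs"
  proof (cases "\<forall>j<Suc n. lin sc (fs j)")
    case False
    thus ?thesis unfolding coinsert_def by auto
  next
    case True
    hence l: "lin sc (fs j)" if "j < Suc n" for j using that by blast
    \<comment> \<open>Arbitrary functionals are cut down to valid ones. Slot \<open>Suc i\<close>
      receives the factor of degree 0 from either coaction; all other slots receive elements of
      degree 1.\<close>
    define A' where "A' = map (\<lambda>j x. fs j (p (Suc 0) x)) [0..<i]"
    define g where "g = (\<lambda>x. fs i (p (Suc 0) x))"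
    define a where "a = (\<lambda>x. fs (Suc i) (p 0 x))"
    define b' where "b' = (\<lambda>x. fs (Suc (Suc i)) (p (Suc 0) x))"
    define B' where "B' = map (\<lambda>j x. fs j (p (Suc 0) x)) [Suc (Suc (Suc i))..<Suc n]"
    have lg: "lin sc g" "lin sc a" "lin sc b'" unfolding g_def a_def b'_def using l i by (auto intro!: lin_p)
    have gp: "g (p (Suc 0) x) = g x" "a (p 0 x) = a x" "b' (p (Suc 0) x) = b' x" for x
      by (simp_all add: g_def a_def b'_def p_p)
    have V: "valid (Inr (A' @ [g]))" "valid (Inl a)" "valid (Inr (b' # B'))"
      using lg gp l i by (auto simp: A'_def B'_def p_p simp del: upt_Suc intro!: lin_p)
    have cvp: "(\<lambda>x. cv g a (p (Suc 0) x)) = cv g a" "(\<lambda>x. cv a b' (p (Suc 0) x)) = cv a b'"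
      using cv_deg[OF lg(1,2)] cv_deg[OF lg(2,3)] gp by auto
    have lA: "length A' = i" "length B' = n - Suc (Suc i)" by (simp_all add: A'_def B'_def Suc_diff_Suc i del: upt_Suc)
    have e: "ev (Inr (A' @ [cv g a, b'] @ B')) x = ev (Inr (A' @ [g, cv a b'] @ B')) x"
      using b[unfolded balanced_def, rule_format, OF V] by simp
    have nn: "length (A' @ [cv g a, b'] @ B') = n" "length (A' @ [g, cv a b'] @ B') = n" using lA i by simp_all
    have cs: "j < i \<or> j = i \<or> j = Suc i \<or> (\<exists>l. j = Suc (Suc (i + l)))" for j
      by (metis Suc_lessI add_Suc less_imp_Suc_add linorder_neqE_nat)
    have i': "i < n" using i by simp
    have "coinsert sc (crhor C) n i (x n) fs = x n (\<lambda>j. if j < i then fs j else if j = i then cv g a else fs (Suc j))"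
      unfolding g_def a_def by (rule coinsert_r[OF t l i'])
    also have "\<dots> = x n (\<lambda>j x. (if j < i then fs j else if j = i then cv g a else fs (Suc j)) (p (Suc 0) x))"
      by (rule tensors_p[OF t]) (use l in \<open>auto simp: lin_cv\<close>)
    also have "\<dots> = x n ((!) (A' @ [cv g a, b'] @ B'))"
    proof (rule tensors_cong[OF t])
      fix j assume "j < n"
      show "(\<lambda>x. (if j < i then fs j else if j = i then cv g a else fs (Suc j)) (p (Suc 0) x)) =
          (A' @ [cv g a, b'] @ B') ! j"
        using cs[of j] \<open>j < n\<close>
        by (elim disjE exE) (auto simp: nth_append lA cvp b'_def, auto simp: A'_def B'_def simp del: upt_Suc)
    qed
    moreover have "coinsert sc (crhol C) n (Suc i) (x n) fs =
        x n (\<lambda>j. if j < Suc i then fs j else if j = Suc i then cv a b' else fs (Suc j))"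
      unfolding a_def b'_def by (rule coinsert_l[OF t l i])
    moreover have "\<dots> = x n (\<lambda>j x. (if j < Suc i then fs j else if j = Suc i then cv a b' else fs (Suc j)) (p (Suc 0) x))"
      by (rule tensors_p[OF t]) (use l in \<open>auto simp: lin_cv\<close>)
    moreover have "\<dots> = x n ((!) (A' @ [g, cv a b'] @ B'))"
    proof (rule tensors_cong[OF t])
      fix j assume "j < n"
      show "(\<lambda>x. (if j < Suc i then fs j else if j = Suc i then cv a b' else fs (Suc j)) (p (Suc 0) x)) =
          (A' @ [g, cv a b'] @ B') ! j"
        using cs[of j] \<open>j < n\<close>
        by (elim disjE exE) (auto simp: nth_append lA cvp g_def, auto simp: A'_def B'_def simp del: upt_Suc)
    qed
    ultimately show ?thesis using e nn by simp
  qed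
qed

lemma carrier_iff: "x \<in> cot_carrier C \<longleftrightarrow> x \<in> precot \<and> balanced x"
  using carrier_balanced balanced_carrier cot_carrier_precot by blast

lemma carrier_sub: "subspace_of cscale (cot_carrier C)"
proof -
  have "cot_carrier C = {x \<in> precot. balanced x}" using carrier_iff by blast
  thus ?thesis using precot_sub unfolding subspace_of_def balanced_def
    by (auto simp: lin_0[OF lin_ev] lin_add[OF lin_ev] lin_scale[OF lin_ev] simp del: ev.simps mul.simps valid.simps)
qed

lemma carrier_precot: "x \<in> cot_carrier C \<Longrightarrow> x \<in> precot"
  by (simp add: carrier_iff)

lemma assoc_carrier:
  assumes "x \<in> cot_carrier C" "valid I" "valid J" "valid K"
  shows "ev (mul (mul I J) K) x = ev (mul I (mul J K)) x"
proof (cases "isl J \<and> \<not> isl I \<and> \<not> isl K")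
  case True
  then obtain A a B where "I = Inr A" "J = Inl a" "K = Inr B" by (cases I; cases J; cases K) auto
  thus ?thesis using assms unfolding carrier_iff balanced_def by (simp del: ev.simps mul.simps valid.simps)
qed (use mul_assoc assms in auto)

lemma not_isl_mul: "\<not> isl I \<or> \<not> isl J \<Longrightarrow> \<not> isl (mul I J)"
  by (cases "(I, J)" rule: mul.cases) auto

text \<open>By \<open>tensors2_mem\<close> it is enough that slices against pure functionals are
  balanced. Such a slice \<open>z\<close> satisfies \<open>ev J z = ev (mul J I) x\<close> or the
  mirrored identity, so its balancing condition is an instance of associativity evaluated at
  \<open>x\<close>.\<close>

lemma cot_comult_carrier:
  assumes x: "x \<in> cot_carrier C"
  shows "cot_comult C x \<in> tensors cscale 2 (cot_carrier C)"
proof (rule tensors2_mem[OF vector_space_cscale precot_sub carrier_sub, where E = "ev ` Collect valid"])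
  show "cot_comult C x \<in> tensors cscale 2 precot" by (rule cot_comult_precot[OF carrier_precot[OF x]])
next
  fix e z assume e: "e \<in> ev ` Collect valid" and z: "z \<in> precot"
    "\<And>f. lin cscale f \<Longrightarrow> cot_comult C x (pr f e) = f z"
  obtain I where I: "valid I" "e = ev I" using e by auto
  have z': "ev J z = ev (mul J I) x" if "valid J" for J
    using z(2)[OF lin_ev, of J] cot_comult_eval[OF carrier_precot[OF x] that I(1)] I by simp
  have "balanced z" unfolding balanced_def
  proof (intro allI impI)
    fix A a B assume v: "valid (Inr A)" "valid (Inl a)" "valid (Inr B)"
    show "ev (mul (mul (Inr A) (Inl a)) (Inr B)) z = ev (mul (Inr A) (mul (Inl a) (Inr B))) z"
      using v I(1) by (simp add: z' valid_mul assoc_carrier[OF x] mul_assoc[of "Inl a" "Inr B" I] del: ev.simps mul.simps valid.simps)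
  qed
  thus "z \<in> cot_carrier C" using z carrier_iff by blast
next
  fix e z assume e: "e \<in> ev ` Collect valid" and z: "z \<in> precot"
    "\<And>f. lin cscale f \<Longrightarrow> cot_comult C x (pr e f) = f z"
  obtain I where I: "valid I" "e = ev I" using e by auto
  have z': "ev J z = ev (mul I J) x" if "valid J" for J
    using z(2)[OF lin_ev, of J] cot_comult_eval[OF carrier_precot[OF x] I(1) that] I by simp
  have "balanced z" unfolding balanced_def
  proof (intro allI impI)
    fix A a B assume v: "valid (Inr A)" "valid (Inl a)" "valid (Inr B)"
    \<comment> \<open>In each rebracketing the index in the middle has positive degree, so the
      pattern excluded from \<open>mul_assoc\<close> does not arise and \<open>I\<close> can be
      moved next to \<open>A\<close>.\<close>
    have "mul I (mul (mul (Inr A) (Inl a)) (Inr B)) = mul (mul (mul I (Inr A)) (Inl a)) (Inr B)"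
      using v I(1) by (subst mul_assoc[symmetric])
        (auto simp: valid_mul not_isl_mul mul_assoc[of I "Inr A" "Inl a"] simp del: valid.simps mul.simps)
    moreover have "mul I (mul (Inr A) (mul (Inl a) (Inr B))) = mul (mul I (Inr A)) (mul (Inl a) (Inr B))"
      using v I(1) by (subst mul_assoc[symmetric]) (auto simp: valid_mul not_isl_mul simp del: valid.simps mul.simps)
    moreover have "ev (mul (mul (mul I (Inr A)) (Inl a)) (Inr B)) x = ev (mul (mul I (Inr A)) (mul (Inl a) (Inr B))) x"
      using v I(1) by (intro assoc_carrier[OF x] valid_mul)
    ultimately show "ev (mul (mul (Inr A) (Inl a)) (Inr B)) z = ev (mul (Inr A) (mul (Inl a) (Inr B))) z"
      using v I(1) z' valid_mul by metis
  qed
  thus "z \<in> cot_carrier C" using z carrier_iff by blast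
qed (use lin_ev precot_sep in auto)

lemma carrier_sep: "x \<in> cot_carrier C \<Longrightarrow> (\<And>e. e \<in> ev ` Collect valid \<Longrightarrow> e x = 0) \<Longrightarrow> x = 0"
  using precot_sep carrier_precot by blast

lemma cot_comult_eqI:
  assumes "t \<in> tensors cscale 2 (cot_carrier C)" "t' \<in> tensors cscale 2 (cot_carrier C)"
    "\<And>I J. valid I \<Longrightarrow> valid J \<Longrightarrow> t (pr (ev I) (ev J)) = t' (pr (ev I) (ev J))"
  shows "t = t'"
  by (rule tensors2_sep[OF vector_space_cscale carrier_sub _ carrier_sep assms(1,2), where E = "ev ` Collect valid"])
     (use assms(3) lin_ev in auto)

sublocale K: precoalg cscale "cot_carrier C" "cot_comult C"
proof (rule precoalg.intro)
  show in2: "cot_comult C x \<in> tensors cscale 2 (cot_carrier C)" if "x \<in> cot_carrier C" for x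
    by (rule cot_comult_carrier[OF that])
  show "cot_comult C (x + y) = cot_comult C x + cot_comult C y" if "x \<in> cot_carrier C" "y \<in> cot_carrier C" for x y
    using that subspace_of_add[OF carrier_sub that]
    by (intro cot_comult_eqI) (auto intro!: tensors_add in2 simp: cot_comult_eval carrier_precot lin_add[OF lin_ev] simp del: ev.simps mul.simps valid.simps)
  show "cot_comult C (cscale c x) = tscale c (cot_comult C x)" if "x \<in> cot_carrier C" for x c
    using that subspace_of_scale[OF carrier_sub that]
    by (intro cot_comult_eqI) (auto intro!: tensors_scale in2 carrier_sub simp: cot_comult_eval carrier_precot lin_scale[OF lin_ev] tscale_apply simp del: ev.simps mul.simps valid.simps)
qed (auto simp: vector_space_cscale carrier_sub)

lemma rep_eval: "x \<in> cot_carrier C \<Longrightarrow> valid I \<Longrightarrow> valid J \<Longrightarrow> (\<Sum>(a, b)\<leftarrow>K.rep x. ev I a * ev J b) = ev (mul I J) x"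
  using cot_comult_eval[OF carrier_precot, of x I J] ten2_eval[OF lin_ev lin_ev, of "K.rep x" I J]
  by (simp add: K.rep(2)[symmetric] del: ev.simps mul.simps valid.simps)

text \<open>Used for \<open>n \<le> 1\<close> only: the components of degree 0 and 1 as elements of \<open>X\<close>.\<close>

definition cot_part :: "nat \<Rightarrow> ('h, 'k) cot \<Rightarrow> 'h" where
  "cot_part n x = tapp sc 1 UNIV (\<lambda>v. v ! 0) (x n)"

lemma mlin_hd: "mlin sc UNIV 1 sc (\<lambda>v. v ! 0)"
  by (auto simp: mlin_def)

lemma tapp_hd: "tapp sc 1 UNIV (\<lambda>v. v ! 0) (ptensl sc [a]) = a"
  using tapp_sum_ptensl[OF vsX vsX subspace_of_UNIV mlin_hd, of "[[a]]"] by simp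

lemma tensors_1:
  assumes "subspace_of sc D" "t \<in> tensors sc (Suc 0) D" obtains a where "a \<in> D" "t = ptensl sc [a]"
proof -
  obtain us where us: "t = sum_list (map (ptensl sc) us)" "\<And>v. v \<in> set us \<Longrightarrow> length v = Suc 0 \<and> set v \<subseteq> D"
    by (rule tensors_as_sum[OF assms(2)]) blast
  have "set vs \<subseteq> set us \<Longrightarrow> \<exists>a\<in>D. sum_list (map (ptensl sc) vs) = ptensl sc [a]" for vs
  proof (induction vs)
    case Nil
    show ?case by (rule bexI[of _ 0]) (use assms(1) in \<open>simp_all add: ptensl_zero subspace_of_0\<close>)
  next
    case (Cons v vs)
    then obtain a where a: "a \<in> D" "sum_list (map (ptensl sc) vs) = ptensl sc [a]" by auto
    obtain b where b: "v = [b]" "b \<in> D" using us(2)[of v] Cons.prems by (auto simp: length_Suc_conv)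
    show ?case
      by (rule bexI[of _ "b + a"]) (use a b assms(1) in \<open>simp_all add: ptensl_1_lin subspace_of_add\<close>)
  qed
  thus ?thesis using that us(1) by blast
qed

lemma cot_part_precot:
  assumes "x \<in> precot" "n \<le> 1" shows "cot_part n x \<in> G n" "x n = ptensl sc [cot_part n x]"
proof -
  obtain a where "a \<in> G n" "x n = ptensl sc [a]"
  proof (cases "n = 0")
    case True
    thus ?thesis using assms(1) that unfolding precot_def by blast
  next
    case False
    hence n: "n = Suc 0" using assms(2) by simp
    have "x (Suc 0) \<in> tensors sc (Suc 0) (G (Suc 0))" using assms unfolding precot_def by blast
    thus ?thesis using tensors_1[OF G_sub] that n by metis
  qed
  thus "cot_part n x \<in> G n" "x n = ptensl sc [cot_part n x]" by (auto simp: cot_part_def tapp_hd simp del: One_nat_def)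
qed

lemma cot_part_add: "x \<in> precot \<Longrightarrow> y \<in> precot \<Longrightarrow> n \<le> 1 \<Longrightarrow> cot_part n (x + y) = cot_part n x + cot_part n y"
  using cot_part_precot(2)[of x n] cot_part_precot(2)[of y n] unfolding cot_part_def[of n "x + y"]
  by (simp add: tapp_hd del: One_nat_def flip: ptensl_1_lin)

lemma cot_part_scale: "x \<in> precot \<Longrightarrow> n \<le> 1 \<Longrightarrow> cot_part n (cscale c x) = sc c (cot_part n x)"
  using cot_part_precot(2)[of x n] unfolding cot_part_def[of n "cscale c x"]
  by (simp add: tapp_hd cscale_def del: One_nat_def flip: ptensl_1_lin)

lemma ev_cot_part: "x \<in> precot \<Longrightarrow> lin sc a \<Longrightarrow> ev (Inl a) x = a (cot_part 0 x)"
  "x \<in> precot \<Longrightarrow> lin sc a \<Longrightarrow> ev (Inr [a]) x = a (cot_part (Suc 0) x)"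
  using cot_part_precot(2)[of x 0] cot_part_precot(2)[of x "Suc 0"] by (simp_all add: ptensl_def)

lemma ev_cpr_p: "x \<in> precot \<Longrightarrow> lin sc a \<Longrightarrow> ev (Inl (\<lambda>x. a (p 0 x))) x = a (cot_part 0 x)"
  "x \<in> precot \<Longrightarrow> lin sc a \<Longrightarrow> ev (Inr [\<lambda>x. a (p (Suc 0) x)]) x = a (cot_part (Suc 0) x)"
  using cot_part_precot(1)[of x 0] cot_part_precot(1)[of x "Suc 0"] by (simp_all add: ev_cot_part lin_p p_G del: ev.simps)

text \<open>Pairing with functionals of total degree at most 1 reduces the comultiplication of Cot
  to that of \<open>X\<close>. This is how the degree 0 and 1 data of the multiplication are later
  checked against the comultiplication.\<close>

lemma rep_cot_part:
  assumes x: "x \<in> cot_carrier C" and l: "lin sc f" "lin sc g"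
  shows "(\<Sum>(a, b)\<leftarrow>K.rep x. f (cot_part 0 a) * g (cot_part 0 b)) = cv (\<lambda>x. f (p 0 x)) (\<lambda>x. g (p 0 x)) (cot_part 0 x)"
    "(\<Sum>(a, b)\<leftarrow>K.rep x. f (cot_part 0 a) * g (cot_part (Suc 0) b)) = cv (\<lambda>x. f (p 0 x)) (\<lambda>x. g (p (Suc 0) x)) (cot_part (Suc 0) x)"
    "(\<Sum>(a, b)\<leftarrow>K.rep x. f (cot_part (Suc 0) a) * g (cot_part 0 b)) = cv (\<lambda>x. f (p (Suc 0) x)) (\<lambda>x. g (p 0 x)) (cot_part (Suc 0) x)"
proof -
  let ?f0 = "Inl (\<lambda>x. f (p 0 x))" and ?g0 = "Inl (\<lambda>x. g (p 0 x))" and ?f1 = "Inr [\<lambda>x. f (p (Suc 0) x)]"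
    and ?g1 = "Inr [\<lambda>x. g (p (Suc 0) x)]"
  have v: "valid ?f0" "valid ?g0" "valid ?f1" "valid ?g1" using l by (auto simp: lin_p p_p)
  have precot: "a \<in> precot" "b \<in> precot" if "(a, b) \<in> set (K.rep x)" for a b
    using K.rep(1)[OF x] that carrier_precot by blast+
  have "(\<Sum>(a, b)\<leftarrow>K.rep x. f (cot_part 0 a) * g (cot_part 0 b)) = (\<Sum>(a, b)\<leftarrow>K.rep x. ev ?f0 a * ev ?g0 b)"
    using precot by (intro arg_cong[where f=sum_list] map_cong) (auto simp: ev_cpr_p l simp del: ev.simps)
  thus "(\<Sum>(a, b)\<leftarrow>K.rep x. f (cot_part 0 a) * g (cot_part 0 b)) = cv (\<lambda>x. f (p 0 x)) (\<lambda>x. g (p 0 x)) (cot_part 0 x)"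
    using rep_eval[OF x v(1,2)] carrier_precot[OF x] by (simp add: ev_cot_part lin_cv del: ev.simps)
  have "(\<Sum>(a, b)\<leftarrow>K.rep x. f (cot_part 0 a) * g (cot_part (Suc 0) b)) = (\<Sum>(a, b)\<leftarrow>K.rep x. ev ?f0 a * ev ?g1 b)"
    using precot by (intro arg_cong[where f=sum_list] map_cong) (auto simp: ev_cpr_p l simp del: ev.simps)
  thus "(\<Sum>(a, b)\<leftarrow>K.rep x. f (cot_part 0 a) * g (cot_part (Suc 0) b)) = cv (\<lambda>x. f (p 0 x)) (\<lambda>x. g (p (Suc 0) x)) (cot_part (Suc 0) x)"
    using rep_eval[OF x v(1,4)] carrier_precot[OF x] by (simp add: ev_cot_part lin_cv del: ev.simps)
  have "(\<Sum>(a, b)\<leftarrow>K.rep x. f (cot_part (Suc 0) a) * g (cot_part 0 b)) = (\<Sum>(a, b)\<leftarrow>K.rep x. ev ?f1 a * ev ?g0 b)"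
    using precot by (intro arg_cong[where f=sum_list] map_cong) (auto simp: ev_cpr_p l simp del: ev.simps)
  thus "(\<Sum>(a, b)\<leftarrow>K.rep x. f (cot_part (Suc 0) a) * g (cot_part 0 b)) = cv (\<lambda>x. f (p (Suc 0) x)) (\<lambda>x. g (p 0 x)) (cot_part (Suc 0) x)"
    using rep_eval[OF x v(3,2)] carrier_precot[OF x] by (simp add: ev_cot_part lin_cv del: ev.simps)
qed

lemma emb_cot_part: "x \<in> precot \<Longrightarrow> embn 0 (x 0) = emb0 C (cot_part 0 x)" "x \<in> precot \<Longrightarrow> embn (Suc 0) (x (Suc 0)) = emb1 C (cot_part (Suc 0) x)"
  using cot_part_precot(2)[of x 0] cot_part_precot(2)[of x "Suc 0"] by (auto simp: embn_def emb0_def emb1_def)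

lemma cot_part_emb: "cot_part 0 (emb0 C a) = a" "cot_part (Suc 0) (emb0 C a) = 0" "cot_part 0 (emb1 C a) = 0" "cot_part (Suc 0) (emb1 C a) = a"
  using tapp_hd[of 0] by (simp_all add: cot_part_def emb0_def emb1_def embn_def tapp_hd ptensl_zero del: One_nat_def)

text \<open>Both sides of the balancing condition have the same degree, so the condition passes to
  homogeneous components.\<close>

lemma embn_carrier:
  assumes x: "x \<in> cot_carrier C" shows "embn n (x n) \<in> cot_carrier C" "embn n (x n) \<in> cot_deg C n"
proof -
  have precot: "embn n (x n) \<in> precot"
    using carrier_precot[OF x] subspace_of_0[OF G_sub, of 0] unfolding precot_def embn_def
    by (auto simp: tensors_0 ptensl_zero intro!: exI[of _ 0])
  have "ev I (embn n (x n)) = (if deg I = n then ev I x else 0)" for I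
    by (cases I) (auto simp: embn_def)
  hence "balanced (embn n (x n))"
    using carrier_balanced[OF x] unfolding balanced_def
    by (simp add: deg_mul valid_mul del: ev.simps mul.simps valid.simps)
  thus 1: "embn n (x n) \<in> cot_carrier C" using precot carrier_iff by blast
  thus "embn n (x n) \<in> cot_deg C n" by (auto simp: cot_deg_def embn_def)
qed

lemma carrier_sum_embn:
  assumes "finite S" "{k. x k \<noteq> 0} \<subseteq> S" shows "(\<Sum>k\<in>S. embn k (x k)) = x"
proof
  fix n
  have "(\<Sum>k\<in>S. embn k (x k)) n = (\<Sum>k\<in>S. if k = n then x n else 0)"
    by (subst sum_fun_apply, rule sum.cong) (auto simp: embn_def)
  thus "(\<Sum>k\<in>S. embn k (x k)) n = x n" using assms by (auto simp: sum.delta)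
qed

lemma ev_embn_x: "ev I (embn n (x n)) = (if deg I = n then ev I x else 0)"
  by (cases I) (auto simp: embn_def)

lemma ev_deg: "x \<in> cot_deg C n \<Longrightarrow> deg I \<noteq> n \<Longrightarrow> ev I x = 0"
  by (cases I) (auto simp: cot_deg_def)

lemma cot_comult_deg:
  assumes x: "x \<in> cot_deg C n"
  obtains ps where "cot_comult C x = ten2 cscale ps"
    "\<And>a b. (a, b) \<in> set ps \<Longrightarrow> \<exists>i\<le>n. a \<in> cot_deg C i \<and> b \<in> cot_deg C (n - i)"
proof -
  have xc: "x \<in> cot_carrier C" using x by (simp add: cot_deg_def)
  \<comment> \<open>Only products of components of complementary degree are kept. Tested on
    \<open>I\<close> and \<open>J\<close>, this retains the full sum if
    \<open>deg I + deg J = n\<close>; otherwise that sum is \<open>ev (mul I J) x\<close>, which is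
    0 by degree.\<close>
  define ps where "ps = concat (map (\<lambda>(a, b). map (\<lambda>i. (embn i (a i), embn (n - i) (b (n - i)))) [0..<Suc n]) (K.rep x))"
  have r: "a \<in> cot_carrier C" "b \<in> cot_carrier C" if "(a, b) \<in> set (K.rep x)" for a b
    using K.rep(1)[OF xc] that by blast+
  have 1: "\<exists>i\<le>n. a \<in> cot_deg C i \<and> b \<in> cot_deg C (n - i)" if "(a, b) \<in> set ps" for a b
  proof -
    obtain a' b' i where "(a', b') \<in> set (K.rep x)" "i \<le> n" "a = embn i (a' i)" "b = embn (n - i) (b' (n - i))"
      using \<open>(a, b) \<in> set ps\<close> unfolding ps_def by (auto simp: less_Suc_eq_le simp del: upt_Suc)
    thus ?thesis using r embn_carrier(2) by blast
  qed
  have "cot_comult C x = ten2 cscale ps"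
  proof (rule cot_comult_eqI)
    show "cot_comult C x \<in> tensors cscale 2 (cot_carrier C)" by (rule cot_comult_carrier[OF xc])
    show "ten2 cscale ps \<in> tensors cscale 2 (cot_carrier C)"
      by (rule ten2_in) (use 1 in \<open>fastforce simp: cot_deg_def\<close>)
    fix I J assume v: "valid I" "valid J"
    have "ten2 cscale ps (pr (ev I) (ev J)) =
      (\<Sum>(a, b)\<leftarrow>K.rep x. \<Sum>i\<leftarrow>[0..<Suc n]. ev I (embn i (a i)) * ev J (embn (n - i) (b (n - i))))"
      unfolding ten2_eval[OF lin_ev lin_ev] ps_def
      by (simp add: map_concat sum_list_concat o_def case_prod_unfold del: upt_Suc ev.simps)
    also have "\<dots> = (\<Sum>(a, b)\<leftarrow>K.rep x. if deg I + deg J = n then ev I a * ev J b else 0)"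
    proof (intro arg_cong[where f=sum_list] map_cong refl, clarify)
      fix a b
      have "(\<Sum>i\<leftarrow>[0..<Suc n]. ev I (embn i (a i)) * ev J (embn (n - i) (b (n - i)))) =
        (\<Sum>i\<in>{0..<Suc n}. if i = deg I then (if deg I + deg J = n then ev I a * ev J b else 0) else 0)"
        unfolding sum_list_distinct_conv_sum_set[OF distinct_upt] set_upt
        by (rule sum.cong) (auto simp: ev_embn_x simp del: ev.simps)
      also have "\<dots> = (if deg I + deg J = n then ev I a * ev J b else 0)"
        by (subst sum.delta) auto
      finally show "(\<Sum>i\<leftarrow>[0..<Suc n]. ev I (embn i (a i)) * ev J (embn (n - i) (b (n - i)))) =
        (if deg I + deg J = n then ev I a * ev J b else 0)" .
    qed
    also have "\<dots> = (if deg I + deg J = n then ev (mul I J) x else 0)"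
      using rep_eval[OF xc v] by (auto simp: case_prod_unfold)
    also have "\<dots> = ev (mul I J) x"
      using ev_deg[OF x, of "mul I J"] deg_mul[OF v] by auto
    finally show "cot_comult C x (pr (ev I) (ev J)) = ten2 cscale ps (pr (ev I) (ev J))"
      using cot_comult_eval[OF carrier_precot[OF xc] v] by simp
  qed
  thus ?thesis using 1 that by blast
qed

end

section \<open>The coalgebra of two cotensor factors\<close>

lemma tensors_sum_list: "(\<And>x. x \<in> set xs \<Longrightarrow> f x \<in> tensors s n D) \<Longrightarrow> (\<Sum>x\<leftarrow>xs. f x) \<in> tensors s n D"
  by (induction xs) (auto simp: tensors_0 intro!: tensors_add)

lemma ten2_concat: "ten2 s (concat pss) = (\<Sum>ps\<leftarrow>pss. ten2 s ps)"
  by (induction pss) (auto simp: ten2_simps)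

lemma ptensl_pair_0:
  fixes sc :: "'k::field \<Rightarrow> 'x::ab_group_add \<Rightarrow> 'x"
  shows "ptensl sc [0, a] = 0" "ptensl sc [a, 0] = 0"
  using ptensl_pair_lin(1)[of sc 0 0 a] ptensl_pair_lin(2)[of sc a 0 0] by (simp_all only: add_cancel_right_right add_0_right)

context graded_hopf_loc
begin

lemma CC_sub: "subspace_of tscale (CC C)"
  unfolding CC_def by (rule subspace_tensors[OF carrier_sub]) simp

text \<open>One term of the comultiplication on a tensor product, with the middle factors exchanged.
  \<open>tw1\<close> and \<open>tw2\<close> sum it over the Sweedler terms of the second and of the
  first factor, so that the nested \<open>tapp\<close> is resolved one layer at a time.\<close>

definition tw :: "('h, 'k) cot \<Rightarrow> ('h, 'k) cot \<Rightarrow> ('h, 'k) cot \<Rightarrow> ('h, 'k) cot \<Rightarrow> ((('h, 'k) cot, 'k) tensor, 'k) tensor" where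
  "tw a b c d = ptensl tscale [ptensl cscale [a, c], ptensl cscale [b, d]]"

lemma tw_lin: "tw (a + a') b c d = tw a b c d + tw a' b c d" "tw a (b + b') c d = tw a b c d + tw a b' c d"
  "tw a b (c + c') d = tw a b c d + tw a b c' d" "tw a b c (d + d') = tw a b c d + tw a b c d'"
  "tw (cscale k a) b c d = tscale k (tw a b c d)" "tw a (cscale k b) c d = tscale k (tw a b c d)"
  "tw a b (cscale k c) d = tscale k (tw a b c d)" "tw a b c (cscale k d) = tscale k (tw a b c d)"
  by (simp_all add: tw_def ptensl_pair_lin)

definition tw1 where "tw1 a b y = tapp cscale 2 UNIV (\<lambda>q. tw a b (q ! 0) (q ! 1)) (cot_comult C y)"

definition tw2 where "tw2 x y = tapp cscale 2 UNIV (\<lambda>q. tw1 (q ! 0) (q ! 1) y) (cot_comult C x)"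

lemma bilin_tw: "bilin cscale UNIV tscale (tw a b)"
  by (rule bilinI) (simp_all add: tw_lin)

lemma tw1_ten2: "cot_comult C y = ten2 cscale qs \<Longrightarrow> tw1 a b y = (\<Sum>(c, d)\<leftarrow>qs. tw a b c d)"
  unfolding tw1_def
  by (simp only:, subst tapp2[OF vector_space_cscale vector_space_tscale subspace_of_UNIV]) (simp_all add: bilin_tw)

lemma tw1_add: "y \<in> cot_carrier C \<Longrightarrow> y' \<in> cot_carrier C \<Longrightarrow> tw1 a b (y + y') = tw1 a b y + tw1 a b y'"
  unfolding tw1_def by (rule K.tapp_comult_add[OF vector_space_tscale]) (simp_all add: bilin_tw)

lemma tw1_scale: "y \<in> cot_carrier C \<Longrightarrow> tw1 a b (cscale k y) = tscale k (tw1 a b y)"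
  unfolding tw1_def by (rule K.tapp_comult_scale[OF vector_space_tscale]) (simp_all add: bilin_tw)

lemma bilin_tw1: "y \<in> cot_carrier C \<Longrightarrow> bilin cscale UNIV tscale (\<lambda>a b. tw1 a b y)"
  by (rule bilinI)
    (simp_all only: tw1_ten2[OF K.rep(2)] tw_lin case_prod_unfold sum_list_addf sum_list_distrib_scale[OF vector_space_tscale])

lemma tw2_ten2: "y \<in> cot_carrier C \<Longrightarrow> cot_comult C x = ten2 cscale ps \<Longrightarrow> tw2 x y = (\<Sum>(a, b)\<leftarrow>ps. tw1 a b y)"
  unfolding tw2_def
  by (simp only:, subst tapp2[OF vector_space_cscale vector_space_tscale subspace_of_UNIV]) (simp_all add: bilin_tw1)

lemma bilin_tw2: "bilin cscale (cot_carrier C) tscale tw2"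
proof (rule bilinI)
  fix x y z c assume xyz: "x \<in> cot_carrier C" "y \<in> cot_carrier C" "z \<in> cot_carrier C"
  show "tw2 (x + y) z = tw2 x z + tw2 y z"
    unfolding tw2_def by (rule K.tapp_comult_add[OF vector_space_tscale]) (simp_all add: bilin_tw1 xyz)
  show "tw2 z (x + y) = tw2 z x + tw2 z y"
    using xyz subspace_of_add[OF carrier_sub xyz(1,2)]
    by (simp add: tw2_ten2[OF _ K.rep(2)[OF xyz(3)]] tw1_add case_prod_unfold sum_list_addf)
next
  fix x z c assume xz: "x \<in> cot_carrier C" "z \<in> cot_carrier C"
  show "tw2 (cscale c x) z = tscale c (tw2 x z)"
    unfolding tw2_def by (rule K.tapp_comult_scale[OF vector_space_tscale]) (simp_all add: bilin_tw1 xz)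
  show "tw2 z (cscale c x) = tscale c (tw2 z x)"
    using xz subspace_of_scale[OF carrier_sub xz(1)]
    by (simp add: tw2_ten2[OF _ K.rep(2)[OF xz(2)]] tw1_scale case_prod_unfold sum_list_distrib_scale[OF vector_space_tscale])
qed

lemma cc_comult_tapp: "cc_comult C u = tapp cscale 2 (cot_carrier C) (\<lambda>v. tw2 (v ! 0) (v ! 1)) u"
  by (simp add: cc_comult_def tw2_def tw1_def tw_def)

lemma cc_comult_ten2:
  "set ps \<subseteq> cot_carrier C \<times> cot_carrier C \<Longrightarrow> cc_comult C (ten2 cscale ps) = (\<Sum>(x, y)\<leftarrow>ps. tw2 x y)"
  unfolding cc_comult_tapp
  by (subst tapp2[OF vector_space_cscale vector_space_tscale carrier_sub]) (simp_all add: bilin_tw2)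

lemma tw2_CC:
  assumes "x \<in> cot_carrier C" "y \<in> cot_carrier C"
  shows "tw2 x y \<in> tensors tscale 2 (CC C)"
proof -
  have "tw a b c d \<in> tensors tscale 2 (CC C)" if "(a, b) \<in> set (K.rep x)" "(c, d) \<in> set (K.rep y)" for a b c d
  proof -
    have "a \<in> cot_carrier C" "b \<in> cot_carrier C" "c \<in> cot_carrier C" "d \<in> cot_carrier C"
      using K.rep(1)[OF assms(1)] K.rep(1)[OF assms(2)] that by blast+
    thus ?thesis unfolding tw_def CC_def by (auto intro!: ptensl_in_tensors)
  qed
  thus ?thesis
    by (auto simp: tw2_ten2[OF assms(2) K.rep(2)[OF assms(1)]] tw1_ten2[OF K.rep(2)[OF assms(2)]] intro!: tensors_sum_list)
qed

lemma cc_comult_eval: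
  assumes "set ps \<subseteq> cot_carrier C \<times> cot_carrier C" "lin tscale \<Phi>" "lin tscale \<Psi>"
  shows "cc_comult C (ten2 cscale ps) (pr \<Phi> \<Psi>) = (\<Sum>(x, y)\<leftarrow>ps. \<Sum>(a, b)\<leftarrow>K.rep x. \<Sum>(c, d)\<leftarrow>K.rep y.
     \<Phi> (ptensl cscale [a, c]) * \<Psi> (ptensl cscale [b, d]))"
proof -
  have "tw2 x y (pr \<Phi> \<Psi>) = (\<Sum>(a, b)\<leftarrow>K.rep x. \<Sum>(c, d)\<leftarrow>K.rep y. \<Phi> (ptensl cscale [a, c]) * \<Psi> (ptensl cscale [b, d]))"
    if "(x, y) \<in> set ps" for x y
  proof -
    have xy: "x \<in> cot_carrier C" "y \<in> cot_carrier C" using that assms(1) by auto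
    show ?thesis
      by (simp add: tw2_ten2[OF xy(2) K.rep(2)[OF xy(1)]] tw1_ten2[OF K.rep(2)[OF xy(2)]] sum_list_fun_apply o_def
          case_prod_unfold tw_def ptensl2_eval assms)
  qed
  thus ?thesis unfolding cc_comult_ten2[OF assms(1)]
    by (auto simp: sum_list_fun_apply o_def case_prod_unfold intro!: arg_cong[where f=sum_list])
qed

definition ev2 :: "('h, 'k) idx \<times> ('h, 'k) idx \<Rightarrow> (('h, 'k) cot, 'k) tensor \<Rightarrow> 'k" where
  "ev2 IJ u = u (pr (ev (fst IJ)) (ev (snd IJ)))"

lemma lin_ev2: "lin tscale (ev2 IJ)"
  by (auto simp: lin_def ev2_def tscale_def)

lemma ev2_ptensl: "ev2 (I, J) (ptensl cscale [a, b]) = ev I a * ev J b"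
  by (simp add: ev2_def ptensl2_eval lin_ev)

text \<open>Because the middle factors are exchanged, the double Sweedler sum splits into a product
  of one sum for \<open>x\<close> and one for \<open>y\<close>, each given by
  \<open>rep_eval\<close>.\<close>

lemma cc_comult_ev2:
  assumes u: "u \<in> CC C" and v: "valid I" "valid J" "valid I'" "valid J'"
  shows "cc_comult C u (pr (ev2 (I, J)) (ev2 (I', J'))) = ev2 (mul I I', mul J J') u"
proof -
  obtain ps where ps: "set ps \<subseteq> cot_carrier C \<times> cot_carrier C" "u = ten2 cscale ps"
    by (rule tensors2E[OF u[unfolded CC_def]])
  have "(\<Sum>(a, b)\<leftarrow>K.rep x. \<Sum>(c, d)\<leftarrow>K.rep y. (ev I a * ev J c) * (ev I' b * ev J' d)) =
    ev (mul I I') x * ev (mul J J') y" if "(x, y) \<in> set ps" for x y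
  proof -
    have xy: "x \<in> cot_carrier C" "y \<in> cot_carrier C" using that ps by auto
    have "(\<Sum>(a, b)\<leftarrow>K.rep x. \<Sum>(c, d)\<leftarrow>K.rep y. (ev I a * ev J c) * (ev I' b * ev J' d)) =
      (\<Sum>(a, b)\<leftarrow>K.rep x. (ev I a * ev I' b) * (\<Sum>(c, d)\<leftarrow>K.rep y. ev J c * ev J' d))"
      by (simp add: sum_list_const_mult[symmetric] case_prod_unfold mult_ac del: ev.simps)
    also have "\<dots> = ev (mul I I') x * ev (mul J J') y"
      unfolding rep_eval[OF xy(2) v(2,4)]
      by (simp add: rep_eval[OF xy(1) v(1,3), symmetric] sum_list_mult_const[symmetric] case_prod_unfold del: ev.simps mul.simps)
    finally show ?thesis .
  qed
  thus ?thesis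
    unfolding ps(2) cc_comult_eval[OF ps(1) lin_ev2 lin_ev2] ev2_ptensl
    by (auto simp: ev2_def ten2_eval[OF lin_ev lin_ev] intro!: arg_cong[where f=sum_list] simp del: ev.simps mul.simps)
qed

sublocale Q: precoalg tscale "CC C" "cc_comult C"
proof (rule precoalg.intro)
  show "cc_comult C u \<in> tensors tscale 2 (CC C)" if u: "u \<in> CC C" for u
  proof -
    obtain ps where ps: "set ps \<subseteq> cot_carrier C \<times> cot_carrier C" "u = ten2 cscale ps"
      by (rule tensors2E[OF u[unfolded CC_def]])
    show ?thesis unfolding ps(2) cc_comult_ten2[OF ps(1)]
      by (rule tensors_sum_list) (use ps(1) tw2_CC in auto)
  qed
  show "cc_comult C (u + v) = cc_comult C u + cc_comult C v" if "u \<in> CC C" "v \<in> CC C" for u v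
    unfolding cc_comult_tapp
    by (rule tapp2_add[OF vector_space_cscale vector_space_tscale carrier_sub])
       (use that in \<open>simp_all add: bilin_tw2 CC_def\<close>)
  show "cc_comult C (tscale c u) = tscale c (cc_comult C u)" if "u \<in> CC C" for u c
    unfolding cc_comult_tapp
    by (rule tapp2_scale[OF vector_space_cscale vector_space_tscale carrier_sub])
       (use that in \<open>simp_all add: bilin_tw2 CC_def\<close>)
qed (auto simp: vector_space_tscale CC_sub)

lemma CC_sep:
  assumes u: "u \<in> CC C" and z: "\<And>e. e \<in> ev2 ` (Collect valid \<times> Collect valid) \<Longrightarrow> e u = 0"
  shows "u = 0"
proof (rule cot_comult_eqI)
  show "u \<in> tensors cscale 2 (cot_carrier C)" using u by (simp add: CC_def)
  show "u (pr (ev I) (ev J)) = 0 (pr (ev I) (ev J))" if "valid I" "valid J" for I J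
    using z[of "ev2 (I, J)"] that by (auto simp: ev2_def)
qed (rule tensors_0)

text \<open>Differently bracketed indices can be distinct lists with the same values on Cot. This
  lemma allows such indices to be exchanged inside \<open>ev2\<close>.\<close>

lemma ev2_cong:
  assumes u: "u \<in> CC C" and e: "\<And>x. x \<in> cot_carrier C \<Longrightarrow> ev I x = ev I' x" "\<And>x. x \<in> cot_carrier C \<Longrightarrow> ev J x = ev J' x"
  shows "ev2 (I, J) u = ev2 (I', J') u"
proof -
  obtain ps where ps: "set ps \<subseteq> cot_carrier C \<times> cot_carrier C" "u = ten2 cscale ps"
    by (rule tensors2E[OF u[unfolded CC_def]])
  have "ev I x = ev I' x \<and> ev J y = ev J' y" if "(x, y) \<in> set ps" for x y
    using that ps(1) e by blast
  thus ?thesis unfolding ps(2) ev2_def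
    by (auto simp: ten2_eval[OF lin_ev lin_ev] intro!: arg_cong[where f=sum_list] simp del: ev.simps)
qed

text \<open>Pairs of pure functionals separate \<open>CC C\<close>, so \<open>coassoc_sep\<close>
  reduces coassociativity to them. There it becomes \<open>assoc_carrier\<close> in each of the two
  factors.\<close>

sublocale Q: coalg tscale "CC C" "cc_comult C"
proof (unfold_locales)
  fix u and f g h :: "(('h, 'k) cot, 'k) tensor \<Rightarrow> 'k"
  assume u: "u \<in> CC C" and l: "lin tscale f" "lin tscale g" "lin tscale h"
  let ?E = "ev2 ` (Collect valid \<times> Collect valid)"
  have e: "Q.cv (ev2 (I, J)) (ev2 (I', J')) = (\<lambda>u. ev2 (mul I I', mul J J') (Q.P u))"
    if "valid I" "valid J" "valid I'" "valid J'" for I J I' J'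
    unfolding conv_def using cc_comult_ev2[OF Q.P(1) that] by simp
  show "Q.cv (Q.cv f g) h u = Q.cv f (Q.cv g h) u"
  proof (rule Q.coassoc_sep[of ?E, OF _ _ _ u l])
    fix f g h :: "(('h, 'k) cot, 'k) tensor \<Rightarrow> 'k" and v assume "f \<in> ?E" "g \<in> ?E" "h \<in> ?E" and v: "v \<in> CC C"
    then obtain I I' I'' J J' J'' where fgh: "f = ev2 (I, J)" "g = ev2 (I', J')" "h = ev2 (I'', J'')"
      and vl: "valid I" "valid J" "valid I'" "valid J'" "valid I''" "valid J''" by auto
    have "Q.cv (Q.cv f g) h = Q.cv (ev2 (mul I I', mul J J')) h"
      by (rule Q.cv_cong) (use fgh vl in \<open>auto simp: lin_ev2 Q.lin_cv e Q.P Q.lin_P[OF lin_ev2]\<close>)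
    hence 1: "Q.cv (Q.cv f g) h v = ev2 (mul (mul I I') I'', mul (mul J J') J'') v"
      using fgh vl v by (simp add: e valid_mul Q.P del: valid.simps mul.simps)
    have "Q.cv f (Q.cv g h) = Q.cv f (ev2 (mul I' I'', mul J' J''))"
      by (rule Q.cv_cong) (use fgh vl in \<open>auto simp: lin_ev2 Q.lin_cv e Q.P Q.lin_P[OF lin_ev2]\<close>)
    hence 2: "Q.cv f (Q.cv g h) v = ev2 (mul I (mul I' I''), mul J (mul J' J'')) v"
      using fgh vl v by (simp add: e valid_mul Q.P del: valid.simps mul.simps)
    show "Q.cv (Q.cv f g) h v = Q.cv f (Q.cv g h) v"
      unfolding 1 2 by (rule ev2_cong[OF v]) (use vl assoc_carrier in auto)
  qed (use CC_sep lin_ev2 in auto)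
qed

lemma cc_deg_CC: "u \<in> cc_deg C n \<Longrightarrow> u \<in> CC C"
proof -
  assume "u \<in> cc_deg C n"
  then obtain us where us: "u = sum_list (map (ptensl cscale) us)"
    "\<forall>v\<in>set us. \<exists>i j x y. v = [x, y] \<and> x \<in> cot_deg C i \<and> y \<in> cot_deg C j \<and> i + j = n"
    unfolding cc_deg_def by blast
  show "u \<in> CC C" unfolding us(1) CC_def
    by (rule tensors_sum_list) (use us(2) in \<open>fastforce simp: cot_deg_def intro!: ptensl_in_tensors\<close>)
qed

lemma cc_deg_rep:
  assumes "u \<in> cc_deg C n"
  obtains ps where "set ps \<subseteq> cot_carrier C \<times> cot_carrier C" "u = ten2 cscale ps"
    "\<And>x y. (x, y) \<in> set ps \<Longrightarrow> \<exists>i\<le>n. x \<in> cot_deg C i \<and> y \<in> cot_deg C (n - i)"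
proof -
  obtain us where us: "u = sum_list (map (ptensl cscale) us)"
    "\<forall>v\<in>set us. \<exists>i j x y. v = [x, y] \<and> x \<in> cot_deg C i \<and> y \<in> cot_deg C j \<and> i + j = n"
    using assms unfolding cc_deg_def by blast
  let ?ps = "map (\<lambda>v. (v ! 0, v ! 1)) us"
  have "map (\<lambda>(a, b). [a, b]) ?ps = us" using us(2) by (fastforce intro!: map_idI)
  hence 2: "u = ten2 cscale ?ps" unfolding ten2_alt us(1) by simp
  have *: "\<exists>i\<le>n. x \<in> cot_deg C i \<and> y \<in> cot_deg C (n - i)" if xy: "(x, y) \<in> set ?ps" for x y
  proof -
    obtain v where v: "v \<in> set us" "x = v ! 0" "y = v ! 1" using xy by auto
    obtain i j a b where "v = [a, b]" "a \<in> cot_deg C i" "b \<in> cot_deg C j" "i + j = n"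
      using bspec[OF us(2) v(1)] by blast
    thus ?thesis using v by (intro exI[of _ i]) auto
  qed
  have 1: "set ?ps \<subseteq> cot_carrier C \<times> cot_carrier C"
  proof (rule subrelI)
    fix x y assume "(x, y) \<in> set ?ps"
    from *[OF this] show "(x, y) \<in> cot_carrier C \<times> cot_carrier C" by (auto simp: cot_deg_def)
  qed
  show ?thesis by (rule that[OF 1 2 *])
qed

lemma ptensl_cc_deg: "x \<in> cot_deg C i \<Longrightarrow> y \<in> cot_deg C j \<Longrightarrow> ptensl cscale [x, y] \<in> cc_deg C (i + j)"
  unfolding cc_deg_def by (intro CollectI exI[of _ "[[x, y]]"]) auto

lemma cc_comult_deg:
  assumes u: "u \<in> cc_deg C n"
  obtains qs where "cc_comult C u = ten2 tscale qs"
    "\<And>a b. (a, b) \<in> set qs \<Longrightarrow> \<exists>i\<le>n. a \<in> cc_deg C i \<and> b \<in> cc_deg C (n - i)"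
proof -
  obtain ps where ps: "set ps \<subseteq> cot_carrier C \<times> cot_carrier C" "u = ten2 cscale ps"
    "\<And>x y. (x, y) \<in> set ps \<Longrightarrow> \<exists>i\<le>n. x \<in> cot_deg C i \<and> y \<in> cot_deg C (n - i)"
    using cc_deg_rep[OF u] by blast
  have "\<exists>qs. tw2 x y = ten2 tscale qs \<and> (\<forall>(a, b)\<in>set qs. \<exists>i\<le>n. a \<in> cc_deg C i \<and> b \<in> cc_deg C (n - i))"
    if "(x, y) \<in> set ps" for x y
  proof -
    obtain i where i: "i \<le> n" "x \<in> cot_deg C i" "y \<in> cot_deg C (n - i)" using ps(3)[OF \<open>(x, y) \<in> set ps\<close>] by blast
    obtain as where as: "cot_comult C x = ten2 cscale as"
      "\<And>a b. (a, b) \<in> set as \<Longrightarrow> \<exists>k\<le>i. a \<in> cot_deg C k \<and> b \<in> cot_deg C (i - k)"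
      using cot_comult_deg[OF i(2)] by blast
    obtain bs where bs: "cot_comult C y = ten2 cscale bs"
      "\<And>a b. (a, b) \<in> set bs \<Longrightarrow> \<exists>k\<le>n-i. a \<in> cot_deg C k \<and> b \<in> cot_deg C (n - i - k)"
      using cot_comult_deg[OF i(3)] by blast
    define qs where "qs = concat (map (\<lambda>(a, b). map (\<lambda>(c, d). (ptensl cscale [a, c], ptensl cscale [b, d])) bs) as)"
    have "y \<in> cot_carrier C" using i(3) by (simp add: cot_deg_def)
    hence "tw2 x y = ten2 tscale qs"
      by (simp add: tw2_ten2[OF _ as(1)] tw1_ten2[OF bs(1)] qs_def ten2_concat o_def case_prod_unfold tw_def)
        (simp add: ten2_def o_def)
    moreover have "\<exists>k\<le>n. a' \<in> cc_deg C k \<and> b' \<in> cc_deg C (n - k)" if q: "(a', b') \<in> set qs" for a' b'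
    proof -
      obtain a b c d where abcd: "(a, b) \<in> set as" "(c, d) \<in> set bs" "a' = ptensl cscale [a, c]" "b' = ptensl cscale [b, d]"
        using q unfolding qs_def by auto
      obtain k where k: "k \<le> i" "a \<in> cot_deg C k" "b \<in> cot_deg C (i - k)" using as(2)[OF abcd(1)] by blast
      obtain l where l: "l \<le> n - i" "c \<in> cot_deg C l" "d \<in> cot_deg C (n - i - l)" using bs(2)[OF abcd(2)] by blast
      have "i - k + (n - i - l) = n - (k + l)" using k(1) l(1) i(1) by simp
      thus ?thesis using ptensl_cc_deg[OF k(2) l(2)] ptensl_cc_deg[OF k(3) l(3)] abcd k(1) l(1) i(1)
        by (intro exI[of _ "k + l"]) auto
    qed
    ultimately show ?thesis by blast
  qed
  hence "\<exists>q. \<forall>xy\<in>set ps. tw2 (fst xy) (snd xy) = ten2 tscale (q xy) \<and> (\<forall>(a, b)\<in>set (q xy). \<exists>i\<le>n. a \<in> cc_deg C i \<and> b \<in> cc_deg C (n - i))"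
    by (intro bchoice) auto
  then obtain q where q: "\<And>xy. xy \<in> set ps \<Longrightarrow> tw2 (fst xy) (snd xy) = ten2 tscale (q xy)"
    "\<And>xy a b. xy \<in> set ps \<Longrightarrow> (a, b) \<in> set (q xy) \<Longrightarrow> \<exists>i\<le>n. a \<in> cc_deg C i \<and> b \<in> cc_deg C (n - i)"
    by fast
  have "cc_comult C u = ten2 tscale (concat (map q ps))"
    unfolding ps(2) cc_comult_ten2[OF ps(1)] ten2_concat using q(1)
    by (auto simp: o_def case_prod_unfold intro!: arg_cong[where f=sum_list])
  thus ?thesis using q(2) by (intro that[of "concat (map q ps)"]) auto
qed

text \<open>Both factors of a pure tensor are split into homogeneous components. The statement has
  the form of the assumption \<open>gen\<close> in \<open>cot_map\<close>, that the homogeneous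
  parts span.\<close>

lemma cc_gen:
  assumes W: "subspace_of tscale W" "\<And>n. cc_deg C n \<subseteq> W" shows "CC C \<subseteq> W"
proof
  fix u assume u: "u \<in> CC C"
  obtain ps where ps: "set ps \<subseteq> cot_carrier C \<times> cot_carrier C" "u = ten2 cscale ps"
    by (rule tensors2E[OF u[unfolded CC_def]])
  have "ptensl cscale [x, y] \<in> W" if "(x, y) \<in> set ps" for x y
  proof -
    have xy: "x \<in> cot_carrier C" "y \<in> cot_carrier C" using that ps by auto
    let ?S = "{k. x k \<noteq> 0}" and ?T = "{k. y k \<noteq> 0}"
    have f: "finite ?S" "finite ?T" using xy by (auto simp: cot_carrier_def)
    have 1: "ptensl cscale [sum g S, z] = (\<Sum>k\<in>S. ptensl cscale [g k, z])" if "finite S" for g z and S :: "nat set"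
      using that by (induction S rule: finite_induct) (simp_all only: ptensl_pair_lin ptensl_pair_0 sum.insert sum.empty not_False_eq_True)
    have 2: "ptensl cscale [z, sum g S] = (\<Sum>k\<in>S. ptensl cscale [z, g k])" if "finite S" for g z and S :: "nat set"
      using that by (induction S rule: finite_induct) (simp_all only: ptensl_pair_lin ptensl_pair_0 sum.insert sum.empty not_False_eq_True)
    have "ptensl cscale [\<Sum>k\<in>?S. embn k (x k), \<Sum>k\<in>?T. embn k (y k)] \<in> W"
      unfolding 1[OF f(1)] 2[OF f(2)]
      by (intro subspace_of_sum[OF W(1)]) (use ptensl_cc_deg embn_carrier xy W(2) in blast)
    thus ?thesis using carrier_sum_embn[OF f(1) order.refl] carrier_sum_embn[OF f(2) order.refl] by simp
  qed
  thus "u \<in> W" unfolding ps(2) ten2_def by (intro subspace_of_sum_list[OF W(1)]) auto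
qed

end

section \<open>Coalgebra morphisms into the cotensor coalgebra\<close>

lemma app_map: "length xs = n \<Longrightarrow> app (map h [0..<n]) xs = (\<Prod>i<n. h i (xs ! i))"
proof (induction n arbitrary: h xs)
  case (Suc n)
  obtain y ys where xs: "xs = y # ys" "length ys = n" using Suc.prems by (cases xs) auto
  have "map h [0..<Suc n] = h 0 # map (\<lambda>i. h (Suc i)) [0..<n]"
    by (simp only: map_upt_Suc)
  thus ?case using Suc.IH[OF xs(2), of "\<lambda>i. h (Suc i)"] xs
    by (simp add: prod.lessThan_Suc_shift del: prod.lessThan_Suc upt_Suc)
qed simp

text \<open>The source of a graded coalgebra morphism into Cot. Stated on functionals,
  \<open>f00\<close> says that \<open>f0\<close> respects comultiplication, and \<open>f01\<close>,
  \<open>f10\<close> say that \<open>f1\<close> is a map of bicomodules along \<open>f0\<close>. The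
  locale is used with \<open>X\<close> and with the tensor square of Cot as source.\<close>

locale cot_map = graded_hopf_loc X + D: coalg sd DD \<Delta>d
  for X :: "('h::ab_group_add, 'k::field) ghopf"
    and sd :: "'k \<Rightarrow> 'd::ab_group_add \<Rightarrow> 'd" and DD :: "'d set" and \<Delta>d :: "'d \<Rightarrow> ('d, 'k) tensor" +
  fixes Gd :: "nat \<Rightarrow> 'd set" and f0 f1 :: "'d \<Rightarrow> 'h"
  assumes Gd_DD: "Gd n \<subseteq> DD"
    and gen: "subspace_of sd W \<Longrightarrow> (\<And>n. Gd n \<subseteq> W) \<Longrightarrow> DD \<subseteq> W"
    and comult_Gd: "x \<in> Gd n \<Longrightarrow> \<exists>ps. \<Delta>d x = ten2 sd ps \<and> (\<forall>(a, b)\<in>set ps. \<exists>i\<le>n. a \<in> Gd i \<and> b \<in> Gd (n - i))"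
    and f0_in: "x \<in> DD \<Longrightarrow> f0 x \<in> G 0" and f1_in: "x \<in> DD \<Longrightarrow> f1 x \<in> G (Suc 0)"
    and f0_add: "x \<in> DD \<Longrightarrow> y \<in> DD \<Longrightarrow> f0 (x + y) = f0 x + f0 y"
    and f1_add: "x \<in> DD \<Longrightarrow> y \<in> DD \<Longrightarrow> f1 (x + y) = f1 x + f1 y"
    and f0_scale: "x \<in> DD \<Longrightarrow> f0 (sd c x) = sc c (f0 x)"
    and f1_scale: "x \<in> DD \<Longrightarrow> f1 (sd c x) = sc c (f1 x)"
    and f0_Gd: "x \<in> Gd n \<Longrightarrow> n \<noteq> 0 \<Longrightarrow> f0 x = 0" and f1_Gd: "x \<in> Gd n \<Longrightarrow> n \<noteq> Suc 0 \<Longrightarrow> f1 x = 0"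
    and f00: "x \<in> DD \<Longrightarrow> valid (Inl a) \<Longrightarrow> valid (Inl b) \<Longrightarrow>
      D.cv (\<lambda>x. a (f0 (D.P x))) (\<lambda>x. b (f0 (D.P x))) x = cv a b (f0 x)"
    and f01: "x \<in> DD \<Longrightarrow> valid (Inl a) \<Longrightarrow> valid (Inr [g]) \<Longrightarrow>
      D.cv (\<lambda>x. a (f0 (D.P x))) (\<lambda>x. g (f1 (D.P x))) x = cv a g (f1 x)"
    and f10: "x \<in> DD \<Longrightarrow> valid (Inl a) \<Longrightarrow> valid (Inr [g]) \<Longrightarrow>
      D.cv (\<lambda>x. g (f1 (D.P x))) (\<lambda>x. a (f0 (D.P x))) x = cv g a (f1 x)"
begin

text \<open>The natural value for the empty list would be the counit, which is not part of the
  locale. The value 0 is a placeholder that keeps \<open>lin_cprod\<close> unconditional; valid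
  words are never empty.\<close>

fun cprod :: "('d \<Rightarrow> 'k) list \<Rightarrow> 'd \<Rightarrow> 'k" where
  "cprod [] = (\<lambda>_. 0)"
| "cprod [f] = f"
| "cprod (f # g # fs) = D.cv f (cprod (g # fs))"

lemma cprod_Cons: "fs \<noteq> [] \<Longrightarrow> cprod (f # fs) = D.cv f (cprod fs)"
  by (cases fs) auto

lemma lin_cprod: "(\<And>f. f \<in> set fs \<Longrightarrow> lin sd f) \<Longrightarrow> lin sd (cprod fs)"
  by (induction fs rule: cprod.induct) (auto simp: D.lin_cv, auto simp: lin_def)

lemma cprod_append:
  assumes "fs \<noteq> []" "gs \<noteq> []" "\<And>f. f \<in> set fs \<Longrightarrow> lin sd f" "\<And>f. f \<in> set gs \<Longrightarrow> lin sd f"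
  shows "cprod (fs @ gs) = D.cv (cprod fs) (cprod gs)"
  using assms
proof (induction fs)
  case (Cons f fs)
  show ?case
  proof (cases "fs = []")
    case True
    thus ?thesis using Cons by (simp add: cprod_Cons)
  next
    case False
    thus ?thesis using Cons by (simp add: cprod_Cons D.cv_assoc lin_cprod)
  qed
qed simp

lemma lin_f0: "lin sc a \<Longrightarrow> lin sd (\<lambda>x. a (f0 (D.P x)))"
  and lin_f1: "lin sc a \<Longrightarrow> lin sd (\<lambda>x. a (f1 (D.P x)))"
  by (auto simp: lin_def D.P f0_add f1_add f0_scale f1_scale)

abbreviation "pull1 g \<equiv> (\<lambda>x. g (f1 (D.P x)))"

text \<open>The transpose of the morphism under construction: \<open>pull I\<close> is what
  \<open>ev I\<close> composed with \<open>F\<close> has to be, and \<open>ev_F\<close> confirms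
  that it is.\<close>

fun pull :: "('h, 'k) idx \<Rightarrow> 'd \<Rightarrow> 'k" where
  "pull (Inl a) = (\<lambda>x. a (f0 (D.P x)))"
| "pull (Inr gs) = cprod (map (\<lambda>g. pull1 g) gs)"

lemma lin_pull: "valid I \<Longrightarrow> lin sd (pull I)"
  by (cases I) (auto simp: lin_f0 lin_f1 intro!: lin_cprod)

lemma cv_f00: "valid (Inl a) \<Longrightarrow> valid (Inl b) \<Longrightarrow> D.cv (\<lambda>x. a (f0 (D.P x))) (\<lambda>x. b (f0 (D.P x))) = (\<lambda>x. cv a b (f0 (D.P x)))"
  and cv_f01: "valid (Inl a) \<Longrightarrow> valid (Inr [g]) \<Longrightarrow> D.cv (\<lambda>x. a (f0 (D.P x))) (pull1 g) = pull1 (cv a g)"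
  and cv_f10: "valid (Inl a) \<Longrightarrow> valid (Inr [g]) \<Longrightarrow> D.cv (pull1 g) (\<lambda>x. a (f0 (D.P x))) = pull1 (cv g a)"
  using f00[OF D.P(1), of a b] f01[OF D.P(1), of a g] f10[OF D.P(1), of a g] D.cv_P by (metis (no_types, lifting) ext)+

text \<open>A functional of degree 0 is absorbed into the neighbouring letter by \<open>f00\<close>,
  \<open>f01\<close> or \<open>f10\<close>; the remaining regrouping is associativity of convolution
  on the source.\<close>

lemma pull_mul:
  assumes v: "valid I" "valid J" shows "pull (mul I J) = D.cv (pull I) (pull J)"
proof (cases I; cases J)
  fix a b assume "I = Inl a" "J = Inl b"
  thus ?thesis using cv_f00 v by simp
next
  fix a gs assume IJ: "I = Inl a" "J = Inr gs"
  obtain g gs' where gs: "gs = g # gs'" using v IJ by (cases gs) auto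
  have e: "pull1 (cv a g) = D.cv (\<lambda>x. a (f0 (D.P x))) (pull1 g)" using cv_f01[of a g] v IJ gs by simp
  show ?thesis
  proof (cases "gs' = []")
    case True
    thus ?thesis using IJ gs e by simp
  next
    case False
    have "D.cv (D.cv (\<lambda>x. a (f0 (D.P x))) (pull1 g)) (cprod (map (\<lambda>g. pull1 g) gs')) =
      D.cv (\<lambda>x. a (f0 (D.P x))) (D.cv (pull1 g) (cprod (map (\<lambda>g. pull1 g) gs')))"
      by (rule D.cv_assoc) (use v IJ gs in \<open>auto intro!: lin_f0 lin_f1 lin_cprod\<close>)
    thus ?thesis using IJ gs e False by (simp add: cprod_Cons)
  qed
next
  fix gs a assume IJ: "I = Inr gs" "J = Inl a"
  obtain g gs' where gs: "gs = gs' @ [g]" using v IJ by (cases gs rule: rev_cases) auto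
  have e: "pull1 (cv g a) = D.cv (pull1 g) (\<lambda>x. a (f0 (D.P x)))" using cv_f10[of a g] v IJ gs by simp
  show ?thesis
  proof (cases "gs' = []")
    case True
    thus ?thesis using IJ gs e by simp
  next
    case False
    have l: "\<And>f. f \<in> set (map (\<lambda>g. pull1 g) gs') \<Longrightarrow> lin sd f" "lin sd (pull1 g)" "lin sd (\<lambda>x. a (f0 (D.P x)))"
      "lin sd (pull1 (cv g a))"
      using v IJ gs by (auto intro!: lin_f0 lin_f1 lin_cv)
    have "D.cv (D.cv (cprod (map (\<lambda>g. pull1 g) gs')) (pull1 g)) (\<lambda>x. a (f0 (D.P x))) =
      D.cv (cprod (map (\<lambda>g. pull1 g) gs')) (D.cv (pull1 g) (\<lambda>x. a (f0 (D.P x))))"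
      by (rule D.cv_assoc) (use l in \<open>auto intro!: lin_cprod\<close>)
    moreover have "pull I = D.cv (cprod (map (\<lambda>g. pull1 g) gs')) (pull1 g)"
      using IJ gs cprod_append[of "map (\<lambda>g. pull1 g) gs'" "[pull1 g]"] False l by auto
    moreover have "pull (mul I J) = D.cv (cprod (map (\<lambda>g. pull1 g) gs')) (pull1 (cv g a))"
      using IJ gs cprod_append[of "map (\<lambda>g. pull1 g) gs'" "[pull1 (cv g a)]"] False l by auto
    ultimately show ?thesis using e IJ by simp
  qed
next
  fix gs hs assume IJ: "I = Inr gs" "J = Inr hs"
  show ?thesis
    using v unfolding IJ by (simp, intro cprod_append) (auto intro!: lin_f1)
qed

text \<open>The components are written directly as functions of functionals, with the value 0 on
  non-linear arguments as in \<open>ptensl\<close>. That they are finite sums of pure tensors is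
  left to \<open>F_tensors\<close>.\<close>

definition F :: "'d \<Rightarrow> ('h, 'k) cot" where
  "F x = (\<lambda>n. if n = 0 then ptensl sc [f0 (D.P x)]
    else (\<lambda>fs. if \<forall>i<n. lin sc (fs i) then cprod (map (\<lambda>i. pull1 (fs i)) [0..<n]) x else 0))"

text \<open>\<open>us\<close> represents the iterated comultiplication of \<open>x\<close>. The
  order of quantifiers is essential: the same \<open>us\<close> serves every \<open>hs\<close>, and
  \<open>gs\<close> only fixes the number of factors.\<close>

lemma cprod_rep:
  assumes "gs \<noteq> []" "x \<in> DD"
  shows "\<exists>us. (\<forall>v\<in>set us. length v = length gs \<and> set v \<subseteq> DD) \<and>
    (\<forall>hs. length hs = length gs \<longrightarrow> (\<forall>h\<in>set hs. lin sd h) \<longrightarrow> cprod hs x = (\<Sum>v\<leftarrow>us. app hs v))"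
  using assms
proof (induction gs arbitrary: x rule: list_nonempty_induct)
  case (single g)
  show ?case
    by (rule exI[of _ "[[x]]"]) (use single in \<open>auto simp: length_Suc_conv\<close>)
next
  case (cons g gs)
  let ?R = "\<lambda>y us. (\<forall>v\<in>set us. length v = length gs \<and> set v \<subseteq> DD) \<and>
    (\<forall>hs. length hs = length gs \<longrightarrow> (\<forall>h\<in>set hs. lin sd h) \<longrightarrow> cprod hs y = (\<Sum>v\<leftarrow>us. app hs v))"
  have "\<exists>q. \<forall>y\<in>DD. ?R y (q y)" by (rule bchoice) (use cons.IH in blast)
  then obtain q where q: "\<And>y. y \<in> DD \<Longrightarrow> ?R y (q y)" by blast
  define us where "us = concat (map (\<lambda>(a, b). map (\<lambda>v. a # v) (q b)) (D.rep x))"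
  have r: "a \<in> DD" "b \<in> DD" if "(a, b) \<in> set (D.rep x)" for a b
    using D.rep(1)[OF cons.prems] that by blast+
  show ?case
  proof (rule exI[of _ us], intro conjI allI impI ballI)
    fix v assume "v \<in> set us"
    then obtain a b w where w: "(a, b) \<in> set (D.rep x)" "v = a # w" "w \<in> set (q b)" unfolding us_def by auto
    thus "length v = length (g # gs)" "set v \<subseteq> DD" using q[of b] r[OF w(1)] by auto
  next
    fix hs assume hs: "length hs = length (g # gs)" "\<forall>h\<in>set hs. lin sd h"
    then obtain h hs' where h: "hs = h # hs'" "length hs' = length gs" by (cases hs) auto
    have "hs' \<noteq> []" using h cons.hyps by auto
    hence "cprod hs x = (\<Sum>(a, b)\<leftarrow>D.rep x. h a * cprod hs' b)"
      using h hs cons.prems by (simp add: cprod_Cons D.cv_rep lin_cprod)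
    also have "\<dots> = (\<Sum>(a, b)\<leftarrow>D.rep x. h a * (\<Sum>v\<leftarrow>q b. app hs' v))"
      using q r h hs by (intro arg_cong[where f=sum_list] map_cong) auto
    also have "\<dots> = (\<Sum>v\<leftarrow>us. app hs v)"
      by (simp add: us_def map_concat sum_list_concat o_def case_prod_unfold h sum_list_const_mult)
    finally show "cprod hs x = (\<Sum>v\<leftarrow>us. app hs v)" .
  qed
qed

lemma F_tensors:
  assumes x: "x \<in> DD" and n: "n > 0" shows "F x n \<in> tensors sc n (G (Suc 0))"
proof -
  \<comment> \<open>A dummy list; only its length enters \<open>cprod_rep\<close>.\<close>
  have "replicate n (undefined :: 'd \<Rightarrow> 'k) \<noteq> []" using n by simp
  from cprod_rep[OF this x] obtain us where us: "\<And>v. v \<in> set us \<Longrightarrow> length v = n \<and> set v \<subseteq> DD"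
    "\<And>hs. length hs = n \<Longrightarrow> \<forall>h\<in>set hs. lin sd h \<Longrightarrow> cprod hs x = (\<Sum>v\<leftarrow>us. app hs v)" by auto
  define vs where "vs = map (map f1) us"
  have "F x n = sum_list (map (ptensl sc) vs)"
  proof
    fix fs :: "nat \<Rightarrow> 'h \<Rightarrow> 'k"
    have vl: "\<forall>v\<in>set vs. length v = n" using us(1) by (auto simp: vs_def)
    show "F x n fs = sum_list (map (ptensl sc) vs) fs"
    proof (cases "\<forall>i<n. lin sc (fs i)")
      case True
      have "F x n fs = (\<Sum>v\<leftarrow>us. app (map (\<lambda>i. pull1 (fs i)) [0..<n]) v)"
        unfolding F_def using n True by (simp, subst us(2)) (auto intro!: lin_f1)
      also have "\<dots> = (\<Sum>v\<leftarrow>us. \<Prod>i<n. fs i (map f1 v ! i))"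
      proof (intro arg_cong[where f=sum_list] map_cong refl)
        fix v assume v: "v \<in> set us"
        have "v ! i \<in> DD" if "i < n" for i using us(1)[OF v] that nth_mem by blast
        thus "app (map (\<lambda>i. pull1 (fs i)) [0..<n]) v = (\<Prod>i<n. fs i (map f1 v ! i))"
          using us(1)[OF v] by (simp add: app_map D.P)
      qed
      also have "\<dots> = sum_list (map (ptensl sc) vs) fs"
        unfolding sum_ptensl_eval[OF vl True] by (simp add: vs_def o_def)
      finally show ?thesis .
    next
      case False
      have "sum_list (map (ptensl sc) vs) \<in> tensors sc n UNIV" unfolding tensors_def using vl by blast
      from tensors_not_lin[OF this False] show ?thesis using False n by (auto simp: F_def)
    qed
  qed
  moreover have "\<forall>v\<in>set vs. length v = n \<and> set v \<subseteq> G (Suc 0)"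
    using us(1) f1_in by (fastforce simp: vs_def)
  ultimately show ?thesis unfolding tensors_def by blast
qed

lemma map_nth_upt: "map (\<lambda>i. h (xs ! i)) [0..<length xs] = map h xs"
  by (intro nth_equalityI) auto

lemma ev_F: "valid I \<Longrightarrow> ev I (F x) = pull I x"
proof (cases I)
  case (Inr gs)
  assume "valid I"
  hence "gs \<noteq> []" "\<forall>i<length gs. lin sc (gs ! i)" using Inr by auto
  thus ?thesis using Inr by (simp add: F_def map_nth_upt[of "\<lambda>g. pull1 g" gs])
qed (auto simp: F_def ptensl_def)

text \<open>In each Sweedler term the first functional needs an argument of degree 1, which leaves
  degree \<open>n - 1\<close> for the product of the others, and this is the wrong degree by
  induction.\<close>

lemma cprod_Gd:
  assumes "fs \<noteq> []" "\<And>f n x. f \<in> set fs \<Longrightarrow> n \<noteq> Suc 0 \<Longrightarrow> x \<in> Gd n \<Longrightarrow> f x = 0"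
    "\<And>f. f \<in> set fs \<Longrightarrow> lin sd f" "x \<in> Gd n" "n \<noteq> length fs"
  shows "cprod fs x = 0"
  using assms
proof (induction fs arbitrary: x n rule: list_nonempty_induct)
  case (single f)
  thus ?case by auto
next
  case (cons f fs)
  obtain ps where ps: "\<Delta>d x = ten2 sd ps" "\<And>a b. (a, b) \<in> set ps \<Longrightarrow> \<exists>i\<le>n. a \<in> Gd i \<and> b \<in> Gd (n - i)"
    using comult_Gd[OF cons.prems(3)] by blast
  have x: "x \<in> DD" using cons.prems Gd_DD by blast
  have "cprod (f # fs) x = (\<Sum>(a, b)\<leftarrow>ps. f a * cprod fs b)"
    using cons by (simp add: cprod_Cons D.cv_D[OF x] ps(1) ten2_eval lin_cprod)
  also have "\<dots> = 0"
  proof (rule sum_list_zero, clarify)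
    fix a b assume "(a, b) \<in> set ps"
    then obtain i where i: "i \<le> n" "a \<in> Gd i" "b \<in> Gd (n - i)" using ps(2) by blast
    show "f a * cprod fs b = 0"
    proof (cases "i = Suc 0")
      case True
      hence "cprod fs b = 0" using i cons.prems(1,2,4)
        by (intro cons.IH[of b "n - i"]) auto
      thus ?thesis by simp
    next
      case False
      thus ?thesis using cons.prems(1)[of f i a] i by simp
    qed
  qed
  finally show ?case .
qed

lemma lin_cprod_pull: "\<forall>i<n. lin sc (fs i) \<Longrightarrow> lin sd (cprod (map (\<lambda>i. pull1 (fs i)) [0..<n]))"
  by (rule lin_cprod) (auto intro: lin_f1)

lemma F_add: "F (x + y) = F x + F y"
  by (auto simp: F_def fun_eq_iff D.P f0_add ptensl_1_lin lin_add[OF lin_cprod_pull])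

lemma F_scale: "F (sd c x) = cscale c (F x)"
  by (auto simp: F_def fun_eq_iff D.P f0_scale ptensl_1_lin lin_scale[OF lin_cprod_pull] cscale_def tscale_def)

lemma F_Gd: "x \<in> Gd k \<Longrightarrow> n \<noteq> k \<Longrightarrow> F x n = 0"
proof -
  assume x: "x \<in> Gd k" "n \<noteq> k"
  have xD: "D.P y = y" if "y \<in> Gd k" for y k using that Gd_DD D.P(2) by blast
  show ?thesis
  proof (cases "n = 0")
    case True
    thus ?thesis using x f0_Gd xD[OF x(1)] by (auto simp: F_def ptensl_zero)
  next
    case False
    have "cprod (map (\<lambda>i. pull1 (fs i)) [0..<n]) x = 0" if "\<forall>i<n. lin sc (fs i)" for fs
      by (rule cprod_Gd[OF _ _ _ x(1)]) (use False x that in \<open>auto simp: xD f1_Gd lin_0 intro!: lin_f1\<close>)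
    thus ?thesis using False by (auto simp: F_def fun_eq_iff)
  qed
qed

lemma F_precot: "x \<in> DD \<Longrightarrow> F x \<in> precot"
proof -
  assume x: "x \<in> DD"
  \<comment> \<open>Finite support holds on homogeneous elements, where only one component survives,
    and is preserved by linear combinations; it then extends to \<open>DD\<close> by
    \<open>gen\<close>.\<close>
  let ?W = "{x. finite {n. F x n \<noteq> 0}}"
  have "DD \<subseteq> ?W"
  proof (rule gen)
    show "subspace_of sd ?W" unfolding subspace_of_def
    proof (intro conjI ballI allI)
      have "F 0 = 0" using F_add[of 0 0] by simp
      thus "0 \<in> ?W" by simp
    next
      fix x y assume "x \<in> ?W" "y \<in> ?W"
      moreover have "{n. F (x + y) n \<noteq> 0} \<subseteq> {n. F x n \<noteq> 0} \<union> {n. F y n \<noteq> 0}" by (auto simp: F_add)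
      ultimately show "x + y \<in> ?W" by (auto intro: finite_subset)
    next
      fix c x assume "x \<in> ?W"
      moreover have "{n. F (sd c x) n \<noteq> 0} \<subseteq> {n. F x n \<noteq> 0}"
        by (auto simp: F_scale cscale_def tscale_def fun_eq_iff)
      ultimately show "sd c x \<in> ?W" by (auto intro: finite_subset)
    qed
    show "Gd n \<subseteq> ?W" for n
    proof
      fix x assume "x \<in> Gd n"
      hence "{k. F x k \<noteq> 0} \<subseteq> {n}" using F_Gd by auto
      thus "x \<in> ?W" by (auto intro: finite_subset)
    qed
  qed
  hence "finite {n. F x n \<noteq> 0}" using x by blast
  moreover have "F x 0 = ptensl sc [f0 x]" by (simp add: F_def D.P x)
  ultimately show ?thesis using F_tensors[OF x] f0_in[OF x] unfolding precot_def by blast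
qed

text \<open>\<open>pull\<close> turns the two sides of the balancing condition into two bracketings
  of a convolution on \<open>DD\<close>. Thus coassociativity of the source puts the image into the
  cotensor products.\<close>

lemma F_carrier: "x \<in> DD \<Longrightarrow> F x \<in> cot_carrier C"
  unfolding carrier_iff balanced_def
proof (intro conjI allI impI)
  fix A a B assume v: "valid (Inr A)" "valid (Inl a)" "valid (Inr B)"
  show "ev (mul (mul (Inr A) (Inl a)) (Inr B)) (F x) = ev (mul (Inr A) (mul (Inl a) (Inr B))) (F x)"
    using v by (simp add: ev_F pull_mul valid_mul D.cv_assoc lin_pull del: ev.simps mul.simps valid.simps pull.simps)
qed (rule F_precot)

lemma F_deg: "x \<in> Gd n \<Longrightarrow> F x \<in> cot_deg C n"
  using F_carrier Gd_DD F_Gd by (auto simp: cot_deg_def)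

lemma bilin_F: "bilin sd D' tscale (\<lambda>x y. ptensl cscale [F x, F y])"
  by (rule bilinI) (simp_all add: F_add F_scale ptensl_pair_lin)

lemma F_comult:
  assumes x: "x \<in> DD"
  shows "cot_comult C (F x) = tapp sd 2 DD (\<lambda>v. ptensl cscale [F (v ! 0), F (v ! 1)]) (\<Delta>d x)"
proof -
  have e: "tapp sd 2 DD (\<lambda>v. ptensl cscale [F (v ! 0), F (v ! 1)]) (\<Delta>d x) =
     (\<Sum>(a, b)\<leftarrow>D.rep x. ptensl cscale [F a, F b])"
    by (subst D.tapp_comult[OF vector_space_tscale D.sub order.refl _ x]) (simp_all add: bilin_F)
  show ?thesis unfolding e
  proof (rule cot_comult_eqI)
    show "cot_comult C (F x) \<in> tensors cscale 2 (cot_carrier C)" by (rule cot_comult_carrier[OF F_carrier[OF x]])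
    have "ptensl cscale [F a, F b] \<in> tensors cscale 2 (cot_carrier C)" if "(a, b) \<in> set (D.rep x)" for a b
    proof -
      have "a \<in> DD" "b \<in> DD" using D.rep(1)[OF x] that by blast+
      thus ?thesis by (intro ptensl_in_tensors) (auto simp: F_carrier)
    qed
    thus "(\<Sum>(a, b)\<leftarrow>D.rep x. ptensl cscale [F a, F b]) \<in> tensors cscale 2 (cot_carrier C)"
      by (intro tensors_sum_list) auto
    fix I J assume v: "valid I" "valid J"
    have "(\<Sum>(a, b)\<leftarrow>D.rep x. ptensl cscale [F a, F b]) (pr (ev I) (ev J)) = (\<Sum>(a, b)\<leftarrow>D.rep x. pull I a * pull J b)"
      by (simp add: sum_list_fun_apply o_def case_prod_unfold ptensl2_eval lin_ev ev_F v del: ev.simps pull.simps)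
    also have "\<dots> = D.cv (pull I) (pull J) x" by (simp add: D.cv_rep[OF x] lin_pull v del: pull.simps)
    also have "\<dots> = ev (mul I J) (F x)" by (simp add: pull_mul ev_F valid_mul v del: ev.simps pull.simps valid.simps mul.simps)
    finally show "cot_comult C (F x) (pr (ev I) (ev J)) = (\<Sum>(a, b)\<leftarrow>D.rep x. ptensl cscale [F a, F b]) (pr (ev I) (ev J))"
      using cot_comult_eval[OF F_precot[OF x] v] by simp
  qed
qed

lemma cot_part_F: "x \<in> DD \<Longrightarrow> cot_part 0 (F x) = f0 x"
  "x \<in> DD \<Longrightarrow> cot_part (Suc 0) (F x) = f1 x"
proof -
  assume x: "x \<in> DD"
  show "cot_part 0 (F x) = f0 x" using tapp_hd by (simp add: cot_part_def F_def D.P x)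
  have "F x (Suc 0) = ptensl sc [f1 x]"
    by (auto simp: F_def ptensl_def D.P x fun_eq_iff)
  thus "cot_part (Suc 0) (F x) = f1 x" using tapp_hd by (simp add: cot_part_def)
qed

text \<open>A pure functional of degree \<open>n \<ge> 2\<close> is a product of pure functionals of lower degree.\<close>

theorem F_unique:
  assumes c: "\<And>x. x \<in> DD \<Longrightarrow> F' x \<in> cot_carrier C"
    and a: "\<And>x y. x \<in> DD \<Longrightarrow> y \<in> DD \<Longrightarrow> F' (x + y) = F' x + F' y"
    and s: "\<And>c x. x \<in> DD \<Longrightarrow> F' (sd c x) = cscale c (F' x)"
    and d: "\<And>n x. x \<in> Gd n \<Longrightarrow> F' x \<in> cot_deg C n"
    and cm: "\<And>x. x \<in> DD \<Longrightarrow> cot_comult C (F' x) = tapp sd 2 DD (\<lambda>v. ptensl cscale [F' (v ! 0), F' (v ! 1)]) (\<Delta>d x)"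
    and e0: "\<And>x. x \<in> Gd 0 \<Longrightarrow> cot_part 0 (F' x) = f0 x"
    and e1: "\<And>x. x \<in> Gd (Suc 0) \<Longrightarrow> cot_part (Suc 0) (F' x) = f1 x"
    and x: "x \<in> DD"
  shows "F' x = F x"
proof -
  \<comment> \<open>On homogeneous elements of another degree both sides vanish, and in the matching
    degree they are the prescribed components. Linearity and \<open>gen\<close> extend the equality
    to all of \<open>DD\<close>.\<close>
  have low: "ev I (F' x) = ev I (F x)" if v: "valid I" and I: "(\<exists>a. I = Inl a) \<or> (\<exists>g. I = Inr [g])" and x: "x \<in> DD" for I x
  proof -
    let ?W = "{x \<in> DD. ev I (F' x) = ev I (F x)}"
    have "DD \<subseteq> ?W"
    proof (rule gen)
      have "F' (0 + 0) = F' 0 + F' 0" by (rule a) (use D.sub subspace_of_0 in blast)+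
      hence "F' 0 = 0" "F 0 = 0" using F_add[of 0 0] by simp_all
      thus "subspace_of sd ?W" unfolding subspace_of_def
        by (auto simp: a s F_add F_scale lin_add[OF lin_ev] lin_scale[OF lin_ev] subspace_of_0[OF D.sub]
           subspace_of_add[OF D.sub] subspace_of_scale[OF D.sub] simp del: ev.simps)
      show "Gd n \<subseteq> ?W" for n
      proof
        fix x assume x: "x \<in> Gd n"
        have xD: "x \<in> DD" using x Gd_DD by blast
        have "ev I (F' x) = ev I (F x)"
        proof (cases "deg I = n")
          case False
          thus ?thesis using ev_deg[OF d[OF x]] ev_deg[OF F_deg[OF x]] by simp
        next
          case True
          thus ?thesis using I v x xD carrier_precot[OF c[OF xD]] F_precot[OF xD]
            by (auto simp: ev_cot_part e0 e1 cot_part_F simp del: ev.simps)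
        qed
        thus "x \<in> ?W" using xD by simp
      qed
    qed
    thus ?thesis using x by blast
  qed
  have high: "gs \<noteq> [] \<Longrightarrow> valid (Inr gs) \<Longrightarrow> x \<in> DD \<Longrightarrow> ev (Inr gs) (F' x) = ev (Inr gs) (F x)" for gs x
  proof (induction gs arbitrary: x rule: list_nonempty_induct)
    case (single g)
    thus ?case using low by blast
  next
    case (cons g gs)
    have v: "valid (Inr [g])" "valid (Inr gs)" using cons by auto
    have b: "bilin sd DD tscale (\<lambda>x y. ptensl cscale [F' x, F' y])"
      by (rule bilinI) (simp_all add: a s ptensl_pair_lin)
    have r: "c \<in> DD" "d \<in> DD" if "(c, d) \<in> set (D.rep x)" for c d
      using D.rep(1)[OF cons.prems(2)] that by blast+
    have m: "Inr (g # gs) = mul (Inr [g]) (Inr gs)" by simp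
    have "ev (Inr (g # gs)) (F' x) = cot_comult C (F' x) (pr (ev (Inr [g])) (ev (Inr gs)))"
      unfolding m by (rule cot_comult_eval[OF carrier_precot[OF c[OF cons.prems(2)]] v, symmetric])
    also have "\<dots> = (\<Sum>(c, d)\<leftarrow>D.rep x. ev (Inr [g]) (F' c) * ev (Inr gs) (F' d))"
      unfolding cm[OF cons.prems(2)]
      by (subst D.tapp_comult[OF vector_space_tscale D.sub order.refl _ cons.prems(2)])
         (simp_all add: b sum_list_fun_apply o_def case_prod_unfold ptensl2_eval lin_ev del: ev.simps)
    also have "\<dots> = (\<Sum>(c, d)\<leftarrow>D.rep x. ev (Inr [g]) (F c) * ev (Inr gs) (F d))"
      using r by (intro arg_cong[where f=sum_list] map_cong refl)
        (auto simp: low[OF v(1)] cons.IH[OF v(2)] simp del: ev.simps)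
    also have "\<dots> = cot_comult C (F x) (pr (ev (Inr [g])) (ev (Inr gs)))"
      unfolding F_comult[OF cons.prems(2)]
      by (subst D.tapp_comult[OF vector_space_tscale D.sub order.refl _ cons.prems(2)])
         (simp_all add: bilin_F sum_list_fun_apply o_def case_prod_unfold ptensl2_eval lin_ev del: ev.simps)
    also have "\<dots> = ev (Inr (g # gs)) (F x)"
      unfolding m by (rule cot_comult_eval[OF F_precot[OF cons.prems(2)] v])
    finally show ?case .
  qed
  show ?thesis
  proof (rule precot_eq[OF carrier_precot[OF c[OF x]] F_precot[OF x]])
    fix I assume v: "valid I"
    show "ev I (F' x) = ev I (F x)"
    proof (cases I)
      case (Inl a)
      thus ?thesis using low[OF v _ x] by blast
    next
      case (Inr gs)
      thus ?thesis using high[OF _ _ x, of gs] v by auto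
    qed
  qed
qed

end

section \<open>The multiplication of the cotensor coalgebra\<close>

context graded_hopf_loc
begin

lemma gen_X:
  assumes W: "subspace_of sc W" "\<And>n. G n \<subseteq> W" shows "UNIV \<subseteq> W"
proof
  fix x
  have "(\<Sum>n | p n x \<noteq> 0. p n x) \<in> W"
    by (rule subspace_of_sum[OF W(1)]) (use W(2) p_in in blast)
  thus "x \<in> W" by (simp add: p_sum)
qed

lemma cot_map_X: "cot_map X sc UNIV \<Delta> G (p 0) (p (Suc 0))"
proof (intro cot_map.intro cot_map_axioms.intro)
  show "graded_hopf_loc X" "coalg sc UNIV \<Delta>" by unfold_locales
  show "\<exists>ps. \<Delta> x = ten2 sc ps \<and> (\<forall>(a, b)\<in>set ps. \<exists>i\<le>n. a \<in> G i \<and> b \<in> G (n - i))" if x: "x \<in> G n" for x n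
  proof -
    obtain ps where "\<Delta> x = ten2 sc ps" "\<And>a b. (a, b) \<in> set ps \<Longrightarrow> \<exists>i\<le>n. a \<in> G i \<and> b \<in> G (n - i)"
      using comult_G[OF x] by blast
    thus ?thesis by (intro exI[of _ ps]) auto
  qed
  show "cv (\<lambda>x. a (p 0 (P x))) (\<lambda>x. b (p 0 (P x))) x = cv a b (p 0 x)"
    if "valid (Inl a)" "valid (Inl b)" for a b x
    using that by (simp add: prj_UNIV cv_deg)
  show "cv (\<lambda>x. a (p 0 (P x))) (\<lambda>x. g (p (Suc 0) (P x))) x = cv a g (p (Suc 0) x)"
    "cv (\<lambda>x. g (p (Suc 0) (P x))) (\<lambda>x. a (p 0 (P x))) x = cv g a (p (Suc 0) x)"
    if "valid (Inl a)" "valid (Inr [g])" for a g x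
    using that by (simp_all add: prj_UNIV cv_deg)
qed (use gen_X in \<open>auto simp: p_in p_add p_scale p_G\<close>)

text \<open>The data that determine the multiplication of Cot: \<open>mult_part 0 0\<close> gives
  its degree 0, and the sum \<open>mult1\<close> of the two mixed parts, the left and the right
  action, gives its degree 1.\<close>

definition mult_part :: "nat \<Rightarrow> nat \<Rightarrow> (('h, 'k) cot, 'k) tensor \<Rightarrow> 'h" where
  "mult_part i k u = tapp cscale 2 (cot_carrier C) (\<lambda>v. m (cot_part i (v ! 0)) (cot_part k (v ! 1))) u"

lemma bilin_cot_part: "i \<le> 1 \<Longrightarrow> k \<le> 1 \<Longrightarrow> bilin cscale (cot_carrier C) sc (\<lambda>x y. m (cot_part i x) (cot_part k y))"
  by (rule bilinI) (simp_all add: cot_part_add cot_part_scale carrier_precot m_add m_scale del: One_nat_def)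

lemma mult_part_ten2: "i \<le> 1 \<Longrightarrow> k \<le> 1 \<Longrightarrow> set ps \<subseteq> cot_carrier C \<times> cot_carrier C \<Longrightarrow>
    mult_part i k (ten2 cscale ps) = (\<Sum>(x, y)\<leftarrow>ps. m (cot_part i x) (cot_part k y))"
  unfolding mult_part_def
  by (subst tapp2[OF vector_space_cscale vsX carrier_sub]) (simp_all add: bilin_cot_part nth1 del: One_nat_def)

lemma mult_part_ptensl: "i \<le> 1 \<Longrightarrow> k \<le> 1 \<Longrightarrow> x \<in> cot_carrier C \<Longrightarrow> y \<in> cot_carrier C \<Longrightarrow>
    mult_part i k (ptensl cscale [x, y]) = m (cot_part i x) (cot_part k y)"
  using mult_part_ten2[of i k "[(x, y)]"] by (simp add: ten2_simps del: One_nat_def)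

lemma mult_part_add: "i \<le> 1 \<Longrightarrow> k \<le> 1 \<Longrightarrow> u \<in> CC C \<Longrightarrow> v \<in> CC C \<Longrightarrow> mult_part i k (u + v) = mult_part i k u + mult_part i k v"
  unfolding mult_part_def CC_def
  by (rule tapp2_add[OF vector_space_cscale vsX carrier_sub]) (simp_all add: bilin_cot_part nth1 del: One_nat_def)

lemma mult_part_scale: "i \<le> 1 \<Longrightarrow> k \<le> 1 \<Longrightarrow> u \<in> CC C \<Longrightarrow> mult_part i k (tscale c u) = sc c (mult_part i k u)"
  unfolding mult_part_def CC_def
  by (rule tapp2_scale[OF vector_space_cscale vsX carrier_sub]) (simp_all add: bilin_cot_part nth1 del: One_nat_def)

lemma CC_rep:
  assumes "u \<in> CC C" obtains ps where "set ps \<subseteq> cot_carrier C \<times> cot_carrier C" "u = ten2 cscale ps"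
  using tensors2E[OF assms[unfolded CC_def]] by blast

lemma mult_part_in: assumes "i \<le> 1" "k \<le> 1" "u \<in> CC C" shows "mult_part i k u \<in> G (i + k)"
proof -
  obtain ps where ps: "set ps \<subseteq> cot_carrier C \<times> cot_carrier C" "u = ten2 cscale ps"
    using CC_rep[OF assms(3)] by blast
  have "m (cot_part i x) (cot_part k y) \<in> G (i + k)" if "(x, y) \<in> set ps" for x y
  proof -
    have "x \<in> precot" "y \<in> precot" using that ps(1) carrier_precot by blast+
    thus ?thesis by (intro m_G cot_part_precot assms)
  qed
  thus ?thesis unfolding ps(2) mult_part_ten2[OF assms(1,2) ps(1)]
    by (intro subspace_of_sum_list[OF G_sub]) auto
qed

lemma cot_part_deg: "x \<in> cot_deg C n \<Longrightarrow> i \<noteq> n \<Longrightarrow> cot_part i x = 0"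
  using tapp_hd[of 0] by (simp add: cot_part_def cot_deg_def ptensl_zero)

lemma mult_part_deg: assumes "i \<le> 1" "k \<le> 1" "u \<in> cc_deg C n" "i + k \<noteq> n" shows "mult_part i k u = 0"
proof -
  obtain ps where ps: "set ps \<subseteq> cot_carrier C \<times> cot_carrier C" "u = ten2 cscale ps"
    "\<And>x y. (x, y) \<in> set ps \<Longrightarrow> \<exists>i\<le>n. x \<in> cot_deg C i \<and> y \<in> cot_deg C (n - i)"
    using cc_deg_rep[OF assms(3)] by blast
  show ?thesis unfolding ps(2) mult_part_ten2[OF assms(1,2) ps(1)]
  proof (rule sum_list_zero, clarify)
    fix x y assume "(x, y) \<in> set ps"
    then obtain l where l: "l \<le> n" "x \<in> cot_deg C l" "y \<in> cot_deg C (n - l)" using ps(3) by blast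
    show "m (cot_part i x) (cot_part k y) = 0"
    proof (cases "i = l")
      case True
      hence "k \<noteq> n - l" using assms(4) l(1) by auto
      thus ?thesis using cot_part_deg[OF l(3)] by (simp add: m_0)
    next
      case False
      thus ?thesis using cot_part_deg[OF l(2)] by (simp add: m_0)
    qed
  qed
qed

text \<open>The part of \<open>cv f g (m x y)\<close> in which the Sweedler factors of
  \<open>x\<close> have degrees \<open>i\<close>, \<open>j\<close> and those of \<open>y\<close>
  have degrees \<open>k\<close>, \<open>l\<close>.\<close>

definition mult_sum where
  "mult_sum f g i j k l x y = (\<Sum>(a, b)\<leftarrow>rep x. \<Sum>(c, d)\<leftarrow>rep y. f (m (p i a) (p k c)) * g (m (p j b) (p l d)) :: 'k)"

lemma rep_cot_part':
  assumes "i + j \<le> 1" "x \<in> cot_carrier C" "lin sc f" "lin sc g"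
  shows "(\<Sum>(a, b)\<leftarrow>K.rep x. f (cot_part i a) * g (cot_part j b)) = (\<Sum>(a, b)\<leftarrow>rep (cot_part (i + j) x). f (p i a) * g (p j b))"
proof -
  have "(i, j) = (0, 0) \<or> (i, j) = (0, Suc 0) \<or> (i, j) = (Suc 0, 0)" using assms(1) by auto
  thus ?thesis using rep_cot_part[OF assms(2-4)] by (auto simp: cv_rep lin_p assms)
qed

text \<open>\<open>rep_cot_part'\<close> replaces a Sweedler sum in Cot by one in \<open>X\<close>
  for a single argument, the other being fixed; hence one replacement per argument with an exchange
  of summations in between.\<close>

lemma mult_sum_cot_part:
  assumes ij: "i + j \<le> 1" "k + l \<le> 1" and xy: "x \<in> cot_carrier C" "y \<in> cot_carrier C" and fg: "lin sc f" "lin sc g"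
  shows "(\<Sum>(a, b)\<leftarrow>K.rep x. \<Sum>(c, d)\<leftarrow>K.rep y. f (m (cot_part i a) (cot_part k c)) * g (m (cot_part j b) (cot_part l d)))
    = mult_sum f g i j k l (cot_part (i + j) x) (cot_part (k + l) y)"
proof -
  have "(\<Sum>(a, b)\<leftarrow>K.rep x. \<Sum>(c, d)\<leftarrow>K.rep y. f (m (cot_part i a) (cot_part k c)) * g (m (cot_part j b) (cot_part l d))) =
    (\<Sum>(a, b)\<leftarrow>K.rep x. \<Sum>(c, d)\<leftarrow>rep (cot_part (k + l) y). f (m (cot_part i a) (p k c)) * g (m (cot_part j b) (p l d)))"
    by (intro arg_cong[where f=sum_list] map_cong refl, clarify)
      (rule rep_cot_part'[OF ij(2) xy(2) lin_m(2)[OF fg(1)] lin_m(2)[OF fg(2)]])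
  also have "\<dots> = (\<Sum>(c, d)\<leftarrow>rep (cot_part (k + l) y). \<Sum>(a, b)\<leftarrow>K.rep x. f (m (cot_part i a) (p k c)) * g (m (cot_part j b) (p l d)))"
    unfolding case_prod_unfold by (rule sum_list_swap)
  also have "\<dots> = (\<Sum>(c, d)\<leftarrow>rep (cot_part (k + l) y). \<Sum>(a, b)\<leftarrow>rep (cot_part (i + j) x). f (m (p i a) (p k c)) * g (m (p j b) (p l d)))"
    by (intro arg_cong[where f=sum_list] map_cong refl, clarify)
      (rule rep_cot_part'[OF ij(1) xy(1) lin_m(1)[OF fg(1)] lin_m(1)[OF fg(2)]])
  also have "\<dots> = mult_sum f g i j k l (cot_part (i + j) x) (cot_part (k + l) y)"
    unfolding mult_sum_def case_prod_unfold by (rule sum_list_swap)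
  finally show ?thesis .
qed

lemma rep_G_zero: "x \<in> G n \<Longrightarrow> i + j \<noteq> n \<Longrightarrow> lin sc f \<Longrightarrow> lin sc g \<Longrightarrow> (\<Sum>(a, b)\<leftarrow>rep x. f (p i a) * g (p j b)) = 0"
  using cv_eval_G(1)[of x n f g i j] by (simp add: cv_rep lin_p)

lemma mult_sum_zero1: assumes "x \<in> G n" "i + j \<noteq> n" "lin sc f" "lin sc g" shows "mult_sum f g i j k l x y = 0"
proof -
  have "mult_sum f g i j k l x y = (\<Sum>(c, d)\<leftarrow>rep y. \<Sum>(a, b)\<leftarrow>rep x. f (m (p i a) (p k c)) * g (m (p j b) (p l d)))"
    unfolding mult_sum_def case_prod_unfold by (rule sum_list_swap)
  also have "\<dots> = 0"
    by (rule sum_list_zero, clarify, rule rep_G_zero[OF assms(1,2) lin_m(1)[OF assms(3)] lin_m(1)[OF assms(4)]])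
  finally show ?thesis .
qed

lemma sum_list_cong_pairs:
  "(\<And>x y. (x, y) \<in> set ps \<Longrightarrow> f x y = g x y) \<Longrightarrow> (\<Sum>(x, y)\<leftarrow>ps. f x y) = (\<Sum>(x, y)\<leftarrow>ps. g x y)"
  by (rule arg_cong[where f=sum_list], rule map_cong) auto

lemma a_m: "valid (Inl a) \<Longrightarrow> a (m b c) = a (m (p 0 b) (p 0 c))"
  using p0_m[of b c] by (metis valid.simps(1))

lemma cv_m_00: "valid (Inl a) \<Longrightarrow> valid (Inl b) \<Longrightarrow> cv a b (m x y) = mult_sum a b 0 0 0 0 x y"
  by (simp add: comult_mult mult_sum_def p0_m[symmetric])

lemma g_m: "valid (Inr [g]) \<Longrightarrow> g (m a b) = g (m (p 0 a) (p (Suc 0) b)) + g (m (p (Suc 0) a) (p 0 b))"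
  using p1_m[of a b] lin_add[of sc g] by (metis list.set_intros(1) valid.simps(2))

text \<open>A functional of degree 1 sees a product through the degree splittings 0 + 1 and 1 + 0,
  and one of degree 0 through 0 + 0. Each splitting contributes one \<open>mult_sum\<close>.\<close>

lemma cv_m_01: "valid (Inl a) \<Longrightarrow> valid (Inr [g]) \<Longrightarrow> cv a g (m x y) = mult_sum a g 0 0 0 (Suc 0) x y + mult_sum a g 0 (Suc 0) 0 0 x y"
proof -
  assume v: "valid (Inl a)" "valid (Inr [g])"
  have "a (m b c) * g (m d e) = a (m (p 0 b) (p 0 c)) * g (m (p 0 d) (p (Suc 0) e)) +
      a (m (p 0 b) (p 0 c)) * g (m (p (Suc 0) d) (p 0 e))" for b c d e
    by (simp only: a_m[OF v(1), of b c] g_m[OF v(2), of d e] distrib_left)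
  hence "(\<Sum>(b, d)\<leftarrow>rep x. \<Sum>(c, e)\<leftarrow>rep y. a (m b c) * g (m d e)) =
    (\<Sum>(b, d)\<leftarrow>rep x. \<Sum>(c, e)\<leftarrow>rep y. a (m (p 0 b) (p 0 c)) * g (m (p 0 d) (p (Suc 0) e)) +
      a (m (p 0 b) (p 0 c)) * g (m (p (Suc 0) d) (p 0 e)))"
    by (intro sum_list_cong_pairs)
  thus ?thesis using v by (simp add: comult_mult) (simp add: mult_sum_def sum_list_addf case_prod_unfold)
qed

lemma cv_m_10: "valid (Inl a) \<Longrightarrow> valid (Inr [g]) \<Longrightarrow> cv g a (m x y) = mult_sum g a 0 0 (Suc 0) 0 x y + mult_sum g a (Suc 0) 0 0 0 x y"
proof -
  assume v: "valid (Inl a)" "valid (Inr [g])"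
  have "g (m d e) * a (m b c) = g (m (p 0 d) (p (Suc 0) e)) * a (m (p 0 b) (p 0 c)) +
      g (m (p (Suc 0) d) (p 0 e)) * a (m (p 0 b) (p 0 c))" for b c d e
    by (simp only: a_m[OF v(1), of b c] g_m[OF v(2), of d e] distrib_right)
  hence "(\<Sum>(d, b)\<leftarrow>rep x. \<Sum>(e, c)\<leftarrow>rep y. g (m d e) * a (m b c)) =
    (\<Sum>(d, b)\<leftarrow>rep x. \<Sum>(e, c)\<leftarrow>rep y. g (m (p 0 d) (p (Suc 0) e)) * a (m (p 0 b) (p 0 c)) +
      g (m (p (Suc 0) d) (p 0 e)) * a (m (p 0 b) (p 0 c)))"
    by (intro sum_list_cong_pairs)
  thus ?thesis using v by (simp add: comult_mult) (simp add: mult_sum_def sum_list_addf case_prod_unfold)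
qed

definition mult1 where "mult1 u = mult_part 0 (Suc 0) u + mult_part (Suc 0) 0 u"

lemma lin_mult_part: "i \<le> 1 \<Longrightarrow> k \<le> 1 \<Longrightarrow> lin sc f \<Longrightarrow> lin tscale (\<lambda>u. f (mult_part i k (Q.P u)))"
  by (simp add: lin_def Q.P mult_part_add mult_part_scale del: One_nat_def)

lemma lin_mult1: "lin sc f \<Longrightarrow> lin tscale (\<lambda>u. f (mult1 (Q.P u)))"
  using lin_mult_part[of 0 "Suc 0" f] lin_mult_part[of "Suc 0" 0 f] by (simp add: lin_def mult1_def algebra_simps)

lemma CC_ptensl: "x \<in> cot_carrier C \<Longrightarrow> y \<in> cot_carrier C \<Longrightarrow> ptensl cscale [x, y] \<in> CC C"
  unfolding CC_def by (rule ptensl_in_tensors) auto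

lemma mult_part_Pptensl: "i \<le> 1 \<Longrightarrow> k \<le> 1 \<Longrightarrow> x \<in> cot_carrier C \<Longrightarrow> y \<in> cot_carrier C \<Longrightarrow>
    mult_part i k (Q.P (ptensl cscale [x, y])) = m (cot_part i x) (cot_part k y)"
  by (simp add: Q.P CC_ptensl mult_part_ptensl del: One_nat_def)

lemma K_rep_in: "x \<in> cot_carrier C \<Longrightarrow> (a, b) \<in> set (K.rep x) \<Longrightarrow> a \<in> cot_carrier C \<and> b \<in> cot_carrier C"
  using K.rep(1) by blast

lemma cc_eval_cong:
  assumes ps: "set ps \<subseteq> cot_carrier C \<times> cot_carrier C" and l: "lin tscale \<Phi>" "lin tscale \<Psi>"
    and eq: "\<And>a c. a \<in> cot_carrier C \<Longrightarrow> c \<in> cot_carrier C \<Longrightarrow> \<Phi> (ptensl cscale [a, c]) = \<Phi>' a c"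
     "\<And>a c. a \<in> cot_carrier C \<Longrightarrow> c \<in> cot_carrier C \<Longrightarrow> \<Psi> (ptensl cscale [a, c]) = \<Psi>' a c"
  shows "Q.cv \<Phi> \<Psi> (ten2 cscale ps) = (\<Sum>(x, y)\<leftarrow>ps. \<Sum>(a, b)\<leftarrow>K.rep x. \<Sum>(c, d)\<leftarrow>K.rep y. \<Phi>' a c * \<Psi>' b d)"
proof -
  have "ten2 cscale ps \<in> CC C" unfolding CC_def by (rule ten2_in[OF ps])
  hence "Q.cv \<Phi> \<Psi> (ten2 cscale ps) = (\<Sum>(x, y)\<leftarrow>ps. \<Sum>(a, b)\<leftarrow>K.rep x. \<Sum>(c, d)\<leftarrow>K.rep y.
     \<Phi> (ptensl cscale [a, c]) * \<Psi> (ptensl cscale [b, d]))"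
    by (simp add: Q.cv_D cc_comult_eval[OF ps l])
  also have "\<dots> = (\<Sum>(x, y)\<leftarrow>ps. \<Sum>(a, b)\<leftarrow>K.rep x. \<Sum>(c, d)\<leftarrow>K.rep y. \<Phi>' a c * \<Psi>' b d)"
  proof (intro arg_cong[where f=sum_list] map_cong refl, clarify, intro arg_cong[where f=sum_list] map_cong refl,
      clarify, intro arg_cong[where f=sum_list] map_cong refl, clarify)
    fix x y a b c d assume "(x, y) \<in> set ps" "(a, b) \<in> set (K.rep x)" "(c, d) \<in> set (K.rep y)"
    hence "a \<in> cot_carrier C" "b \<in> cot_carrier C" "c \<in> cot_carrier C" "d \<in> cot_carrier C"
      using ps K_rep_in by blast+
    thus "\<Phi> (ptensl cscale [a, c]) * \<Psi> (ptensl cscale [b, d]) = \<Phi>' a c * \<Psi>' b d" by (simp add: eq)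
  qed
  finally show ?thesis .
qed

lemma cv_sum_pairs: "cv a b (\<Sum>(x, y)\<leftarrow>ps. h x y) = (\<Sum>(x, y)\<leftarrow>ps. cv a b (h x y))"
  by (simp add: lin_sum_list[OF lin_cv] o_def case_prod_unfold)

text \<open>The compatibility conditions express that the product of \<open>X\<^sub>0\<close>
  respects comultiplication and that its actions on \<open>X\<^sub>1\<close> respect the coactions.
  All of them come from multiplicativity of \<open>\<Delta>\<close> on \<open>X\<close>, sorted by
  degree.\<close>

lemma cot_map_CC: "cot_map X tscale (CC C) (cc_comult C) (cc_deg C) (mult_part 0 0) mult1"
proof (intro cot_map.intro cot_map_axioms.intro)
  show "graded_hopf_loc X" "coalg tscale (CC C) (cc_comult C)" by unfold_locales
  show "\<exists>ps. cc_comult C x = ten2 tscale ps \<and> (\<forall>(a, b)\<in>set ps. \<exists>i\<le>n. a \<in> cc_deg C i \<and> b \<in> cc_deg C (n - i))"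
    if x: "x \<in> cc_deg C n" for x n
  proof -
    obtain ps where "cc_comult C x = ten2 tscale ps" "\<And>a b. (a, b) \<in> set ps \<Longrightarrow> \<exists>i\<le>n. a \<in> cc_deg C i \<and> b \<in> cc_deg C (n - i)"
      using cc_comult_deg[OF x] by blast
    thus ?thesis by (intro exI[of _ ps]) auto
  qed
  show "cc_deg C n \<subseteq> CC C" for n using cc_deg_CC by blast
  show "mult_part 0 0 x \<in> G 0" "mult1 x \<in> G (Suc 0)" if "x \<in> CC C" for x
    using mult_part_in[OF _ _ that, of 0 0] mult_part_in[OF _ _ that, of 0 1] mult_part_in[OF _ _ that, of 1 0] subspace_of_add[OF G_sub]
    by (auto simp: mult1_def)
  show "mult_part 0 0 (x + y) = mult_part 0 0 x + mult_part 0 0 y" "mult1 (x + y) = mult1 x + mult1 y" if "x \<in> CC C" "y \<in> CC C" for x y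
    using that by (simp_all add: mult_part_add mult1_def)
  show "mult_part 0 0 (tscale c x) = sc c (mult_part 0 0 x)" "mult1 (tscale c x) = sc c (mult1 x)" if "x \<in> CC C" for x c
  proof -
    interpret v: vector_space sc by (rule vsX)
    show "mult_part 0 0 (tscale c x) = sc c (mult_part 0 0 x)" "mult1 (tscale c x) = sc c (mult1 x)"
      using that by (simp_all add: mult_part_scale mult1_def v.scale_right_distrib)
  qed
  show "mult_part 0 0 x = 0" if "x \<in> cc_deg C n" "n \<noteq> 0" for x n
    using mult_part_deg[OF _ _ that(1), of 0 0] that(2) by simp
  show "mult1 x = 0" if "x \<in> cc_deg C n" "n \<noteq> Suc 0" for x n
    using mult_part_deg[OF _ _ that(1), of 0 1] mult_part_deg[OF _ _ that(1), of 1 0] that(2) by (simp add: mult1_def)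
next
  fix u a b assume u: "u \<in> CC C" and v: "valid (Inl a)" "valid (Inl b)"
  obtain ps where ps: "set ps \<subseteq> cot_carrier C \<times> cot_carrier C" "u = ten2 cscale ps" using CC_rep[OF u] by blast
  have l: "lin sc a" "lin sc b" using v by auto
  have "Q.cv (\<lambda>u. a (mult_part 0 0 (Q.P u))) (\<lambda>u. b (mult_part 0 0 (Q.P u))) u = (\<Sum>(x, y)\<leftarrow>ps. \<Sum>(a', b')\<leftarrow>K.rep x. \<Sum>(c, d)\<leftarrow>K.rep y.
    a (m (cot_part 0 a') (cot_part 0 c)) * b (m (cot_part 0 b') (cot_part 0 d)))"
    unfolding ps(2) by (rule cc_eval_cong[OF ps(1)]) (use l in \<open>simp_all add: lin_mult_part mult_part_Pptensl\<close>)
  also have "\<dots> = (\<Sum>(x, y)\<leftarrow>ps. cv a b (m (cot_part 0 x) (cot_part 0 y)))"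
  proof (rule sum_list_cong_pairs)
    fix x y assume "(x, y) \<in> set ps"
    hence xy: "x \<in> cot_carrier C" "y \<in> cot_carrier C" using ps(1) by auto
    show "(\<Sum>(a', b')\<leftarrow>K.rep x. \<Sum>(c, d)\<leftarrow>K.rep y. a (m (cot_part 0 a') (cot_part 0 c)) * b (m (cot_part 0 b') (cot_part 0 d))) =
       cv a b (m (cot_part 0 x) (cot_part 0 y))"
      using mult_sum_cot_part[OF _ _ xy l, of 0 0 0 0] by (simp add: cv_m_00 v del: valid.simps)
  qed
  also have "\<dots> = cv a b (mult_part 0 0 u)" unfolding ps(2) by (simp add: mult_part_ten2 ps(1) cv_sum_pairs)
  finally show "Q.cv (\<lambda>u. a (mult_part 0 0 (Q.P u))) (\<lambda>u. b (mult_part 0 0 (Q.P u))) u = cv a b (mult_part 0 0 u)" .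
next
  fix u a g assume u: "u \<in> CC C" and v: "valid (Inl a)" "valid (Inr [g])"
  obtain ps where ps: "set ps \<subseteq> cot_carrier C \<times> cot_carrier C" "u = ten2 cscale ps" using CC_rep[OF u] by blast
  have l: "lin sc a" "lin sc g" using v by auto
  have mf: "mult1 u = (\<Sum>(x, y)\<leftarrow>ps. m (cot_part 0 x) (cot_part (Suc 0) y) + m (cot_part (Suc 0) x) (cot_part 0 y))"
    unfolding ps(2) mult1_def by (simp add: mult_part_ten2 ps(1) sum_list_addf case_prod_unfold)
  have "Q.cv (\<lambda>u. a (mult_part 0 0 (Q.P u))) (\<lambda>u. g (mult1 (Q.P u))) u = (\<Sum>(x, y)\<leftarrow>ps. \<Sum>(a', b')\<leftarrow>K.rep x. \<Sum>(c, d)\<leftarrow>K.rep y.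
    a (m (cot_part 0 a') (cot_part 0 c)) * (g (m (cot_part 0 b') (cot_part (Suc 0) d)) + g (m (cot_part (Suc 0) b') (cot_part 0 d))))"
    unfolding ps(2) by (rule cc_eval_cong[OF ps(1)])
      (use l in \<open>simp_all add: lin_mult_part lin_mult1, simp_all add: mult1_def mult_part_Pptensl lin_add[OF l(2)]\<close>)
  also have "\<dots> = (\<Sum>(x, y)\<leftarrow>ps. cv a g (m (cot_part 0 x) (cot_part (Suc 0) y) + m (cot_part (Suc 0) x) (cot_part 0 y)))"
  proof (rule sum_list_cong_pairs)
    fix x y assume "(x, y) \<in> set ps"
    hence xy: "x \<in> cot_carrier C" "y \<in> cot_carrier C" using ps(1) by auto
    have c: "cot_part 0 x \<in> G 0" "cot_part (Suc 0) x \<in> G (Suc 0)" using cot_part_precot(1)[of x] carrier_precot[OF xy(1)] by auto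
    \<comment> \<open>Expanding the right-hand side by \<open>cv_m_01\<close> yields four terms. In
      two of them the degrees of the Sweedler factors of \<open>x\<close> do not add up to the
      degree of the component of \<open>x\<close>, so these vanish; the other two match the
      left-hand side.\<close>
    show "(\<Sum>(a', b')\<leftarrow>K.rep x. \<Sum>(c, d)\<leftarrow>K.rep y.
      a (m (cot_part 0 a') (cot_part 0 c)) * (g (m (cot_part 0 b') (cot_part (Suc 0) d)) + g (m (cot_part (Suc 0) b') (cot_part 0 d)))) =
      cv a g (m (cot_part 0 x) (cot_part (Suc 0) y) + m (cot_part (Suc 0) x) (cot_part 0 y))"
      using mult_sum_cot_part[OF _ _ xy l, of 0 0 0 "Suc 0"] mult_sum_cot_part[OF _ _ xy l, of 0 "Suc 0" 0 0]
        mult_sum_zero1[OF c(1) _ l, of 0 "Suc 0"] mult_sum_zero1[OF c(2) _ l, of 0 0]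
      by (simp add: cv_m_01 v lin_add[OF lin_cv] distrib_left case_prod_unfold sum_list_addf del: valid.simps)
  qed
  also have "\<dots> = cv a g (mult1 u)" unfolding mf by (simp add: cv_sum_pairs)
  finally show "Q.cv (\<lambda>u. a (mult_part 0 0 (Q.P u))) (\<lambda>u. g (mult1 (Q.P u))) u = cv a g (mult1 u)" .
  have "Q.cv (\<lambda>u. g (mult1 (Q.P u))) (\<lambda>u. a (mult_part 0 0 (Q.P u))) u = (\<Sum>(x, y)\<leftarrow>ps. \<Sum>(a', b')\<leftarrow>K.rep x. \<Sum>(c, d)\<leftarrow>K.rep y.
    (g (m (cot_part 0 a') (cot_part (Suc 0) c)) + g (m (cot_part (Suc 0) a') (cot_part 0 c))) * a (m (cot_part 0 b') (cot_part 0 d)))"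
    unfolding ps(2) by (rule cc_eval_cong[OF ps(1)])
      (use l in \<open>simp_all add: lin_mult_part lin_mult1, simp_all add: mult1_def mult_part_Pptensl lin_add[OF l(2)]\<close>)
  also have "\<dots> = (\<Sum>(x, y)\<leftarrow>ps. cv g a (m (cot_part 0 x) (cot_part (Suc 0) y) + m (cot_part (Suc 0) x) (cot_part 0 y)))"
  proof (rule sum_list_cong_pairs)
    fix x y assume "(x, y) \<in> set ps"
    hence xy: "x \<in> cot_carrier C" "y \<in> cot_carrier C" using ps(1) by auto
    have c: "cot_part 0 x \<in> G 0" "cot_part (Suc 0) x \<in> G (Suc 0)" using cot_part_precot(1)[of x] carrier_precot[OF xy(1)] by auto
    show "(\<Sum>(a', b')\<leftarrow>K.rep x. \<Sum>(c, d)\<leftarrow>K.rep y.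
      (g (m (cot_part 0 a') (cot_part (Suc 0) c)) + g (m (cot_part (Suc 0) a') (cot_part 0 c))) * a (m (cot_part 0 b') (cot_part 0 d))) =
      cv g a (m (cot_part 0 x) (cot_part (Suc 0) y) + m (cot_part (Suc 0) x) (cot_part 0 y))"
      using mult_sum_cot_part[OF _ _ xy l(2,1), of 0 0 "Suc 0" 0] mult_sum_cot_part[OF _ _ xy l(2,1), of "Suc 0" 0 0 0]
        mult_sum_zero1[OF c(1) _ l(2,1), of "Suc 0" 0] mult_sum_zero1[OF c(2) _ l(2,1), of 0 0]
      by (simp add: cv_m_10 v lin_add[OF lin_cv] distrib_right case_prod_unfold sum_list_addf del: valid.simps)
  qed
  also have "\<dots> = cv g a (mult1 u)" unfolding mf by (simp add: cv_sum_pairs)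
  finally show "Q.cv (\<lambda>u. g (mult1 (Q.P u))) (\<lambda>u. a (mult_part 0 0 (Q.P u))) u = cv g a (mult1 u)" .
qed (use cc_gen in blast)

text \<open>\<open>J.F\<close> is the morphism \<open>j\<close> out of \<open>X\<close>;
  \<open>M.F\<close> is the multiplication of Cot as a map on its tensor square.\<close>

interpretation J: cot_map X sc UNIV \<Delta> G "p 0" "p (Suc 0)" by (rule cot_map_X)
interpretation M: cot_map X tscale "CC C" "cc_comult C" "cc_deg C" "mult_part 0 0" mult1 by (rule cot_map_CC)

text \<open>\<open>A\<close> and \<open>B\<close> are non-empty words, so the balancing condition
  reads only components of degree at least 2.\<close>

lemma balanced_low:
  assumes "\<And>k. k \<ge> 2 \<Longrightarrow> x k = 0" shows "balanced x"
  unfolding balanced_def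
proof (intro allI impI)
  fix A a B assume v: "valid (Inr A)" "valid (Inl a)" "valid (Inr B)"
  have "ev I x = 0" if "deg I \<ge> 2" for I using assms[of "deg I"] that by (cases I) auto
  moreover have "deg (Inr A) + deg (Inr B) \<ge> 2" using v by (cases A; cases B) auto
  ultimately show "ev (mul (mul (Inr A) (Inl a)) (Inr B)) x = ev (mul (Inr A) (mul (Inl a) (Inr B))) x"
    using v by (simp add: deg_mul valid_mul del: ev.simps mul.simps valid.simps deg.simps(2))
qed

lemma emb0_deg: "a \<in> G 0 \<Longrightarrow> emb0 C a \<in> cot_deg C 0"
  using emb0_precot[of a] balanced_low[of "emb0 C a"] by (auto simp: cot_deg_def carrier_iff emb0_def)

lemma emb1_deg: "a \<in> G (Suc 0) \<Longrightarrow> emb1 C a \<in> cot_deg C (Suc 0)"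
  using embn_precot[of "Suc 0" "ptensl sc [a]"] balanced_low[of "emb1 C a"]
  by (auto simp: cot_deg_def carrier_iff emb1_def embn_def ptensl_in_tensors)

lemma deg_emb: "x \<in> cot_deg C 0 \<Longrightarrow> x = emb0 C (cot_part 0 x)" "x \<in> cot_deg C (Suc 0) \<Longrightarrow> x = emb1 C (cot_part (Suc 0) x)"
proof -
  have *: "x = embn n (x n)" if "x \<in> cot_deg C n" for n
    using that by (auto simp: cot_deg_def embn_def fun_eq_iff)
  show "x \<in> cot_deg C 0 \<Longrightarrow> x = emb0 C (cot_part 0 x)" "x \<in> cot_deg C (Suc 0) \<Longrightarrow> x = emb1 C (cot_part (Suc 0) x)"
    using *[of 0] *[of "Suc 0"] emb_cot_part[of x] carrier_precot[of x] by (auto simp: cot_deg_def)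
qed

section \<open>Existence and uniqueness of the multiplication of Cot\<close>

lemma cot_counit_cot_part: "x \<in> precot \<Longrightarrow> cot_counit C x = \<epsilon> (cot_part 0 x)"
proof -
  assume x: "x \<in> precot"
  have "mlin sc UNIV 1 (*) (\<lambda>v. \<epsilon> (v ! 0))"
    by (auto simp: mlin_def lin_add[OF \<epsilon>_lin] lin_scale[OF \<epsilon>_lin])
  from tapp_sum_ptensl[OF vsX vector_space_field subspace_of_UNIV this, of "[[cot_part 0 x]]"]
  show ?thesis unfolding cot_counit_def using cot_part_precot(2)[OF x, of 0] by simp
qed

text \<open>The value 0 outside \<open>CC C\<close> is required by \<open>is_cot_mult\<close>, where
  it makes the description by \<open>THE\<close> determine the function on the whole type.\<close>

definition mu :: "(('h, 'k) cot, 'k) tensor \<Rightarrow> ('h, 'k) cot" where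
  "mu u = (if u \<in> CC C then M.F u else 0)"

lemma mu_comult:
  assumes u: "u \<in> CC C"
  shows "cot_comult C (mu u) = tapp tscale 2 (CC C) (\<lambda>v. ptensl cscale [mu (v ! 0), mu (v ! 1)]) (cc_comult C u)"
proof -
  have b: "bilin tscale (CC C) tscale (\<lambda>x y. ptensl cscale [mu x, mu y])"
    by (rule bilinI) (simp_all add: mu_def subspace_of_add[OF CC_sub] subspace_of_scale[OF CC_sub] M.F_add M.F_scale ptensl_pair_lin)
  have "tapp tscale 2 (CC C) (\<lambda>v. ptensl cscale [mu (v ! 0), mu (v ! 1)]) (cc_comult C u) =
    (\<Sum>(x, y)\<leftarrow>Q.rep u. ptensl cscale [mu x, mu y])"
    by (subst Q.tapp_comult[OF vector_space_tscale CC_sub order.refl _ u]) (simp_all add: b)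
  also have "\<dots> = (\<Sum>(x, y)\<leftarrow>Q.rep u. ptensl cscale [M.F x, M.F y])"
  proof (rule sum_list_cong_pairs)
    fix x y assume "(x, y) \<in> set (Q.rep u)"
    hence "x \<in> CC C" "y \<in> CC C" using Q.rep(1)[OF u] by auto
    thus "ptensl cscale [mu x, mu y] = ptensl cscale [M.F x, M.F y]" by (simp add: mu_def)
  qed
  also have "\<dots> = tapp tscale 2 (CC C) (\<lambda>v. ptensl cscale [M.F (v ! 0), M.F (v ! 1)]) (cc_comult C u)"
    by (subst Q.tapp_comult[OF vector_space_tscale CC_sub order.refl _ u]) (simp_all add: M.bilin_F)
  finally show ?thesis using M.F_comult[OF u] u by (simp add: mu_def)
qed

lemma mu_counit:
  assumes u: "u \<in> CC C" shows "cot_counit C (mu u) = cc_counit C u"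
proof -
  obtain ps where ps: "set ps \<subseteq> cot_carrier C \<times> cot_carrier C" "u = ten2 cscale ps" using CC_rep[OF u] by blast
  have cc: "cot_counit C x = \<epsilon> (cot_part 0 x)" if "x \<in> cot_carrier C" for x
    by (rule cot_counit_cot_part[OF carrier_precot[OF that]])
  have "bilin cscale (cot_carrier C) (*) (\<lambda>x y. cot_counit C x * cot_counit C y)"
    by (rule bilinI) (simp_all add: cc subspace_of_add[OF carrier_sub] subspace_of_scale[OF carrier_sub] cot_part_add cot_part_scale
       carrier_precot lin_add[OF \<epsilon>_lin] lin_scale[OF \<epsilon>_lin] algebra_simps)
  hence "cc_counit C u = (\<Sum>(x, y)\<leftarrow>ps. cot_counit C x * cot_counit C y)"
    unfolding cc_counit_def ps(2)
    by (subst tapp2[OF vector_space_cscale vector_space_field carrier_sub _ ps(1)]) simp_all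
  also have "\<dots> = (\<Sum>(x, y)\<leftarrow>ps. \<epsilon> (m (cot_part 0 x) (cot_part 0 y)))"
    by (rule sum_list_cong_pairs) (use ps(1) in \<open>auto simp: cc \<epsilon>_m\<close>)
  also have "\<dots> = \<epsilon> (mult_part 0 0 u)"
    unfolding ps(2) by (simp add: mult_part_ten2 ps(1) lin_sum_list[OF \<epsilon>_lin] o_def case_prod_unfold)
  also have "\<dots> = cot_counit C (mu u)"
    using u by (simp add: mu_def cc M.F_carrier M.cot_part_F)
  finally show ?thesis by simp
qed

lemma mu_ptensl_00:
  assumes "x \<in> cot_deg C 0" "y \<in> cot_deg C 0"
  shows "mu (ptensl cscale [x, y]) = emb0 C (m (cot_part 0 x) (cot_part 0 y))"
proof -
  have xy: "x \<in> cot_carrier C" "y \<in> cot_carrier C" using assms by (auto simp: cot_deg_def)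
  have u: "ptensl cscale [x, y] \<in> cc_deg C 0" using ptensl_cc_deg[OF assms] by simp
  have uc: "ptensl cscale [x, y] \<in> CC C" by (rule CC_ptensl[OF xy])
  have "mu (ptensl cscale [x, y]) \<in> cot_deg C 0" using M.F_deg[OF u] uc by (simp add: mu_def)
  from deg_emb(1)[OF this] show ?thesis
    using uc by (simp add: mu_def M.cot_part_F mult_part_ptensl xy)
qed

lemma mu_ptensl_1:
  assumes "x \<in> cot_deg C i" "y \<in> cot_deg C j" "i + j = Suc 0"
  shows "mu (ptensl cscale [x, y]) = emb1 C (m (cot_part 0 x) (cot_part (Suc 0) y) + m (cot_part (Suc 0) x) (cot_part 0 y))"
proof -
  have xy: "x \<in> cot_carrier C" "y \<in> cot_carrier C" using assms by (auto simp: cot_deg_def)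
  have u: "ptensl cscale [x, y] \<in> cc_deg C (Suc 0)" using ptensl_cc_deg[OF assms(1,2)] assms(3) by simp
  have uc: "ptensl cscale [x, y] \<in> CC C" by (rule CC_ptensl[OF xy])
  have "mu (ptensl cscale [x, y]) \<in> cot_deg C (Suc 0)" using M.F_deg[OF u] uc by (simp add: mu_def)
  from deg_emb(2)[OF this] show ?thesis
    using uc by (simp add: mu_def M.cot_part_F mult1_def mult_part_ptensl xy)
qed

lemma is_cot_mult_mu: "is_cot_mult C mu"
  unfolding is_cot_mult_def
proof (intro conjI allI ballI impI)
  show "mu u = 0" if "u \<notin> CC C" for u using that by (simp add: mu_def)
  show "mu u \<in> cot_carrier C" if "u \<in> CC C" for u using that by (simp add: mu_def M.F_carrier)
  show "mu (u + v) = mu u + mu v" if "u \<in> CC C" "v \<in> CC C" for u v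
    using that by (simp add: mu_def subspace_of_add[OF CC_sub] M.F_add)
  show "mu (tscale c u) = cscale c (mu u)" if "u \<in> CC C" for u c
    using that by (simp add: mu_def subspace_of_scale[OF CC_sub] M.F_scale)
  show "mu u \<in> cot_deg C n" if "u \<in> cc_deg C n" for u n
    using that M.F_deg[OF that] by (simp add: mu_def cc_deg_CC)
  show "mu (ptensl cscale [emb0 C a, emb0 C b]) = emb0 C (cmult C a b)" if "a \<in> cA C" "b \<in> cA C" for a b
    using that by (simp add: mu_ptensl_00 emb0_deg cot_part_emb)
  show "mu (ptensl cscale [emb0 C h, emb1 C n]) = emb1 C (clact C h n)" if "h \<in> cA C" "n \<in> cM C" for h n
    using that by (subst mu_ptensl_1[OF emb0_deg emb1_deg]) (simp_all add: cot_part_emb m_0)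
  show "mu (ptensl cscale [emb1 C n, emb0 C h]) = emb1 C (cract C n h)" if "h \<in> cA C" "n \<in> cM C" for h n
    using that by (subst mu_ptensl_1[OF emb1_deg emb0_deg]) (simp_all add: cot_part_emb m_0)
qed (simp_all add: mu_comult mu_counit)

lemma additive_ten2:
  fixes h h' :: "(('h, 'k) cot, 'k) tensor \<Rightarrow> 'h"
  assumes "\<And>u v. u \<in> CC C \<Longrightarrow> v \<in> CC C \<Longrightarrow> h (u + v) = h u + h v"
    "\<And>u v. u \<in> CC C \<Longrightarrow> v \<in> CC C \<Longrightarrow> h' (u + v) = h' u + h' v"
    and ps: "set ps \<subseteq> cot_carrier C \<times> cot_carrier C"
    and eq: "\<And>x y. (x, y) \<in> set ps \<Longrightarrow> h (ptensl cscale [x, y]) = h' (ptensl cscale [x, y])"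
  shows "h (ten2 cscale ps) = h' (ten2 cscale ps)"
proof -
  have "set qs \<subseteq> set ps \<Longrightarrow> h (ten2 cscale qs) = h' (ten2 cscale qs)" for qs
  proof (induction qs)
    case Nil
    have "0 \<in> CC C" by (rule subspace_of_0[OF CC_sub])
    hence "h 0 = 0" "h' 0 = 0" using assms(1)[of 0 0] assms(2)[of 0 0] by simp_all
    thus ?case by (simp only: ten2_simps)
  next
    case (Cons q qs)
    obtain x y where q: "q = (x, y)" by (cases q)
    have "ptensl cscale [x, y] \<in> CC C" using Cons.prems ps q by (intro CC_ptensl) auto
    moreover have "ten2 cscale qs \<in> CC C" unfolding CC_def by (rule ten2_in) (use Cons.prems ps in auto)
    ultimately show ?case using Cons q eq[of x y] assms(1,2) by (simp add: ten2_simps del: plus_fun_apply)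
  qed
  thus ?thesis by blast
qed

text \<open>\<open>M.F_unique\<close> reduces uniqueness to the components of degree 0 and 1.
  Tensors of these degrees are sums of pure tensors with homogeneous factors, which are of the form
  \<open>emb0\<close> or \<open>emb1\<close>, and on those the values are prescribed.\<close>

lemma cot_mult_eq: "cot_mult C = mu"
  unfolding cot_mult_def
proof (rule the_equality)
  fix \<mu> assume "is_cot_mult C \<mu>"
  hence z: "\<And>u. u \<notin> CC C \<Longrightarrow> \<mu> u = 0"
    and c: "\<And>u. u \<in> CC C \<Longrightarrow> \<mu> u \<in> cot_carrier C"
    and a: "\<And>u v. u \<in> CC C \<Longrightarrow> v \<in> CC C \<Longrightarrow> \<mu> (u + v) = \<mu> u + \<mu> v"
    and s: "\<And>c u. u \<in> CC C \<Longrightarrow> \<mu> (tscale c u) = cscale c (\<mu> u)"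
    and d: "\<And>n u. u \<in> cc_deg C n \<Longrightarrow> \<mu> u \<in> cot_deg C n"
    and cm: "\<And>u. u \<in> CC C \<Longrightarrow> cot_comult C (\<mu> u) =
          tapp tscale 2 (CC C) (\<lambda>v. ptensl cscale [\<mu> (v!0), \<mu> (v!1)]) (cc_comult C u)"
    and m00: "\<And>a b. a \<in> G 0 \<Longrightarrow> b \<in> G 0 \<Longrightarrow> \<mu> (ptensl cscale [emb0 C a, emb0 C b]) = emb0 C (m a b)"
    and m01: "\<And>h n. h \<in> G 0 \<Longrightarrow> n \<in> G (Suc 0) \<Longrightarrow> \<mu> (ptensl cscale [emb0 C h, emb1 C n]) = emb1 C (m h n)"
    and m10: "\<And>h n. h \<in> G 0 \<Longrightarrow> n \<in> G (Suc 0) \<Longrightarrow> \<mu> (ptensl cscale [emb1 C n, emb0 C h]) = emb1 C (m n h)"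
    unfolding is_cot_mult_def by simp_all
  have ca: "cot_part i (\<mu> (u + v)) = cot_part i (\<mu> u) + cot_part i (\<mu> v)" if "i \<le> 1" "u \<in> CC C" "v \<in> CC C" for i u v
    using that by (simp add: a cot_part_add c carrier_precot del: One_nat_def)
  have ci: "cot_part 0 x \<in> G 0" "cot_part (Suc 0) x \<in> G (Suc 0)" if "x \<in> cot_deg C n" for x n
    using cot_part_precot(1)[of x 0] cot_part_precot(1)[of x "Suc 0"] that carrier_precot[of x] by (auto simp: cot_deg_def)
  show "\<mu> = mu"
  proof
    fix u show "\<mu> u = mu u"
    proof (cases "u \<in> CC C")
      case True
      have "\<mu> u = M.F u"
      proof (rule M.F_unique[OF c a s d cm _ _ True])
        fix u assume u: "u \<in> cc_deg C 0"
        obtain ps where ps: "set ps \<subseteq> cot_carrier C \<times> cot_carrier C" "u = ten2 cscale ps"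
          "\<And>x y. (x, y) \<in> set ps \<Longrightarrow> \<exists>i\<le>0. x \<in> cot_deg C i \<and> y \<in> cot_deg C (0 - i)"
          using cc_deg_rep[OF u] by blast
        show "cot_part 0 (\<mu> u) = mult_part 0 0 u" unfolding ps(2)
        proof (rule additive_ten2[OF _ _ ps(1)])
          fix x y assume xy: "(x, y) \<in> set ps"
          hence d: "x \<in> cot_deg C 0" "y \<in> cot_deg C 0" using ps(3) by auto
          have "\<mu> (ptensl cscale [x, y]) = emb0 C (m (cot_part 0 x) (cot_part 0 y))"
            using m00[OF ci(1)[OF d(1)] ci(1)[OF d(2)]] deg_emb(1)[OF d(1)] deg_emb(1)[OF d(2)] by simp
          thus "cot_part 0 (\<mu> (ptensl cscale [x, y])) = mult_part 0 0 (ptensl cscale [x, y])"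
            using xy ps(1) by (auto simp: cot_part_emb mult_part_ptensl)
        qed (simp_all add: ca mult_part_add del: plus_fun_apply)
      next
        fix u assume u: "u \<in> cc_deg C (Suc 0)"
        obtain ps where ps: "set ps \<subseteq> cot_carrier C \<times> cot_carrier C" "u = ten2 cscale ps"
          "\<And>x y. (x, y) \<in> set ps \<Longrightarrow> \<exists>i\<le>Suc 0. x \<in> cot_deg C i \<and> y \<in> cot_deg C (Suc 0 - i)"
          using cc_deg_rep[OF u] by blast
        show "cot_part (Suc 0) (\<mu> u) = mult1 u" unfolding ps(2)
        proof (rule additive_ten2[OF _ _ ps(1)])
          fix x y assume xy: "(x, y) \<in> set ps"
          hence xyc: "x \<in> cot_carrier C" "y \<in> cot_carrier C" using ps(1) by auto
          obtain i where "i \<le> Suc 0" "x \<in> cot_deg C i" "y \<in> cot_deg C (Suc 0 - i)" using ps(3)[OF xy] by blast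
          hence "(x \<in> cot_deg C 0 \<and> y \<in> cot_deg C (Suc 0)) \<or> (x \<in> cot_deg C (Suc 0) \<and> y \<in> cot_deg C 0)"
            by (cases i) auto
          thus "cot_part (Suc 0) (\<mu> (ptensl cscale [x, y])) = mult1 (ptensl cscale [x, y])"
          proof (elim disjE conjE)
            assume d: "x \<in> cot_deg C 0" "y \<in> cot_deg C (Suc 0)"
            have "\<mu> (ptensl cscale [x, y]) = emb1 C (m (cot_part 0 x) (cot_part (Suc 0) y))"
              using m01[OF ci(1)[OF d(1)] ci(2)[OF d(2)]] deg_emb(1)[OF d(1)] deg_emb(2)[OF d(2)] by simp
            thus ?thesis using xyc cot_part_deg[OF d(1), of "Suc 0"] by (simp add: cot_part_emb mult1_def mult_part_ptensl m_0)
          next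
            assume d: "x \<in> cot_deg C (Suc 0)" "y \<in> cot_deg C 0"
            have "\<mu> (ptensl cscale [x, y]) = emb1 C (m (cot_part (Suc 0) x) (cot_part 0 y))"
              using m10[OF ci(1)[OF d(2)] ci(2)[OF d(1)]] deg_emb(2)[OF d(1)] deg_emb(1)[OF d(2)] by simp
            thus ?thesis using xyc cot_part_deg[OF d(1), of 0] by (simp add: cot_part_emb mult1_def mult_part_ptensl m_0)
          qed
        qed (simp_all add: ca mult1_def mult_part_add del: plus_fun_apply)
      qed
      thus ?thesis using True by (simp add: mu_def)
    qed (simp add: z mu_def)
  qed
qed (rule is_cot_mult_mu)

section \<open>The morphism \<open>j\<close> and its multiplicativity\<close>

lemma cot_times_F: "x \<in> cot_carrier C \<Longrightarrow> y \<in> cot_carrier C \<Longrightarrow> cot_times C x y = M.F (ptensl cscale [x, y])"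
  by (simp add: cot_times_def cot_mult_eq mu_def CC_ptensl)

text \<open>\<open>J.F\<close> respects comultiplication, so Sweedler sums of \<open>J.F x\<close>
  in Cot can be computed from those of \<open>x\<close> in \<open>X\<close>.\<close>

lemma J_rep:
  assumes "lin cscale f" "lin cscale g"
  shows "(\<Sum>(a, b)\<leftarrow>K.rep (J.F x). f a * g b) = (\<Sum>(a, b)\<leftarrow>rep x. f (J.F a) * g (J.F b))"
proof -
  have "J.F x \<in> cot_carrier C" by (rule J.F_carrier) simp
  hence "(\<Sum>(a, b)\<leftarrow>K.rep (J.F x). f a * g b) = cot_comult C (J.F x) (pr f g)"
    using assms by (simp add: K.rep(2) ten2_eval)
  also have "\<dots> = (\<Sum>(a, b)\<leftarrow>rep x. f (J.F a) * g (J.F b))"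
    unfolding J.F_comult[OF UNIV_I]
    by (subst tapp_comult[OF vector_space_tscale subspace_of_UNIV])
      (simp_all add: J.bilin_F sum_list_fun_apply o_def case_prod_unfold ptensl2_eval assms)
  finally show ?thesis .
qed

lemma lin_ptensl_pair:
  fixes s :: "'a::field \<Rightarrow> 'x::ab_group_add \<Rightarrow> 'x"
  shows "lin tscale f \<Longrightarrow> lin s (\<lambda>x. f (ptensl s [x, y]))" "lin tscale f \<Longrightarrow> lin s (\<lambda>x. f (ptensl s [y, x]))"
  by (simp_all add: lin_def ptensl_pair_lin del: plus_fun_apply)

text \<open>In principle two coalgebra morphisms out of the tensor square of \<open>X\<close> are
  compared in degrees 0 and 1. That square is not formed; instead both sides are tested on words, by
  induction on their length. Splitting off the first letter uses multiplicativity of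
  \<open>\<Delta>\<close> on the left and the comultiplication of the tensor square of Cot on the
  right.\<close>

lemma J_mult: "J.F (m x y) = cot_times C (J.F x) (J.F y)"
proof -
  have Jc: "J.F x \<in> cot_carrier C" for x by (rule J.F_carrier) simp
  have uc: "ptensl cscale [J.F x, J.F y] \<in> CC C" for x y by (rule CC_ptensl[OF Jc Jc])
  have low: "J.pull I (m x y) = M.pull I (ptensl cscale [J.F x, J.F y])" if "(\<exists>a. I = Inl a) \<or> (\<exists>g. I = Inr [g])" for I x y
    using that by (auto simp: prj_UNIV Q.P uc mult_part_ptensl Jc J.cot_part_F mult1_def p0_m p1_m)
  define T where "T x y = ptensl cscale [J.F x, J.F y]" for x y
  have high: "gs \<noteq> [] \<Longrightarrow> valid (Inr gs) \<Longrightarrow> \<forall>x y. J.pull (Inr gs) (m x y) = M.pull (Inr gs) (T x y)" for gs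
  proof (induction gs rule: list_nonempty_induct)
    case (single g)
    thus ?case using low unfolding T_def by blast
  next
    case (cons g gs)
    show ?case unfolding T_def
    proof (intro allI)
      fix x y
      have v: "valid (Inr [g])" "valid (Inr gs)" using cons by auto
      have mm: "Inr (g # gs) = mul (Inr [g]) (Inr gs)" by simp
      let ?f = "J.pull (Inr [g])" and ?g = "J.pull (Inr gs)" and ?f' = "M.pull (Inr [g])" and ?g' = "M.pull (Inr gs)"
      have l: "lin sc ?f" "lin sc ?g" "lin tscale ?f'" "lin tscale ?g'"
        using J.lin_pull M.lin_pull v by blast+
      have "M.pull (Inr (g # gs)) (ptensl cscale [J.F x, J.F y]) = Q.cv ?f' ?g' (ten2 cscale [(J.F x, J.F y)])"
        unfolding mm M.pull_mul[OF v] by (simp add: ten2_simps)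
      also have "\<dots> = (\<Sum>(a, b)\<leftarrow>K.rep (J.F x). \<Sum>(c, d)\<leftarrow>K.rep (J.F y). ?f' (ptensl cscale [a, c]) * ?g' (ptensl cscale [b, d]))"
        by (subst cc_eval_cong[OF _ l(3,4) refl refl]) (simp_all add: Jc)
      also have "\<dots> = (\<Sum>(a, b)\<leftarrow>K.rep (J.F x). \<Sum>(c, d)\<leftarrow>rep y. ?f' (ptensl cscale [a, J.F c]) * ?g' (ptensl cscale [b, J.F d]))"
        by (rule sum_list_cong_pairs) (rule J_rep[OF lin_ptensl_pair(2)[OF l(3)] lin_ptensl_pair(2)[OF l(4)]])
      also have "\<dots> = (\<Sum>(c, d)\<leftarrow>rep y. \<Sum>(a, b)\<leftarrow>K.rep (J.F x). ?f' (ptensl cscale [a, J.F c]) * ?g' (ptensl cscale [b, J.F d]))"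
        unfolding case_prod_unfold by (rule sum_list_swap)
      also have "\<dots> = (\<Sum>(c, d)\<leftarrow>rep y. \<Sum>(a, b)\<leftarrow>rep x. ?f' (ptensl cscale [J.F a, J.F c]) * ?g' (ptensl cscale [J.F b, J.F d]))"
        by (rule sum_list_cong_pairs) (rule J_rep[OF lin_ptensl_pair(1)[OF l(3)] lin_ptensl_pair(1)[OF l(4)]])
      also have "\<dots> = (\<Sum>(c, d)\<leftarrow>rep y. \<Sum>(a, b)\<leftarrow>rep x. ?f (m a c) * ?g (m b d))"
      proof (intro sum_list_cong_pairs)
        fix a b c d
        have "?f (m a c) = ?f' (ptensl cscale [J.F a, J.F c])" by (rule low) blast
        thus "?f' (ptensl cscale [J.F a, J.F c]) * ?g' (ptensl cscale [J.F b, J.F d]) = ?f (m a c) * ?g (m b d)"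
          using cons.IH[OF v(2)] by (simp add: T_def)
      qed
      also have "\<dots> = (\<Sum>(a, b)\<leftarrow>rep x. \<Sum>(c, d)\<leftarrow>rep y. ?f (m a c) * ?g (m b d))"
        unfolding case_prod_unfold by (rule sum_list_swap)
      also have "\<dots> = J.pull (Inr (g # gs)) (m x y)"
        unfolding mm J.pull_mul[OF v] comult_mult[OF l(1,2)] ..
      finally show "J.pull (Inr (g # gs)) (m x y) = M.pull (Inr (g # gs)) (ptensl cscale [J.F x, J.F y])" by simp
    qed
  qed
  show ?thesis unfolding cot_times_F[OF Jc Jc]
  proof (rule precot_eq[OF J.F_precot[OF UNIV_I] M.F_precot[OF uc]])
    fix I assume v: "valid I"
    have "J.pull I (m x y) = M.pull I (ptensl cscale [J.F x, J.F y])"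
    proof (cases I)
      case (Inl a)
      thus ?thesis using low by blast
    next
      case (Inr gs)
      hence "gs \<noteq> []" using v by auto
      thus ?thesis using high[of gs] v Inr unfolding T_def by blast
    qed
    thus "ev I (J.F (m x y)) = ev I (M.F (ptensl cscale [J.F x, J.F y]))"
      using v by (simp add: J.ev_F M.ev_F del: ev.simps J.pull.simps M.pull.simps valid.simps)
  qed
qed

lemma J_deg: "x \<in> G n \<Longrightarrow> J.F x \<in> cot_deg C n"
  by (rule J.F_deg)

lemma J_0: "x \<in> G 0 \<Longrightarrow> J.F x = emb0 C x"
  using deg_emb(1)[OF J_deg[of x 0]] by (simp add: J.cot_part_F p_G)

lemma J_1: "x \<in> G (Suc 0) \<Longrightarrow> J.F x = emb1 C x"
  using deg_emb(2)[OF J_deg[of x "Suc 0"]] by (simp add: J.cot_part_F p_G)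

text \<open>Generation of \<open>X\<close> in degrees 0 and 1 puts the image of \<open>J.F\<close>
  into \<open>qsym C\<close>. Conversely the image contains the generators of \<open>qsym C\<close>
  and is closed under its operations, since \<open>J.F\<close> is linear and multiplicative.\<close>

theorem qsym_hom_ex:
  assumes "generated_deg01 X"
  shows "\<exists>j. qsym_hom X j \<and> id_on_deg01 X j \<and> range j = qsym C"
proof (intro exI conjI)
  have Jin: "J.F x \<in> qsym C" for x
  proof -
    have "x \<in> alg_gen X (G 0 \<union> G 1)" using assms by (simp add: generated_deg01_def)
    thus ?thesis
    proof induction
      case (gen x)
      thus ?case by (auto simp: J_0 J_1 intro!: qsym.deg0 qsym.deg1)
    next
      case one
      show ?case using one_G by (simp add: J_0 qsym.deg0)
    qed (simp_all only: J.F_add J.F_scale J_mult qsym.intros)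
  qed
  show r: "range J.F = qsym C"
  proof
    show "range J.F \<subseteq> qsym C" using Jin by blast
    show "qsym C \<subseteq> range J.F"
    proof
      fix z assume "z \<in> qsym C"
      thus "z \<in> range J.F"
      proof induction
        case (deg0 a)
        thus ?case using J_0[of a] by (metis C_simps(2) rangeI)
      next
        case (deg1 a)
        thus ?case using J_1[of a] by (metis C_simps(3) rangeI)
      next
        case (add x y)
        then obtain a b where "x = J.F a" "y = J.F b" by blast
        thus ?case by (simp only: J.F_add[symmetric] rangeI)
      next
        case (scale x c)
        then obtain a where "x = J.F a" by blast
        thus ?case by (simp only: J.F_scale[symmetric] rangeI)
      next
        case (mult x y)
        then obtain a b where "x = J.F a" "y = J.F b" by blast
        thus ?case by (simp only: J_mult[symmetric] rangeI)
      qed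
    qed
  qed
  show "id_on_deg01 X J.F" by (simp add: id_on_deg01_def J_0 J_1)
  show "qsym_hom X J.F"
    unfolding qsym_hom_def Let_def
  proof (intro conjI allI ballI)
    show "range J.F \<subseteq> qsym C" using r by simp
    show "J.F (hone X) = cot_one C" using one_G by (simp add: cot_one_def J_0)
    show "cot_comult C (J.F x) = tapp sc 2 UNIV (\<lambda>v. ptensl cscale [J.F (v ! 0), J.F (v ! 1)]) (\<Delta> x)" for x
      by (rule J.F_comult) simp
    show "cot_counit C (J.F x) = \<epsilon> x" for x
      by (simp add: cot_counit_cot_part J.F_precot J.cot_part_F \<epsilon>_p0)
  qed (simp_all add: J.F_add J.F_scale J_mult J_deg)
qed

end

section \<open>Injectivity from a pairing\<close>

context graded_hopf_loc
begin

text \<open>The dual form of \<open>X\<^sub>n = X\<^sub>1 X\<^sub>n\<^sub>-\<^sub>1\<close>.\<close>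

lemma functional_zero_G:
  assumes gen: "generated_deg01 X" and n: "n \<ge> 2" and f: "lin sc f"
    and z: "\<And>a b. a \<in> G (Suc 0) \<Longrightarrow> b \<in> G (n - Suc 0) \<Longrightarrow> f (m a b) = 0" and y: "y \<in> G n"
  shows "f y = 0"
proof -
  \<comment> \<open>The degree and the functional are quantified inside the induction on generation,
    because a product is treated by fixing one factor, which changes the functional and possibly the
    degree.\<close>
  have good: "\<forall>n\<ge>2. \<forall>f. lin sc f \<longrightarrow> (\<forall>a\<in>G (Suc 0). \<forall>b\<in>G (n - Suc 0). f (m a b) = 0) \<longrightarrow> f (p n y) = 0" for y
  proof -
    have "y \<in> alg_gen X (G 0 \<union> G 1)" using gen by (simp add: generated_deg01_def)
    thus ?thesis
    proof induction
      case (gen x)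
      thus ?case by (auto simp: p_G lin_0)
    next
      case one
      thus ?case by (auto simp: p_G[OF one_G] lin_0)
    next
      case (mult x y)
      show ?case
      proof (intro allI impI)
        fix n f assume n: "(2::nat) \<le> n" and f: "lin sc f"
          and z: "\<forall>a\<in>G (Suc 0). \<forall>b\<in>G (n - Suc 0). f (m a b) = 0"
        have "f (m (p i x) (p (n - i) y)) = 0" if i: "i \<le> n" for i
        proof -
          consider "i = 0" | "i = Suc 0" | "i \<ge> 2" by linarith
          thus ?thesis
          proof cases
            case 1
            \<comment> \<open>Multiplication by \<open>p 0 x\<close> keeps \<open>a\<close> in
              degree 1, so the functional obtained from \<open>f\<close> by left multiplication with
              \<open>p 0 x\<close> again vanishes on these products, and the hypothesis for
              \<open>y\<close> applies to it.\<close>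
            have "\<forall>a\<in>G (Suc 0). \<forall>b\<in>G (n - Suc 0). f (m (p 0 x) (m a b)) = 0"
              using z m_G[OF p_in[of 0 x], of _ "Suc 0"] by (auto simp flip: m_assoc)
            thus ?thesis using mult.IH(2) n lin_m(2)[OF f, of "p 0 x"] 1 by auto
          next
            case 2
            thus ?thesis using z p_in by auto
          next
            case 3
            \<comment> \<open>By associativity the right factor is absorbed into \<open>b\<close>,
              which reaches degree \<open>n - 1\<close>. The functional obtained by right
              multiplication thus satisfies the hypothesis in degree \<open>i\<close>, where the
              assumption on \<open>x\<close> applies.\<close>
            have "\<forall>a\<in>G (Suc 0). \<forall>b\<in>G (i - Suc 0). f (m (m a b) (p (n - i) y)) = 0"
            proof (intro ballI)
              fix a b assume ab: "a \<in> G (Suc 0)" "b \<in> G (i - Suc 0)"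
              have "m b (p (n - i) y) \<in> G (i - Suc 0 + (n - i))" by (rule m_G[OF ab(2) p_in])
              moreover have "i - Suc 0 + (n - i) = n - Suc 0" using 3 i by simp
              ultimately show "f (m (m a b) (p (n - i) y)) = 0" using z ab(1) by (simp add: m_assoc)
            qed
            thus ?thesis using mult.IH(1) 3 lin_m(1)[OF f, of "p (n - i) y"] by auto
          qed
        qed
        thus "f (p n (m x y)) = 0" by (simp add: p_m lin_sum[OF f])
      qed
    next
      case (add x y)
      show ?case
      proof (intro allI impI)
        fix n f assume n: "(2::nat) \<le> n" and f: "lin sc f"
          and z: "\<forall>a\<in>G (Suc 0). \<forall>b\<in>G (n - Suc 0). f (m a b) = 0"
        have "f (p n x) = 0" "f (p n y) = 0" using add.IH n f z by blast+
        thus "f (p n (x + y)) = 0" by (simp add: p_add lin_add[OF f])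
      qed
    qed (simp add: p_scale lin_scale)
  qed
  show ?thesis using good[of y] n f z p_G[OF y, of n] by auto
qed

text \<open>\<open>j\<close> is an arbitrary morphism here and not just \<open>J.F\<close>, since
  the second clause of \<open>j_is_iso\<close> speaks about all of them.\<close>

theorem qsym_hom_inj:
  fixes Y :: "('b::ab_group_add, 'k) ghopf"
  assumes Y: "graded_hopf Y" "generated_deg01 Y" and \<psi>: "hopf_pairing X Y \<psi>" "graded_pairing X Y \<psi>"
    and nd: "\<And>h. h \<noteq> 0 \<Longrightarrow> \<exists>b. \<psi> h b \<noteq> 0"
    and j: "qsym_hom X j" "id_on_deg01 X j"
  shows "inj j"
proof -
  interpret Y: graded_hopf_loc Y by unfold_locales (rule Y)
  have l1: "lin sc (\<lambda>h. \<psi> h b)" for b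
    using \<psi>(1) unfolding hopf_pairing_def lin_def by (elim conjE, intro conjI) auto
  have l2: "lin (hscale Y) (\<psi> h)" for h
    using \<psi>(1) unfolding hopf_pairing_def lin_def by (elim conjE, intro conjI) auto
  have gr: "h \<in> G i \<Longrightarrow> b \<in> Y.G k \<Longrightarrow> i \<noteq> k \<Longrightarrow> \<psi> h b = 0" for i k h b
    using \<psi>(2) unfolding graded_pairing_def by blast
  have mult: "\<psi> h (Y.m b b') = cv (\<lambda>h. \<psi> h b) (\<lambda>h. \<psi> h b') h" for h b b'
  proof -
    have "bilin sc UNIV (*) (\<lambda>x y. \<psi> x b * \<psi> y b')"
      by (rule bilinI) (simp_all add: lin_add[OF l1] lin_scale[OF l1] algebra_simps)
    hence "tapp sc 2 UNIV (\<lambda>v. \<psi> (v!0) b * \<psi> (v!1) b') (\<Delta> h) = (\<Sum>(c, d)\<leftarrow>rep h. \<psi> c b * \<psi> d b')"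
      by (subst tapp_comult[OF vector_space_field subspace_of_UNIV]) simp_all
    moreover have "\<psi> h (Y.m b b') = tapp sc 2 UNIV (\<lambda>v. \<psi> (v!0) b * \<psi> (v!1) b') (\<Delta> h)"
      using \<psi>(1) unfolding hopf_pairing_def by blast
    ultimately show ?thesis by (simp add: cv_rep l1)
  qed
  have ja: "\<And>x y. j (x + y) = j x + j y" and js: "\<And>c x. j (sc c x) = cscale c (j x)"
    and jd: "\<And>n x. x \<in> G n \<Longrightarrow> j x \<in> cot_deg C n"
    and jc: "\<And>x. cot_comult C (j x) = tapp sc 2 UNIV (\<lambda>v. ptensl cscale [j (v!0), j (v!1)]) (\<Delta> x)"
    using j(1) unfolding qsym_hom_def Let_def by blast+
  have j0: "x \<in> G 0 \<Longrightarrow> j x = emb0 C x" and j1: "x \<in> G (Suc 0) \<Longrightarrow> j x = emb1 C x" for x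
    using j(2) unfolding id_on_deg01_def by (auto simp: Let_def)
  have jz: "j 0 = 0" using ja[of 0 0] by (simp only: add_0_right add_cancel_right_right)
  have jsum: "j (sum f S) = (\<Sum>i\<in>S. j (f i))" if "finite S" for f and S :: "nat set"
    using that by (induction S rule: finite_induct) (simp_all only: jz ja sum.empty sum.insert not_False_eq_True)
  \<comment> \<open>\<open>j\<close> commutes with taking homogeneous components, so its kernel is
    graded and injectivity can be checked degree by degree.\<close>
  have comp: "embn n (j x n) = j (p n x)" for n x
  proof -
    let ?S = "insert n {i. p i x \<noteq> 0}"
    have fS: "finite ?S" using p_fin by simp
    have "(\<Sum>i\<in>?S. p i x) = x" by (rule p_sum'[OF fS]) blast
    hence "j x = (\<Sum>i\<in>?S. j (p i x))"
      using jsum[OF fS, of "\<lambda>i. p i x"] by metis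
    hence "j x n = (\<Sum>i\<in>?S. j (p i x) n)" by (simp only: sum_fun_apply)
    also have "\<dots> = (\<Sum>i\<in>{n}. j (p i x) n)"
      by (rule sum.mono_neutral_right[OF fS]) (use jd[OF p_in] in \<open>auto simp: cot_deg_def\<close>)
    finally have e: "j x n = j (p n x) n" by simp
    have "embn n (j (p n x) n) = j (p n x)"
      using jd[OF p_in, of n x] by (auto simp: cot_deg_def embn_def fun_eq_iff)
    thus ?thesis using e by simp
  qed
  have hom: "x \<in> G n \<Longrightarrow> j x = 0 \<Longrightarrow> x = 0" for n x
  proof (induction n arbitrary: x rule: less_induct)
    case (less n)
    have c0: "cot_part k 0 = 0" for k using tapp_hd[of 0] by (simp add: cot_part_def ptensl_zero)
    consider "n = 0" | "n = Suc 0" | "n \<ge> 2" by linarith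
    thus ?case
    proof cases
      case 1
      hence "emb0 C x = 0" using j0 less.prems by metis
      thus ?thesis using cot_part_emb(1)[of x] c0 by metis
    next
      case 2
      hence "emb1 C x = 0" using j1 less.prems by metis
      thus ?thesis using cot_part_emb(4)[of x] c0 by metis
    next
      case 3
      \<comment> \<open>Pairing with \<open>b\<close> factors through \<open>j\<close>: by induction
        \<open>j\<close> is injective on \<open>G k\<close> and has a linear left inverse
        \<open>\<Gamma>\<close> there, and \<open>\<psi> a b\<close> depends only on the component
        of \<open>a\<close> in degree \<open>k\<close>, which \<open>\<Gamma>\<close> recovers from
        \<open>j a\<close>.\<close>
      have lift: "\<exists>F. lin cscale F \<and> (\<forall>a. F (j a) = \<psi> a b)" if k: "k < n" and b: "b \<in> Y.G k" for k b
      proof -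
        obtain \<Gamma> where \<Gamma>: "\<And>x y. \<Gamma> (x + y) = \<Gamma> x + \<Gamma> y" "\<And>c x. \<Gamma> (cscale c x) = sc c (\<Gamma> x)" "\<And>x. x \<in> G k \<Longrightarrow> \<Gamma> (j x) = x"
          using left_inverse_on[OF vsX vector_space_cscale G_sub ja js, of k] less.IH[OF k] by blast
        let ?F = "\<lambda>z. \<psi> (\<Gamma> (embn k (z k))) b"
        have "cscale c z k = tscale c (z k)" for c and z :: "('h, 'k) cot" by (simp add: cscale_def)
        hence "lin cscale ?F"
          by (simp add: lin_def embn_lin \<Gamma> lin_add[OF l1] lin_scale[OF l1])
        moreover have "?F (j a) = \<psi> a b" for a
        proof -
          have "?F (j a) = \<psi> (p k a) b" by (simp add: comp \<Gamma>(3)[OF p_in])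
          also have "\<dots> = (\<Sum>i\<in>{k}. \<psi> (p i a) b)" by simp
          also have "\<dots> = (\<Sum>i\<in>insert k {i. p i a \<noteq> 0}. \<psi> (p i a) b)"
            by (rule sum.mono_neutral_left) (use p_fin gr[OF p_in b] in auto)
          also have "\<dots> = \<psi> (\<Sum>i\<in>insert k {i. p i a \<noteq> 0}. p i a) b" by (rule lin_sum[OF l1, symmetric])
          also have "\<dots> = \<psi> a b" by (subst p_sum') (use p_fin in auto)
          finally show ?thesis .
        qed
        ultimately show ?thesis by blast
      qed
      have z: "\<psi> x (Y.m b b') = 0" if b: "b \<in> Y.G (Suc 0)" "b' \<in> Y.G (n - Suc 0)" for b b'
      proof -
        \<comment> \<open>Both 1 and \<open>n - 1\<close> are below \<open>n\<close> because
          \<open>n \<ge> 2\<close>. With both pairings factored through \<open>j\<close>, the value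
          \<open>\<psi> x (Y.m b b')\<close> becomes a value of the comultiplication at
          \<open>j x\<close>, which is 0.\<close>
        obtain F F' where F: "lin cscale F" "\<And>a. F (j a) = \<psi> a b" and F': "lin cscale F'" "\<And>a. F' (j a) = \<psi> a b'"
          using lift[of "Suc 0" b] lift[of "n - Suc 0" b'] b 3 by auto
        have bl: "bilin sc UNIV tscale (\<lambda>x y. ptensl cscale [j x, j y])"
          by (rule bilinI) (simp_all add: ja js ptensl_pair_lin del: plus_fun_apply)
        have "\<psi> x (Y.m b b') = (\<Sum>(c, d)\<leftarrow>rep x. F (j c) * F' (j d))"
          by (simp add: mult cv_rep l1 F F')
        also have "\<dots> = cot_comult C (j x) (pr F F')"
          unfolding jc by (subst tapp_comult[OF vector_space_tscale subspace_of_UNIV])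
            (simp_all add: bl sum_list_fun_apply o_def case_prod_unfold ptensl2_eval F(1) F'(1))
        also have "\<dots> = 0" using less.prems(2) by (simp add: cot_comult_def)
        finally show ?thesis .
      qed
      have "\<psi> x b = 0" for b
      proof -
        have "\<psi> x (Y.p k b) = 0" for k
        proof (cases "k = n")
          case True
          show ?thesis unfolding True
            by (rule Y.functional_zero_G[OF Y(2) 3 l2 z Y.p_in])
        next
          case False
          thus ?thesis using gr[OF less.prems(1) Y.p_in] by simp
        qed
        thus ?thesis using Y.lin_eq_sum_p[OF l2, of x b] by simp
      qed
      thus ?thesis using nd by blast
    qed
  qed
  have ker: "x = 0" if "j x = 0" for x
  proof -
    have "p n x = 0" for n
    proof (rule hom[OF p_in])
      have "embn n (j x n) = 0" using that by (auto simp: embn_def fun_eq_iff)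
      thus "j (p n x) = 0" by (simp only: comp)
    qed
    thus ?thesis using p_sum[of x] by simp
  qed
  show ?thesis
  proof (rule injI)
    fix x y assume e: "j x = j y"
    have "j (x - y) + j y = j y" using ja[of "x - y" y] e by simp
    hence "j (x - y) = 0" by (simp only: add_cancel_left_left)
    thus "x = y" using ker by fastforce
  qed
qed

text \<open>One half of two-sided non-degeneracy yields one of the two isomorphisms; the other half
  is used with the arguments of \<open>\<psi>\<close> exchanged.\<close>

theorem j_is_iso_of_pairing:
  fixes Y :: "('b::ab_group_add, 'k) ghopf"
  assumes "generated_deg01 X" "graded_hopf Y" "generated_deg01 Y" "hopf_pairing X Y \<psi>" "graded_pairing X Y \<psi>"
    and "\<And>h. h \<noteq> 0 \<Longrightarrow> \<exists>b. \<psi> h b \<noteq> 0"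
  shows "j_is_iso X"
proof -
  have "inj j" if "qsym_hom X j" "id_on_deg01 X j" for j
    using qsym_hom_inj[OF assms(2-6) that] .
  thus ?thesis unfolding j_is_iso_def using qsym_hom_ex[OF assms(1)] by (auto simp: bij_betw_def)
qed

end

theorem theorem3p2:
  fixes H :: "('h::ab_group_add, 'k::field) ghopf"
    and B :: "('b::ab_group_add, 'k) ghopf"
    and \<psi> :: "'h \<Rightarrow> 'b \<Rightarrow> 'k"
  assumes "graded_hopf H" and "graded_hopf B"
    and "generated_deg01 H" and "generated_deg01 B"
    and "hopf_pairing H B \<psi>" and "graded_pairing H B \<psi>" and "two_sided_nondeg \<psi>"
  shows "j_is_iso H \<and> j_is_iso B"
proof
  interpret H: graded_hopf_loc H by unfold_locales (rule assms(1))
  interpret B: graded_hopf_loc B by unfold_locales (rule assms(2))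
  show "j_is_iso H"
    by (rule H.j_is_iso_of_pairing[OF assms(3,2,4,5,6)]) (use assms(7) in \<open>auto simp: two_sided_nondeg_def\<close>)
  \<comment> \<open>The axioms of a Hopf pairing are symmetric: exchanging the arguments swaps the
    two unit conditions and the two product conditions.\<close>
  have "hopf_pairing B H (\<lambda>b h. \<psi> h b)"
    using assms(5) unfolding hopf_pairing_def by (auto simp: mult.commute)
  moreover have "graded_pairing B H (\<lambda>b h. \<psi> h b)"
    using assms(6) unfolding graded_pairing_def by metis
  ultimately show "j_is_iso B"
    by (rule B.j_is_iso_of_pairing[OF assms(4,1,3)]) (use assms(7) in \<open>auto simp: two_sided_nondeg_def\<close>)
qed

end
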